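(* Let $g \in L^2(\mathbb{R}^d)$ and let $T, S \subset \mathbb{R}^d$ be two countable sets such that the Gabor system $$\mathbf{G}(g,T,S) = \{ g(x-t)\, e^{2\pi i \langle s, x\rangle} : t \in T,\ s \in S\}$$ is an orthonormal basis in $L^2(\mathbb{R}^d)$. Then $$\sum_{t \in T} |g(x-t)|^2 = D(T) \quad \text{for a.e. } x \in \mathbb{R}^d$$ and $$\sum_{s \in S} |\widehat{g}(\xi-s)|^2 = D(S) \quad \text{for a.e. } \xi \in \mathbb{R}^d,$$ where $D(T)$ and $D(S)$ denote the uniform densities of $T$ and $S$, respectively.
   Context: The Gabor system $\mathbf{G}(g,T,S)$ is the family of functions of $x \in \mathbb{R}^d$ indexed by the pairs $(t,s) \in T \times S$; $g$ is complex-valued. The Fourier transform is $\widehat{g}(\xi) = \int_{\mathbb{R}^d} g(x) e^{-2\pi i \langle \xi, x\rangle}\,dx$ (extended to $L^2(\mathbb{R}^d)$ as a unitary operator in the usual way). A set $\Lambda \subset \mathbb{R}^d$ is said to be uniformly distributed if there exists a number $D(\Lambda)$ such that $$\frac{\#(\Lambda \cap (x + [0,r]^d))}{r^d} = D(\Lambda) + o(1), \quad r \to +\infty,$$ uniformly with respect to $x \in \mathbb{R}^d$; in this case $D(\Lambda)$ is called the uniform density of $\Lambda$. It is a previously known fact (Liu and Wang, "The uniformity of non-uniform Gabor bases", Lemma 2.2) that if $\mathbf{G}(g,T,S)$ is an orthonormal basis in $L^2(\mathbb{R}^d)$ then both $T$ and $S$ are uniformly distributed, and their uniform densities are positive and finite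 numbers satisfying $D(T)D(S) = 1$. Thus $D(T)$ and $D(S)$ are well defined in the claim. *)

theory Defs
  imports "HOL-Analysis.Analysis"
begin

text \<open>
  Elements of the Hilbert space of square integrable functions are rendered by representatives:
  Lebesgue measurable functions, with identities between them understood almost everywhere.
\<close>

definition L2 :: "(real ^ 'd \<Rightarrow> complex) set" where
  "L2 = {f \<in> borel_measurable lebesgue. integrable lebesgue (\<lambda>x. (cmod (f x))\<^sup>2)}"

definition L2_inner :: "(real ^ 'd \<Rightarrow> complex) \<Rightarrow> (real ^ 'd \<Rightarrow> complex) \<Rightarrow> complex" where
  "L2_inner f h = (LINT x|lebesgue. f x * cnj (h x))"

definition L2_norm :: "(real ^ 'd \<Rightarrow> complex) \<Rightarrow> real" where
  "L2_norm f = sqrt (LINT x|lebesgue. (cmod (f x))\<^sup>2)"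

definition L2_tendsto :: "(nat \<Rightarrow> real ^ 'd \<Rightarrow> complex) \<Rightarrow> (real ^ 'd \<Rightarrow> complex) \<Rightarrow> bool" where
  "L2_tendsto f h \<longleftrightarrow>
     (\<forall>n. f n \<in> L2) \<and> h \<in> L2 \<and> (\<lambda>n. L2_norm (\<lambda>x. f n x - h x)) \<longlonglongrightarrow> 0"

text \<open>
  An orthonormal basis is an orthonormal family whose finite linear combinations are dense.
  Orthonormality refers to the index, so members with distinct indices are distinct.
\<close>

definition L2_orthonormal_basis :: "'i set \<Rightarrow> ('i \<Rightarrow> real ^ 'd \<Rightarrow> complex) \<Rightarrow> bool" where
  "L2_orthonormal_basis I e \<longleftrightarrow>
     (\<forall>i\<in>I. e i \<in> L2) \<and>
     (\<forall>i\<in>I. \<forall>j\<in>I. L2_inner (e i) (e j) = (if i = j then 1 else 0)) \<and>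
     (\<forall>f\<in>L2. \<forall>\<epsilon>>0. \<exists>F c. finite F \<and> F \<subseteq> I \<and>
        L2_norm (\<lambda>x. f x - (\<Sum>i\<in>F. c i * e i x)) < \<epsilon>)"

definition gabor :: "(real ^ 'd \<Rightarrow> complex) \<Rightarrow> (real ^ 'd) \<times> (real ^ 'd) \<Rightarrow> real ^ 'd \<Rightarrow> complex" where
  "gabor g = (\<lambda>(t, s) x. g (x - t) * exp (2 * of_real pi * \<i> * of_real (s \<bullet> x)))"

definition fourier_integral :: "(real ^ 'd \<Rightarrow> complex) \<Rightarrow> real ^ 'd \<Rightarrow> complex" where
  "fourier_integral f \<xi> = (LINT x|lebesgue. f x * exp (- 2 * of_real pi * \<i> * of_real (\<xi> \<bullet> x)))"

text \<open>
  \<open>is_fourier_L2 g h\<close> says that \<open>h\<close> represents the Fourier transform of \<open>g \<in> L2\<close>: the continuous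
  extension from the dense subspace of functions that are both integrable and square integrable.
  By Plancherel's theorem such an \<open>h\<close> exists and is unique up to a null set, and it does not depend
  on the approximating sequence; \<open>fourier_L2\<close> picks one representative.
\<close>

definition is_fourier_L2 :: "(real ^ 'd \<Rightarrow> complex) \<Rightarrow> (real ^ 'd \<Rightarrow> complex) \<Rightarrow> bool" where
  "is_fourier_L2 g h \<longleftrightarrow>
     (\<exists>f. (\<forall>n. integrable lebesgue (f n)) \<and> L2_tendsto f g \<and>
          L2_tendsto (\<lambda>n. fourier_integral (f n)) h)"

definition fourier_L2 :: "(real ^ 'd \<Rightarrow> complex) \<Rightarrow> real ^ 'd \<Rightarrow> complex" where
  "fourier_L2 g = (SOME h. is_fourier_L2 g h)"

text \<open>
  The finiteness clause is needed because \<open>card\<close> is 0 on infinite sets.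
\<close>

definition has_uniform_density :: "(real ^ 'd) set \<Rightarrow> real \<Rightarrow> bool" where
  "has_uniform_density \<Lambda> D \<longleftrightarrow>
     (\<forall>x r. finite (\<Lambda> \<inter> (+) x ` cbox 0 (vec r))) \<and>
     uniform_limit UNIV
       (\<lambda>r x. real (card (\<Lambda> \<inter> (+) x ` cbox 0 (vec r))) / r ^ CARD('d)) (\<lambda>x. D) at_top"

definition uniform_density :: "(real ^ 'd) set \<Rightarrow> real" where
  "uniform_density \<Lambda> = (THE D. has_uniform_density \<Lambda> D)"

lemma has_uniform_density_unique:
  assumes "has_uniform_density \<Lambda> D" "has_uniform_density \<Lambda> D'"
  shows "D = D'"
proof -
  let ?f = "\<lambda>r. real (card (\<Lambda> \<inter> (+) 0 ` cbox 0 (vec r))) / r ^ CARD('a)"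
  have "(?f \<longlongrightarrow> D) at_top" "(?f \<longlongrightarrow> D') at_top"
    using assms[unfolded has_uniform_density_def]
    by (auto dest: tendsto_uniform_limitI[where x = 0])
  then show ?thesis
    by (rule tendsto_unique[OF trivial_limit_at_top_linorder])
qed

lemma uniform_density_eq: "has_uniform_density \<Lambda> D \<Longrightarrow> uniform_density \<Lambda> = D"
  unfolding uniform_density_def by (blast intro: has_uniform_density_unique)

end

theory Submission
  imports Defs "HOL-Probability.Characteristic_Functions"
begin

text \<open>
  Write \<open>G x\<close> for the sum of \<open>|g (x - t)|\<^sup>2\<close> over \<open>t \<in> T\<close> and \<open>F\<close> for the Fourier transform.

  Let \<open>E\<close> have finite positive measure. Expanding \<open>1\<^sub>E\<close> times the character with frequency \<open>\<eta>\<close> in the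
  basis gives, by Parseval, that the sum of \<open>|F (1\<^sub>E g(\<sqdot> - t)) (\<eta> - s)|\<^sup>2\<close> over all \<open>t\<close> and \<open>s\<close> equals
  \<open>|E|\<close>, for every \<open>\<eta>\<close> (\<open>gabor_time_Parseval\<close>). So the nonnegative function \<open>H\<close>, the sum over \<open>t\<close> of
  \<open>|F (1\<^sub>E g(\<sqdot> - t))|\<^sup>2\<close>, tiles space at level \<open>|E|\<close> when it is translated along \<open>S\<close>. Plancherel's theorem
  says that its integral is the integral of \<open>G\<close> over \<open>E\<close>.

  A nonnegative function \<open>H\<close> that tiles at a positive level \<open>c\<close> forces its set of translations to be
  uniformly distributed with density \<open>c / \<integral>H\<close>, read as \<open>0\<close> if \<open>\<integral>H = \<infinity>\<close>
  (\<open>tiling_uniform_density\<close>). Hence \<open>S\<close> has a uniform density, and the integral of \<open>G\<close> over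
  \<open>E\<close> is \<open>|E| / D(S)\<close> for every \<open>E\<close>. Bessel's inequality bounds the number of points of \<open>T\<close> in small balls
  (\<open>gabor_translates_locally_bounded\<close>), so \<open>G\<close> has a finite integral over one ball, and \<open>D(S) > 0\<close>.
  Therefore \<open>G = 1 / D(S)\<close> almost everywhere. This says that \<open>|g|\<^sup>2\<close>, which has integral \<open>1\<close>, tiles along \<open>T\<close> at
  level \<open>1 / D(S)\<close>; the tiling theorem yields \<open>D(T) = 1 / D(S)\<close>, and the first claim follows.
  Both uniform densities and the relation \<open>D(T) D(S) = 1\<close> thus come out of the argument.

  The second claim is the same argument with \<open>(T, S, g)\<close> replaced by \<open>(S, T, F g)\<close>. Instead of transporting
  the basis through \<open>F\<close>, one expands the function \<open>x \<mapsto> F 1\<^sub>E (\<eta> - x)\<close>; moving \<open>F\<close> from the indicator to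
  \<open>g\<close> in the coefficients produces the windowed transforms of \<open>F g\<close> (\<open>gabor_frequency_Parseval\<close>).

  Plancherel's theorem and the transform on square integrable functions are built from
  the self-dual Gaussian: the multiplication formula expresses the Gaussian-weighted
  integral of \<open>|F f|\<^sup>2\<close> as a Gaussian average of the autocorrelation of \<open>f\<close>, and the width tends to zero.
\<close>

section \<open>Affine changes of variables for Lebesgue measure\<close>

lemma lebesgue_affine_distr:
  fixes t :: "'a::euclidean_space"
  assumes "c \<noteq> 0"
  shows "lebesgue = density (distr lebesgue lebesgue (\<lambda>x. t + c *\<^sub>R x)) (\<lambda>_. ennreal (\<bar>c\<bar> ^ DIM('a)))"
    and measurable_lebesgue_affine: "(\<lambda>x. t + c *\<^sub>R x) \<in> lebesgue \<rightarrow>\<^sub>M lebesgue"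
proof -
  have T: "(\<lambda>x. t + (\<Sum>j\<in>Basis. (c * (x \<bullet> j)) *\<^sub>R j)) = (\<lambda>x. t + c *\<^sub>R x)"
    by (simp add: euclidean_representation scaleR_scaleR[symmetric] scaleR_right.sum[symmetric] del: scaleR_scaleR)
  show "lebesgue = density (distr lebesgue lebesgue (\<lambda>x. t + c *\<^sub>R x)) (\<lambda>_. ennreal (\<bar>c\<bar> ^ DIM('a)))"
    using lebesgue_affine_euclidean[of "\<lambda>_. c" t] assms unfolding T by simp
  show "(\<lambda>x. t + c *\<^sub>R x) \<in> lebesgue \<rightarrow>\<^sub>M lebesgue"
    using lebesgue_affine_measurable[of "\<lambda>_. c" t] assms unfolding T by simp
qed

lemma integrable_scaleR_right_iff:
  fixes f :: "'a \<Rightarrow> 'b::{banach, second_countable_topology}"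
  assumes "c \<noteq> (0::real)"
  shows "integrable M (\<lambda>x. c *\<^sub>R f x) \<longleftrightarrow> integrable M f"
  using integrable_scaleR_right[of "inverse c" M "\<lambda>x. c *\<^sub>R f x"] integrable_scaleR_right[of c M f] assms by auto

lemma
  fixes t :: "'a::euclidean_space" and f :: "'a \<Rightarrow> 'b::{banach, second_countable_topology}"
  assumes c: "c \<noteq> 0" and f: "f \<in> borel_measurable lebesgue"
  shows integrable_lebesgue_affine:
      "integrable lebesgue (\<lambda>x. f (t + c *\<^sub>R x)) \<longleftrightarrow> integrable lebesgue f"
    and integral_lebesgue_affine:
      "integral\<^sup>L lebesgue f = \<bar>c\<bar> ^ DIM('a) *\<^sub>R integral\<^sup>L lebesgue (\<lambda>x. f (t + c *\<^sub>R x))"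
proof -
  note m[measurable] = measurable_lebesgue_affine[OF c, of t] f
  have p: "\<bar>c\<bar> ^ DIM('a) > 0" using c by simp
  have "integrable lebesgue f \<longleftrightarrow>
      integrable (density (distr lebesgue lebesgue (\<lambda>x. t + c *\<^sub>R x)) (\<lambda>_. ennreal (\<bar>c\<bar> ^ DIM('a)))) f"
    using lebesgue_affine_distr[OF c, of t] by simp
  also have "\<dots> \<longleftrightarrow> integrable lebesgue (\<lambda>x. f (t + c *\<^sub>R x))"
    using p by (subst integrable_density) (auto simp: integrable_distr_eq integrable_scaleR_right_iff)
  finally show "integrable lebesgue (\<lambda>x. f (t + c *\<^sub>R x)) \<longleftrightarrow> integrable lebesgue f" ..
  have "integral\<^sup>L lebesgue f =
      integral\<^sup>L (density (distr lebesgue lebesgue (\<lambda>x. t + c *\<^sub>R x)) (\<lambda>_. ennreal (\<bar>c\<bar> ^ DIM('a)))) f"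
    using lebesgue_affine_distr[OF c, of t] by simp
  also have "\<dots> = integral\<^sup>L lebesgue (\<lambda>x. \<bar>c\<bar> ^ DIM('a) *\<^sub>R f (t + c *\<^sub>R x))"
    using p by (subst integral_density) (auto simp: integral_distr)
  finally show "integral\<^sup>L lebesgue f = \<bar>c\<bar> ^ DIM('a) *\<^sub>R integral\<^sup>L lebesgue (\<lambda>x. f (t + c *\<^sub>R x))"
    by simp
qed

lemma nn_integral_lebesgue_affine:
  fixes t :: "'a::euclidean_space"
  assumes c: "c \<noteq> 0" and f: "f \<in> borel_measurable lebesgue"
  shows "integral\<^sup>N lebesgue f = ennreal (\<bar>c\<bar> ^ DIM('a)) * integral\<^sup>N lebesgue (\<lambda>x. f (t + c *\<^sub>R x))"
proof -
  note m[measurable] = measurable_lebesgue_affine[OF c, of t] f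
  have "integral\<^sup>N lebesgue f =
      integral\<^sup>N (density (distr lebesgue lebesgue (\<lambda>x. t + c *\<^sub>R x)) (\<lambda>_. ennreal (\<bar>c\<bar> ^ DIM('a)))) f"
    using lebesgue_affine_distr[OF c, of t] by simp
  also have "\<dots> = integral\<^sup>N lebesgue (\<lambda>x. ennreal (\<bar>c\<bar> ^ DIM('a)) * f (t + c *\<^sub>R x))"
    by (subst nn_integral_density) (auto simp: nn_integral_distr)
  also have "\<dots> = ennreal (\<bar>c\<bar> ^ DIM('a)) * integral\<^sup>N lebesgue (\<lambda>x. f (t + c *\<^sub>R x))"
    by (rule nn_integral_cmult) measurable
  finally show ?thesis .
qed

lemma measurable_lebesgue_diff [measurable]: "(\<lambda>x. x - (a::'a::euclidean_space)) \<in> lebesgue \<rightarrow>\<^sub>M lebesgue"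
  using measurable_lebesgue_affine[of 1 "- a"] by (simp add: algebra_simps)

lemma measurable_lebesgue_minus [measurable]: "(\<lambda>x. (a::'a::euclidean_space) - x) \<in> lebesgue \<rightarrow>\<^sub>M lebesgue"
  using measurable_lebesgue_affine[of "-1" a] by (simp add: algebra_simps)

lemma measurable_lebesgue_add [measurable]: "(\<lambda>x. x + (a::'a::euclidean_space)) \<in> lebesgue \<rightarrow>\<^sub>M lebesgue"
  using measurable_lebesgue_affine[of 1 "a"] by (simp add: algebra_simps)

lemma nn_integral_lebesgue_translate:
  fixes a :: "'a::euclidean_space"
  assumes "f \<in> borel_measurable lebesgue"
  shows "(\<integral>\<^sup>+x. f (x - a) \<partial>lebesgue) = integral\<^sup>N lebesgue f"
  using nn_integral_lebesgue_affine[of 1 f "-a"] assms by (simp add: algebra_simps)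

lemma
  fixes a :: "'a::euclidean_space" and f :: "'a \<Rightarrow> 'b::{banach, second_countable_topology}"
  assumes "f \<in> borel_measurable lebesgue"
  shows integrable_lebesgue_translate: "integrable lebesgue (\<lambda>x. f (x - a)) \<longleftrightarrow> integrable lebesgue f"
    and integral_lebesgue_translate: "(\<integral>x. f (x - a) \<partial>lebesgue) = integral\<^sup>L lebesgue f"
    and integrable_lebesgue_reflect: "integrable lebesgue (\<lambda>x. f (a - x)) \<longleftrightarrow> integrable lebesgue f"
    and integral_lebesgue_reflect: "(\<integral>x. f (a - x) \<partial>lebesgue) = integral\<^sup>L lebesgue f"
  using integrable_lebesgue_affine[of 1 f "-a"] integral_lebesgue_affine[of 1 f "-a"]
    integrable_lebesgue_affine[of "-1" f "a"] integral_lebesgue_affine[of "-1" f "a"]  assms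
  by (simp_all add: algebra_simps)

section \<open>Continuity of translations in the mean and in the quadratic mean\<close>

text \<open>
  Only the mass of \<open>A + u\<close> outside \<open>A\<close> matters, since \<open>A\<close> and \<open>A + u\<close> have equal measure. Enlarging \<open>A\<close> to an
  open \<open>U\<close> costs little, and a point of \<open>U\<close> stays in \<open>U\<close> after a small shift, so dominated convergence applies.
\<close>

lemma L1_translate_tendsto_indicator:
  fixes A :: "'a::euclidean_space set" and c :: "'b::{banach, second_countable_topology}"
  assumes A: "A \<in> lmeasurable" and X: "X \<longlonglongrightarrow> 0"
  shows "(\<lambda>n. \<integral>x. norm (indicator A (x - X n) *\<^sub>R c - indicator A x *\<^sub>R c) \<partial>lebesgue) \<longlonglongrightarrow> 0"
proof (rule LIMSEQ_I)
  fix e :: real assume e: "e > 0"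
  have [measurable]: "A \<in> sets lebesgue" using A by auto
  have iA: "integrable lebesgue (indicat_real A)"
    using A by (simp add: fmeasurable_def)
  define e' where "e' = e / (4 * (norm c + 1))"
  have e': "e' > 0" using e by (simp add: e'_def add_nonneg_pos)
  obtain U where U: "open U" "A \<subseteq> U" "(U - A) \<in> lmeasurable" "emeasure lebesgue (U - A) < ennreal e'"
    using sets_lebesgue_outer_open[OF _ e', of A] A by auto
  have [measurable]: "U \<in> sets lebesgue" using U(1) by auto
  have iUA: "integrable lebesgue (indicat_real (U - A))"
    using U(3) by (simp add: fmeasurable_def)
  have mUA: "measure lebesgue (U - A) < e'"
    using U(3,4) e' by (simp add: emeasure_eq_measure2 ennreal_less_iff)
  (* For a fixed point of A the integrand is eventually 0, because U is a neighbourhood of the point. *)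
  have *: "(\<lambda>n. \<integral>y. indicat_real A y * indicat_real (- U) (y + X n) \<partial>lebesgue) \<longlonglongrightarrow> (\<integral>y. 0 \<partial>(lebesgue :: 'a measure))"
  proof (rule integral_dominated_convergence)
    show "AE y in lebesgue. (\<lambda>n. indicat_real A y * indicat_real (- U) (y + X n)) \<longlonglongrightarrow> 0"
    proof (intro AE_I2)
      fix y
      show "(\<lambda>n. indicat_real A y * indicat_real (- U) (y + X n)) \<longlonglongrightarrow> 0"
      proof (cases "y \<in> A")
        case True
        have "(\<lambda>n. y + X n) \<longlonglongrightarrow> y + 0" by (intro tendsto_intros X)
        then have "\<forall>\<^sub>F n in sequentially. y + X n \<in> U"
          using U(1,2) True by (intro topological_tendstoD) auto
        then have "\<forall>\<^sub>F n in sequentially. indicat_real A y * indicat_real (- U) (y + X n) = 0"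
          by eventually_elim simp
        then show ?thesis by (rule tendsto_eventually)
      qed simp
    qed
  qed (use iA in \<open>auto split: split_indicator\<close>)
  have "\<forall>\<^sub>F n in sequentially. \<integral>y. indicat_real A y * indicat_real (- U) (y + X n) \<partial>lebesgue < e'"
    using order_tendstoD(2)[OF *, of e'] e' by simp
  then obtain N where N: "\<And>n. n \<ge> N \<Longrightarrow> (\<integral>y. indicat_real A y * indicat_real (- U) (y + X n) \<partial>lebesgue) < e'"
    by (auto simp: eventually_sequentially)
  show "\<exists>N. \<forall>n\<ge>N. norm ((\<integral>x. norm (indicator A (x - X n) *\<^sub>R c - indicator A x *\<^sub>R c) \<partial>lebesgue) - 0) < e"
  proof (intro exI allI impI)
    fix n assume n: "n \<ge> N"
    let ?u = "X n"
    have i1: "integrable lebesgue (\<lambda>x. indicat_real A (x - ?u))"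
      using iA by (subst integrable_lebesgue_translate) auto
    have i2: "integrable lebesgue (\<lambda>x. indicat_real A (x - ?u) * indicat_real (- U) x)"
      by (rule Bochner_Integration.integrable_bound[OF i1]) (auto split: split_indicator)
    have "(\<integral>x. norm (indicator A (x - ?u) *\<^sub>R c - indicator A x *\<^sub>R c) \<partial>lebesgue)
       \<le> (\<integral>x. norm c * (2 * (indicat_real A (x - ?u) * indicat_real (- U) x + indicat_real (U - A) x)
             - (indicat_real A (x - ?u) - indicat_real A x)) \<partial>lebesgue)"
    proof (rule integral_mono)
      show "integrable lebesgue (\<lambda>x. norm (indicator A (x - ?u) *\<^sub>R c - indicator A x *\<^sub>R c))"
        using i1 iA by (intro integrable_norm Bochner_Integration.integrable_diff integrable_scaleR_left)
    qed (use i1 i2 iA iUA U(2) in \<open>auto split: split_indicator\<close>)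
    also have "\<dots> = norm c * (2 * ((\<integral>x. indicat_real A (x - ?u) * indicat_real (- U) x \<partial>lebesgue) + measure lebesgue (U - A)))"
      using i1 i2 iA iUA integral_lebesgue_translate[of "indicat_real A" ?u] by simp
    also have "(\<integral>x. indicat_real A (x - ?u) * indicat_real (- U) x \<partial>lebesgue)
        = (\<integral>y. indicat_real A y * indicat_real (- U) (y + ?u) \<partial>lebesgue)"
      using integral_lebesgue_translate[of "\<lambda>y. indicat_real A y * indicat_real (- U) (y + ?u)" ?u] by simp
    also have "norm c * (2 * (\<dots> + measure lebesgue (U - A))) \<le> norm c * (2 * (e' + e'))"
      using N[OF n] mUA by (intro mult_left_mono) auto
    also have "\<dots> < e"
      using e by (simp add: e'_def divide_simps add_nonneg_pos)
    finally show "norm ((\<integral>x. norm (indicator A (x - X n) *\<^sub>R c - indicator A x *\<^sub>R c) \<partial>lebesgue) - 0) < e"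
      by (simp add: integral_nonneg_AE)
  qed
qed

lemma L1_translate_tendsto:
  fixes f :: "'a::euclidean_space \<Rightarrow> 'b::{banach, second_countable_topology}"
  assumes f: "integrable lebesgue f" and X: "X \<longlonglongrightarrow> 0"
  shows "(\<lambda>n. \<integral>x. norm (f (x - X n) - f x) \<partial>lebesgue) \<longlonglongrightarrow> 0"
  using f
proof (induction f rule: integrable_induct)
  case (base A c)
  then have "A \<in> lmeasurable" by (simp add: fmeasurable_def)
  from L1_translate_tendsto_indicator[OF this X, of c] show ?case .
next
  case (add f g)
  have [measurable]: "f \<in> borel_measurable lebesgue" "g \<in> borel_measurable lebesgue"
    using add by auto
  have ineq: "norm (\<integral>x. norm (f (x - u) + g (x - u) - (f x + g x)) \<partial>lebesgue)
    \<le> (\<integral>x. norm (f (x - u) - f x) \<partial>lebesgue) + (\<integral>x. norm (g (x - u) - g x) \<partial>lebesgue)" for u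
  proof -
    have "(\<integral>x. norm (f (x - u) + g (x - u) - (f x + g x)) \<partial>lebesgue)
       \<le> (\<integral>x. norm (f (x - u) - f x) + norm (g (x - u) - g x) \<partial>lebesgue)"
    proof (rule integral_mono)
      fix x
      show "norm (f (x - u) + g (x - u) - (f x + g x)) \<le> norm (f (x - u) - f x) + norm (g (x - u) - g x)"
        by (rule norm_diff_triangle_ineq)
    qed (use add in \<open>auto simp: integrable_lebesgue_translate\<close>)
    also have "\<dots> = (\<integral>x. norm (f (x - u) - f x) \<partial>lebesgue) + (\<integral>x. norm (g (x - u) - g x) \<partial>lebesgue)"
      using add by (intro Bochner_Integration.integral_add) (auto simp: integrable_lebesgue_translate)
    finally show ?thesis by (simp add: integral_nonneg_AE)
  qed
  show ?case
    by (rule Lim_null_comparison[OF always_eventually, OF allI, OF ineq])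
       (use tendsto_add[OF add.IH] in simp)
next
  case (lim f s)
  have [measurable]: "f \<in> borel_measurable lebesgue" "\<And>i. s i \<in> borel_measurable lebesgue"
    using lim by auto
  have "(\<lambda>i. \<integral>x. norm (s i x - f x) \<partial>lebesgue) \<longlonglongrightarrow> (\<integral>x. 0 \<partial>(lebesgue :: 'a measure))"
  proof (rule integral_dominated_convergence[where w = "\<lambda>x. 3 * norm (f x)"])
    show "AE x in lebesgue. (\<lambda>i. norm (s i x - f x)) \<longlonglongrightarrow> 0"
      using lim.hyps(2) by (auto intro!: AE_I2 tendsto_norm_zero LIM_zero)
    show "AE x in lebesgue. norm (norm (s i x - f x)) \<le> 3 * norm (f x)" for i
    proof (intro AE_I2)
      fix x
      have "norm (s i x - f x) \<le> norm (s i x) + norm (f x)" by (rule norm_triangle_ineq4)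
      then show "norm (norm (s i x - f x)) \<le> 3 * norm (f x)" using lim.hyps(3)[of x i] by simp
    qed
  qed (use lim in auto)
  then have s0: "(\<lambda>i. \<integral>x. norm (s i x - f x) \<partial>lebesgue) \<longlonglongrightarrow> 0" by simp
  show ?case
  proof (rule LIMSEQ_I)
    fix e :: real assume e: "e > 0"
    obtain i where i: "(\<integral>x. norm (s i x - f x) \<partial>lebesgue) < e / 3"
      using order_tendstoD(2)[OF s0, of "e / 3"] e by (auto simp: eventually_sequentially)
    obtain N where N: "\<And>n. n \<ge> N \<Longrightarrow> (\<integral>x. norm (s i (x - X n) - s i x) \<partial>lebesgue) < e / 3"
      using order_tendstoD(2)[OF lim.IH[of i], of "e / 3"] e by (auto simp: eventually_sequentially)
    show "\<exists>N. \<forall>n\<ge>N. norm ((\<integral>x. norm (f (x - X n) - f x) \<partial>lebesgue) - 0) < e"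
    proof (intro exI allI impI)
      fix n assume n: "n \<ge> N"
      let ?u = "X n"
      have I: "integrable lebesgue (\<lambda>x. norm (s i (x - ?u) - f (x - ?u)))"
         "integrable lebesgue (\<lambda>x. norm (s i (x - ?u) - s i x))" "integrable lebesgue (\<lambda>x. norm (s i x - f x))"
         "integrable lebesgue (\<lambda>x. norm (f (x - ?u) - f x))"
        using lim.hyps(1)[of i] lim.hyps(4) by (auto simp: integrable_lebesgue_translate)
      have "(\<integral>x. norm (f (x - ?u) - f x) \<partial>lebesgue)
        \<le> (\<integral>x. norm (s i (x - ?u) - f (x - ?u)) + norm (s i (x - ?u) - s i x) + norm (s i x - f x) \<partial>lebesgue)"
      proof (rule integral_mono[OF I(4)])
        fix x
        have "f (x - ?u) - f x = - (s i (x - ?u) - f (x - ?u)) + (s i (x - ?u) - s i x) + (s i x - f x)" by simp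
        then show "norm (f (x - ?u) - f x) \<le> norm (s i (x - ?u) - f (x - ?u)) + norm (s i (x - ?u) - s i x) + norm (s i x - f x)"
          by (metis norm_triangle_mono norm_minus_cancel order_refl)
      qed (use I in auto)
      also have "\<dots> = (\<integral>x. norm (s i (x - ?u) - f (x - ?u)) \<partial>lebesgue) + (\<integral>x. norm (s i (x - ?u) - s i x) \<partial>lebesgue) + (\<integral>x. norm (s i x - f x) \<partial>lebesgue)"
        using I by simp
      also have "(\<integral>x. norm (s i (x - ?u) - f (x - ?u)) \<partial>lebesgue) = (\<integral>x. norm (s i x - f x) \<partial>lebesgue)"
        by (rule integral_lebesgue_translate[of "\<lambda>x. norm (s i x - f x)"]) measurable
      finally show "norm ((\<integral>x. norm (f (x - X n) - f x) \<partial>lebesgue) - 0) < e"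
        using i N[OF n] by (simp add: integral_nonneg_AE)
    qed
  qed
qed

text \<open>
  The map \<open>a \<mapsto> |a| a\<close> is strongly monotone. It turns square integrable functions into integrable ones
  and so reduces the continuity of translations in the quadratic mean to the continuity in the mean.
\<close>

lemma norm_diff_power2_le:
  fixes a b :: "'a::real_inner"
  shows "(norm (a - b))\<^sup>2 \<le> 2 * norm (norm a *\<^sub>R a - norm b *\<^sub>R b)"
proof (cases "a = b")
  case False
  have "2 * ((norm a *\<^sub>R a - norm b *\<^sub>R b) \<bullet> (a - b))
      = (norm a + norm b) * (norm (a - b))\<^sup>2 + (norm a - norm b) * ((norm a)\<^sup>2 - (norm b)\<^sup>2)"
    unfolding power2_norm_eq_inner by (simp add: algebra_simps inner_commute)
  moreover have "(norm a - norm b) * ((norm a)\<^sup>2 - (norm b)\<^sup>2) = (norm a - norm b)\<^sup>2 * (norm a + norm b)"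
    by (simp add: power2_eq_square algebra_simps)
  moreover have "norm (a - b) * (norm (a - b))\<^sup>2 \<le> (norm a + norm b) * (norm (a - b))\<^sup>2"
    by (intro mult_right_mono norm_triangle_ineq4) auto
  moreover have "(norm a - norm b)\<^sup>2 * (norm a + norm b) \<ge> 0" by simp
  ultimately have "norm (a - b) * (norm (a - b))\<^sup>2 \<le> 2 * ((norm a *\<^sub>R a - norm b *\<^sub>R b) \<bullet> (a - b))"
    by linarith
  also have "\<dots> \<le> 2 * (norm (norm a *\<^sub>R a - norm b *\<^sub>R b) * norm (a - b))"
    using norm_cauchy_schwarz[of "norm a *\<^sub>R a - norm b *\<^sub>R b" "a - b"] by simp
  finally show ?thesis using False by (simp add: mult.commute mult_le_cancel_left)
qed simp

lemma L2_translate_tendsto: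
  fixes f :: "real ^ 'd \<Rightarrow> complex"
  assumes f: "f \<in> L2" and X: "X \<longlonglongrightarrow> 0"
  shows "(\<lambda>n. \<integral>x. (cmod (f (x - X n) - f x))\<^sup>2 \<partial>lebesgue) \<longlonglongrightarrow> 0"
proof -
  have [measurable]: "f \<in> borel_measurable lebesgue" and i: "integrable lebesgue (\<lambda>x. (cmod (f x))\<^sup>2)"
    using f by (auto simp: L2_def)
  let ?h = "\<lambda>x. norm (f x) *\<^sub>R f x"
  have h: "integrable lebesgue ?h"
    by (rule Bochner_Integration.integrable_bound[OF i]) (auto simp: power2_eq_square norm_mult)
  have [measurable]: "?h \<in> borel_measurable lebesgue" by measurable
  have hu: "integrable lebesgue (\<lambda>x. ?h (x - u))" for u
    using h integrable_lebesgue_translate[of ?h u] by simp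
  have ineq: "norm (\<integral>x. (cmod (f (x - u) - f x))\<^sup>2 \<partial>lebesgue) \<le> 2 * (\<integral>x. norm (?h (x - u) - ?h x) \<partial>lebesgue)" for u
  proof -
    have "integrable lebesgue (\<lambda>x. 2 * norm (?h (x - u) - ?h x))"
      using h hu by (intro integrable_mult_right integrable_norm Bochner_Integration.integrable_diff)
    then have "(\<integral>x. (cmod (f (x - u) - f x))\<^sup>2 \<partial>lebesgue) \<le> (\<integral>x. 2 * norm (?h (x - u) - ?h x) \<partial>lebesgue)"
      by (rule integral_mono_AE') (auto intro!: norm_diff_power2_le)
    then show ?thesis by (simp add: integral_nonneg_AE)
  qed
  show ?thesis
    by (rule Lim_null_comparison[OF always_eventually, OF allI, OF ineq])
       (use tendsto_mult_right_zero[OF L1_translate_tendsto[OF h X], of 2] in simp)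
qed

section \<open>Characters and the multiplication formula\<close>

text \<open>
  The sign makes \<open>wave (\<xi> \<bullet> x)\<close> the kernel of the Fourier integral.
\<close>

definition wave :: "real \<Rightarrow> complex" where
  "wave r = cis (- (2 * pi * r))"

lemma wave_add: "wave (a + b) = wave a * wave b"
  by (simp add: wave_def cis_mult algebra_simps)

lemma wave_minus: "wave (- a) = cnj (wave a)"
  by (simp add: wave_def cis_cnj)

lemma norm_wave [simp]: "cmod (wave a) = 1"
  by (simp add: wave_def)

lemma wave_0 [simp]: "wave 0 = 1"
  by (simp add: wave_def)

lemma wave_cancel [simp]: "wave a * cnj (wave a) = 1" "cnj (wave a) * wave a = 1"
  by (simp_all add: wave_minus[symmetric] wave_add[symmetric])

lemma wave_sum: "wave (\<Sum>i\<in>I. a i) = (\<Prod>i\<in>I. wave (a i))"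
  by (induction I rule: infinite_finite_induct) (simp_all add: wave_add)

lemma borel_measurable_wave [measurable]: "wave \<in> borel_measurable borel"
  unfolding wave_def cis_conv_exp by measurable

lemma fourier_integral_wave: "fourier_integral f \<xi> = (LINT x|lebesgue. f x * wave (\<xi> \<bullet> x))"
  by (simp add: fourier_integral_def wave_def cis_conv_exp mult_ac)

lemma gabor_wave: "gabor g (t, s) x = g (x - t) * wave (- (s \<bullet> x))"
  by (simp add: gabor_def wave_def cis_conv_exp mult_ac)

lemma borel_representative:
  fixes f :: "'a::euclidean_space \<Rightarrow> complex"
  assumes [measurable]: "f \<in> borel_measurable lebesgue"
  obtains f' where "f' \<in> borel_measurable borel" "AE x in lebesgue. f x = f' x"
proof -
  obtain u where u: "u \<in> borel_measurable lborel" "AE x in lborel. Re (f x) = u x"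
    using completion_ex_borel_measurable_real[of "\<lambda>x. Re (f x)" lborel] by auto
  obtain v where v: "v \<in> borel_measurable lborel" "AE x in lborel. Im (f x) = v x"
    using completion_ex_borel_measurable_real[of "\<lambda>x. Im (f x)" lborel] by auto
  have "AE x in lborel. f x = Complex (u x) (v x)"
    using u(2) v(2) by eventually_elim (simp add: complex_eq_iff)
  moreover have "(\<lambda>x. Complex (u x) (v x)) \<in> borel_measurable borel"
    using u(1) v(1) unfolding Complex_eq by simp measurable
  ultimately show thesis by (intro that[of "\<lambda>x. Complex (u x) (v x)"] AE_completion)
qed

lemma integrable_borel_representative:
  fixes f :: "'a::euclidean_space \<Rightarrow> complex"
  assumes f: "integrable lebesgue f"
  obtains f' where "f' \<in> borel_measurable borel" "integrable lborel f'" "AE x in lebesgue. f x = f' x"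
proof -
  obtain f' where f': "f' \<in> borel_measurable borel" "AE x in lebesgue. f x = f' x"
    using borel_representative[of f] f by auto
  have "integrable lebesgue f'"
    using integrable_cong_AE_imp[OF f _ f'(2)] f'(1) by (simp add: measurable_completion AE_symmetric)
  then show thesis using f' integrable_completion[of f' lborel] by (intro that) auto
qed

lemma fourier_integral_cong_AE:
  fixes f h :: "real ^ 'd \<Rightarrow> complex"
  assumes "AE x in lebesgue. f x = h x"
    "f \<in> borel_measurable lebesgue" "h \<in> borel_measurable lebesgue"
  shows "fourier_integral f = fourier_integral h"
proof
  fix \<xi> :: "real ^ 'd"
  have [measurable]: "(\<lambda>x. wave (\<xi> \<bullet> x)) \<in> borel_measurable lebesgue" by (rule measurable_completion) simp
  show "fourier_integral f \<xi> = fourier_integral h \<xi>"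
    unfolding fourier_integral_wave using assms by (intro integral_cong_AE) auto
qed

lemma borel_measurable_fourier_integral [measurable]:
  fixes f :: "real ^ 'd \<Rightarrow> complex"
  assumes f: "integrable lebesgue f"
  shows "fourier_integral f \<in> borel_measurable borel"
proof -
  obtain f' where f': "f' \<in> borel_measurable borel" "integrable lborel f'" "AE x in lebesgue. f x = f' x"
    using integrable_borel_representative[OF f] .
  note [measurable] = f'(1)
  have "fourier_integral f = fourier_integral f'"
    using f f' by (intro fourier_integral_cong_AE) (auto intro: measurable_completion)
  also have "\<dots> = (\<lambda>\<xi>. LINT x|lborel. f' x * wave (\<xi> \<bullet> x))"
    unfolding fourier_integral_wave by (intro ext integral_completion) measurable
  also have "\<dots> \<in> borel_measurable borel"
    by measurable
  finally show ?thesis .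
qed

lemma borel_measurable_lebesgue_wave [measurable]:
  "(\<lambda>x. wave (\<xi> \<bullet> x)) \<in> borel_measurable lebesgue" "(\<lambda>x. wave (x \<bullet> \<xi>)) \<in> borel_measurable lebesgue"
  by (rule measurable_completion, simp)+

lemma integrable_mult_wave [simp]:
  fixes f :: "'a::euclidean_space \<Rightarrow> complex"
  assumes "integrable lebesgue f"
  shows "integrable lebesgue (\<lambda>x. f x * wave (\<xi> \<bullet> x))"
  by (rule Bochner_Integration.integrable_bound[OF assms]) (use assms in \<open>auto simp: norm_mult\<close>)

lemma norm_fourier_integral_le:
  "cmod (fourier_integral f \<xi>) \<le> (LINT x|lebesgue. cmod (f x))"
  unfolding fourier_integral_wave using integral_norm_bound[of lebesgue "\<lambda>x. f x * wave (\<xi> \<bullet> x)"]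
  by (simp add: norm_mult)

text \<open>
  Fubini's theorem applies to Borel functions on the product, so both functions are first replaced by
  Borel representatives.
\<close>

lemma fourier_integral_multiplication:
  fixes f k :: "real ^ 'd \<Rightarrow> complex"
  assumes f: "integrable lebesgue f" and k: "integrable lebesgue k"
  shows "(LINT \<xi>|lebesgue. k \<xi> * fourier_integral f \<xi>) = (LINT x|lebesgue. fourier_integral k x * f x)"
proof -
  obtain f' where f': "f' \<in> borel_measurable borel" "integrable lborel f'" "AE x in lebesgue. f x = f' x"
    using integrable_borel_representative[OF f] .
  obtain k' where k': "k' \<in> borel_measurable borel" "integrable lborel k'" "AE x in lebesgue. k x = k' x"
    using integrable_borel_representative[OF k] .
  note [measurable] = f'(1) k'(1)
  have [measurable]: "f' \<in> borel_measurable lebesgue" "k' \<in> borel_measurable lebesgue"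
    by (auto intro: measurable_completion)
  have [measurable]: "f \<in> borel_measurable lebesgue" "k \<in> borel_measurable lebesgue" using f k by auto
  have F: "fourier_integral f = (\<lambda>\<xi>. LINT x|lborel. f' x * wave (\<xi> \<bullet> x))"
  proof -
    have "fourier_integral f = fourier_integral f'"
      using f f' by (intro fourier_integral_cong_AE) (auto intro: measurable_completion)
    also have "\<dots> = (\<lambda>\<xi>. LINT x|lborel. f' x * wave (\<xi> \<bullet> x))"
      unfolding fourier_integral_wave by (intro ext integral_completion) measurable
    finally show ?thesis .
  qed
  have K: "fourier_integral k = (\<lambda>\<xi>. LINT x|lborel. k' x * wave (\<xi> \<bullet> x))"
  proof -
    have "fourier_integral k = fourier_integral k'"
      using k k' by (intro fourier_integral_cong_AE) (auto intro: measurable_completion)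
    also have "\<dots> = (\<lambda>\<xi>. LINT x|lborel. k' x * wave (\<xi> \<bullet> x))"
      unfolding fourier_integral_wave by (intro ext integral_completion) measurable
    finally show ?thesis .
  qed
  have "integrable (lborel \<Otimes>\<^sub>M lborel) (\<lambda>(\<xi>, x). k' \<xi> * (f' x * wave (\<xi> \<bullet> x)))"
  proof (rule lborel_pair.Fubini_integrable)
    have "(\<lambda>\<xi>. \<integral>x. norm (case (\<xi>, x) of (\<xi>, x) \<Rightarrow> k' \<xi> * (f' x * wave (\<xi> \<bullet> x))) \<partial>lborel)
       = (\<lambda>\<xi>. norm (k' \<xi>) * (\<integral>x. norm (f' x) \<partial>lborel))"
      by (simp add: norm_mult)
    then show "integrable lborel (\<lambda>\<xi>. \<integral>x. norm (case (\<xi>, x) of (\<xi>, x) \<Rightarrow> k' \<xi> * (f' x * wave (\<xi> \<bullet> x))) \<partial>lborel)"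
      using k'(2) by simp
    show "AE \<xi> in lborel. integrable lborel (\<lambda>x. case (\<xi>, x) of (\<xi>, x) \<Rightarrow> k' \<xi> * (f' x * wave (\<xi> \<bullet> x)))"
    proof (intro AE_I2)
      fix \<xi> :: "real ^ 'd"
      have "integrable lborel (\<lambda>x. f' x * wave (\<xi> \<bullet> x))"
        by (rule Bochner_Integration.integrable_bound[OF f'(2)]) (auto simp: norm_mult)
      then show "integrable lborel (\<lambda>x. case (\<xi>, x) of (\<xi>, x) \<Rightarrow> k' \<xi> * (f' x * wave (\<xi> \<bullet> x)))"
        by simp
    qed
  qed simp
  note sw = lborel_pair.Fubini_integral[OF this]
  have "(LINT \<xi>|lebesgue. k \<xi> * fourier_integral f \<xi>) = (LINT \<xi>|lebesgue. k' \<xi> * fourier_integral f \<xi>)"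
    using k'(3) borel_measurable_fourier_integral[OF f]
    by (intro integral_cong_AE) (auto intro!: borel_measurable_times intro: measurable_completion)
  also have "\<dots> = (LINT \<xi>|lborel. k' \<xi> * (LINT x|lborel. f' x * wave (\<xi> \<bullet> x)))"
    unfolding F by (rule integral_completion) measurable
  also have "\<dots> = (LINT \<xi>|lborel. LINT x|lborel. k' \<xi> * (f' x * wave (\<xi> \<bullet> x)))"
    by simp
  also have "\<dots> = (LINT x|lborel. LINT \<xi>|lborel. k' \<xi> * (f' x * wave (\<xi> \<bullet> x)))"
    using sw by simp
  also have "\<dots> = (LINT x|lborel. (LINT \<xi>|lborel. k' \<xi> * wave (x \<bullet> \<xi>)) * f' x)"
  proof (intro Bochner_Integration.integral_cong refl)
    fix x
    have "(LINT \<xi>|lborel. k' \<xi> * (f' x * wave (\<xi> \<bullet> x))) = (LINT \<xi>|lborel. (k' \<xi> * wave (x \<bullet> \<xi>)) * f' x)"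
      by (intro Bochner_Integration.integral_cong refl) (simp add: inner_commute mult_ac)
    then show "(LINT \<xi>|lborel. k' \<xi> * (f' x * wave (\<xi> \<bullet> x))) = (LINT \<xi>|lborel. k' \<xi> * wave (x \<bullet> \<xi>)) * f' x"
      by simp
  qed
  also have "\<dots> = (LINT x|lebesgue. fourier_integral k x * f' x)"
    unfolding K by (rule integral_completion[symmetric]) measurable
  also have "\<dots> = (LINT x|lebesgue. fourier_integral k x * f x)"
    using f'(3) borel_measurable_fourier_integral[OF k]
    by (intro integral_cong_AE) (auto intro!: borel_measurable_times intro: measurable_completion)
  finally show ?thesis .
qed

section \<open>The self-dual Gaussian\<close>

definition gauss :: "'a::real_inner \<Rightarrow> real" where
  "gauss x = exp (- (pi * (x \<bullet> x)))"

text \<open>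
  The rescaling \<open>z = sqrt (2 * pi) * x\<close> turns the characteristic function of the standard normal
  distribution into the statement that this Gaussian is its own Fourier transform.
\<close>

lemma gauss_real_fourier:
  fixes y :: real
  shows "integrable lborel (\<lambda>x. of_real (gauss x) * wave (y * x))" (is ?I)
    and "(LINT x|lborel. of_real (gauss x) * wave (y * x)) = of_real (gauss y)" (is ?E)
proof -
  let ?s = "sqrt (2 * pi)"
  let ?h = "\<lambda>z. of_real (std_normal_density z) * iexp ((- ?s * y) * z)"
  have s: "?s > 0" "?s * ?s = 2 * pi" by auto
  have i: "integrable lborel ?h"
  proof (rule Bochner_Integration.integrable_bound)
    show "integrable lborel (std_normal_density :: real \<Rightarrow> real)" by (rule integrable_normal_density) simp
  qed (auto simp: norm_mult)
  have "(LINT z|lborel. ?h z) = char std_normal_distribution (- ?s * y)"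
    unfolding char_def by (subst integral_density) (auto simp: scaleR_conv_of_real)
  also have "\<dots> = of_real (gauss y)"
    unfolding char_std_normal_distribution gauss_def
    using s by (simp add: power_mult_distrib field_simps power2_eq_square)
  finally have e: "(LINT z|lborel. ?h z) = of_real (gauss y)" .
  have eq: "of_real ?s * ?h (0 + ?s * x) = of_real (gauss x) * wave (y * x)" for x
  proof -
    have 1: "?s * std_normal_density (?s * x) = gauss x"
      using s by (simp add: std_normal_density_def gauss_def power_mult_distrib real_sqrt_mult field_simps power2_eq_square)
    have "(- ?s * y) * (?s * x) = - ((?s * ?s) * (y * x))" by algebra
    then have 2: "iexp ((- ?s * y) * (?s * x)) = wave (y * x)"
      unfolding s(2) wave_def cis_conv_exp by (simp only: mult_ac)
    show ?thesis unfolding add_0 2 1[symmetric] by (simp only: of_real_mult mult.assoc)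
  qed
  have "integrable lborel (\<lambda>x. of_real ?s * ?h (0 + ?s * x))"
    using lborel_integrable_real_affine[OF i, of ?s 0] s(1) by simp
  then show ?I unfolding eq .
  have "of_real (gauss y) = \<bar>?s\<bar> *\<^sub>R (LINT x|lborel. ?h (0 + ?s * x))"
    unfolding e[symmetric] by (rule lborel_integral_real_affine) (use s(1) in simp)
  also have "\<dots> = (LINT x|lborel. of_real ?s * ?h (0 + ?s * x))"
    unfolding integral_mult_right_zero using s(1) by (simp add: scaleR_conv_of_real)
  finally show ?E unfolding eq ..
qed

lemma gauss_prod:
  fixes x :: "'a::euclidean_space"
  shows "of_real (gauss x) * wave (\<xi> \<bullet> x)
    = (\<Prod>b\<in>Basis. of_real (gauss (x \<bullet> b)) * wave ((\<xi> \<bullet> b) * (x \<bullet> b)))"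
proof -
  have "gauss x = (\<Prod>b\<in>Basis. gauss (x \<bullet> b))"
    unfolding gauss_def by (subst euclidean_inner) (simp add: exp_sum[symmetric] sum_distrib_left sum_negf)
  moreover have "wave (\<xi> \<bullet> x) = (\<Prod>b\<in>Basis. wave ((\<xi> \<bullet> b) * (x \<bullet> b)))"
    by (subst euclidean_inner) (simp add: wave_sum)
  ultimately show ?thesis by (simp add: prod.distrib)
qed

lemma borel_measurable_gauss [measurable]:
  "(gauss :: 'a::euclidean_space \<Rightarrow> real) \<in> borel_measurable borel"
  unfolding gauss_def by measurable

lemma gauss_fourier_lborel:
  fixes \<xi> :: "'a::euclidean_space"
  shows "integrable lborel (\<lambda>x. of_real (gauss x) * wave (\<xi> \<bullet> x))" (is ?I)
    and "(LINT x|lborel. of_real (gauss x) * wave (\<xi> \<bullet> x)) = of_real (gauss \<xi>)" (is ?E)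
proof -
  interpret product_sigma_finite "\<lambda>_::'a. lborel :: real measure" ..
  let ?f = "\<lambda>b x. of_real (gauss (x::real)) * wave ((\<xi> \<bullet> b) * x)"
  let ?T = "\<lambda>f. \<Sum>b\<in>Basis. f b *\<^sub>R (b :: 'a)"
  have T: "?T \<in> (\<Pi>\<^sub>M b\<in>Basis. lborel) \<rightarrow>\<^sub>M borel"
    by measurable
  have eq: "of_real (gauss (?T f)) * wave (\<xi> \<bullet> ?T f) = (\<Prod>b\<in>Basis. ?f b (f b))" for f
    unfolding gauss_prod by (intro prod.cong) (simp_all add: inner_sum_left_Basis)
  have "integrable (\<Pi>\<^sub>M b\<in>Basis. lborel) (\<lambda>f. \<Prod>b\<in>Basis. ?f b (f b))"
    by (rule product_integrable_prod) (use gauss_real_fourier(1) in auto)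
  then show ?I
    by (subst lborel_eq, subst integrable_distr_eq[OF T]) (auto simp: eq)
  have "(LINT x|lborel. of_real (gauss x) * wave (\<xi> \<bullet> x)) = integral\<^sup>L (\<Pi>\<^sub>M b\<in>Basis. lborel) (\<lambda>f. \<Prod>b\<in>Basis. ?f b (f b))"
    by (subst lborel_eq, subst integral_distr[OF T]) (auto simp: eq)
  also have "\<dots> = (\<Prod>b\<in>Basis. LINT x|lborel. ?f b x)"
    by (rule product_integral_prod) (use gauss_real_fourier(1) in auto)
  also have "\<dots> = of_real (gauss \<xi>)"
    using gauss_prod[of \<xi> 0] by (simp add: gauss_real_fourier(2))
  finally show ?E .
qed

lemma gauss_measurable_lebesgue [measurable]: "gauss \<in> borel_measurable (lebesgue :: 'a::euclidean_space measure)"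
  by (rule measurable_completion) simp

lemma integrable_gauss: "integrable lebesgue (gauss :: 'a::euclidean_space \<Rightarrow> real)"
  and integral_gauss: "integral\<^sup>L lebesgue (gauss :: 'a::euclidean_space \<Rightarrow> real) = 1"
proof -
  have "integrable lborel (\<lambda>x::'a. complex_of_real (gauss x))"
    using gauss_fourier_lborel(1)[of 0] by simp
  then have i: "integrable lborel (gauss :: 'a::euclidean_space \<Rightarrow> real)"
    using complex_of_real_integrable_eq by blast
  then show "integrable lebesgue (gauss :: 'a::euclidean_space \<Rightarrow> real)"
    by (simp add: integrable_completion)
  have "complex_of_real (integral\<^sup>L lborel (gauss :: 'a \<Rightarrow> real)) = 1"
    using gauss_fourier_lborel(2)[of "0::'a"] by (simp add: gauss_def[of 0])
  then show "integral\<^sup>L lebesgue (gauss :: 'a::euclidean_space \<Rightarrow> real) = 1"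
    by (simp add: integral_completion)
qed

lemma fourier_integral_gauss:
  "fourier_integral (\<lambda>x. of_real (gauss x)) \<xi> = of_real (gauss \<xi>)"
  unfolding fourier_integral_wave using gauss_fourier_lborel(2)[of \<xi>] by (subst integral_completion) auto

lemma fourier_integral_gauss_scaled:
  fixes \<xi> :: "real ^ 'd"
  assumes \<delta>: "\<delta> > 0"
  shows "fourier_integral (\<lambda>x. of_real (gauss (\<delta> *\<^sub>R x))) \<xi> = of_real (gauss (\<xi> /\<^sub>R \<delta>) / \<delta> ^ CARD('d))"
proof -
  have "complex_of_real (gauss (\<xi> /\<^sub>R \<delta>)) = (LINT x|lebesgue. of_real (gauss x) * wave ((\<xi> /\<^sub>R \<delta>) \<bullet> x))"
    using fourier_integral_gauss[of "\<xi> /\<^sub>R \<delta>"] unfolding fourier_integral_wave by (rule sym)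
  also have "\<dots> = \<bar>\<delta>\<bar> ^ DIM(real ^ 'd) *\<^sub>R
      (LINT x|lebesgue. of_real (gauss (0 + \<delta> *\<^sub>R x)) * wave ((\<xi> /\<^sub>R \<delta>) \<bullet> (0 + \<delta> *\<^sub>R x)))"
    by (rule integral_lebesgue_affine) (use \<delta> in simp, measurable)
  also have "\<dots> = of_real (\<delta> ^ CARD('d)) * fourier_integral (\<lambda>x. of_real (gauss (\<delta> *\<^sub>R x))) \<xi>"
  proof -
    have "(\<xi> /\<^sub>R \<delta>) \<bullet> (\<delta> *\<^sub>R x) = \<xi> \<bullet> x" for x using \<delta> by simp
    then show ?thesis using \<delta> by (simp only: fourier_integral_wave scaleR_conv_of_real[where 'a=complex] add_0) simp
  qed
  finally show ?thesis using \<delta> by (simp add: field_simps)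
qed

section \<open>Square integrable functions\<close>

lemma L2_measurable [measurable_dest]: "f \<in> L2 \<Longrightarrow> f \<in> borel_measurable lebesgue"
  by (simp add: L2_def)

lemma L2_integrable: "f \<in> L2 \<Longrightarrow> integrable lebesgue (\<lambda>x. (cmod (f x))\<^sup>2)"
  by (simp add: L2_def)

lemma L2_norm_power2: "(L2_norm f)\<^sup>2 = (LINT x|lebesgue. (cmod (f x))\<^sup>2)"
  unfolding L2_norm_def by (intro real_sqrt_pow2 integral_nonneg_AE) auto

lemma L2_norm_nonneg [simp]: "0 \<le> L2_norm f"
  unfolding L2_norm_def by (intro real_sqrt_ge_zero integral_nonneg_AE) auto

lemma norm_mult_le_power2: "cmod (a * b) \<le> ((cmod a)\<^sup>2 + (cmod b)\<^sup>2) / 2"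
  using sum_squares_bound[of "cmod a" "cmod b"] by (simp add: norm_mult)

lemma L2_mult_integrable:
  assumes f: "f \<in> L2" and h: "h \<in> L2"
  shows "integrable lebesgue (\<lambda>x. f x * h x)"
proof (rule Bochner_Integration.integrable_bound)
  show "integrable lebesgue (\<lambda>x. ((cmod (f x))\<^sup>2 + (cmod (h x))\<^sup>2) / 2)"
    using L2_integrable[OF f] L2_integrable[OF h] by simp
  show "(\<lambda>x. f x * h x) \<in> borel_measurable lebesgue" using f h by measurable
  show "AE x in lebesgue. norm (f x * h x) \<le> norm (((cmod (f x))\<^sup>2 + (cmod (h x))\<^sup>2) / 2)"
    using norm_mult_le_power2 by (intro AE_I2) (auto intro: order_trans[OF _ abs_ge_self])
qed

lemma L2_bounded_by:
  assumes "f \<in> L2" "h \<in> borel_measurable lebesgue" "\<And>x. cmod (h x) \<le> c * cmod (f x)"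
  shows "h \<in> L2"
  unfolding L2_def
proof (intro CollectI conjI assms)
  show "integrable lebesgue (\<lambda>x. (cmod (h x))\<^sup>2)"
  proof (rule Bochner_Integration.integrable_bound)
    show "integrable lebesgue (\<lambda>x. c\<^sup>2 * (cmod (f x))\<^sup>2)" using L2_integrable[OF assms(1)] by simp
    show "(\<lambda>x. (cmod (h x))\<^sup>2) \<in> borel_measurable lebesgue" using assms(2) by measurable
    show "AE x in lebesgue. norm ((cmod (h x))\<^sup>2) \<le> norm (c\<^sup>2 * (cmod (f x))\<^sup>2)"
      using assms(3) by (intro AE_I2) (simp add: power_mult_distrib[symmetric] power_mono)
  qed
qed

lemma borel_measurable_cnj [measurable (raw)]:
  "f \<in> borel_measurable M \<Longrightarrow> (\<lambda>x. cnj (f x)) \<in> borel_measurable M"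
  by (rule measurable_compose[of f M borel cnj borel])
    (auto intro!: borel_measurable_continuous_onI continuous_intros)

lemma L2_cnj: "f \<in> L2 \<Longrightarrow> (\<lambda>x. cnj (f x)) \<in> L2"
  by (rule L2_bounded_by[where c = 1]) (auto dest: L2_measurable)

lemma L2_cmult: "f \<in> L2 \<Longrightarrow> (\<lambda>x. c * f x) \<in> L2"
  by (rule L2_bounded_by[where c = "cmod c"]) (auto dest: L2_measurable simp: norm_mult)

lemma cmod_add_power2_le: "(cmod (a + b))\<^sup>2 \<le> 2 * ((cmod a)\<^sup>2 + (cmod b)\<^sup>2)"
proof -
  have "(cmod (a + b))\<^sup>2 \<le> (cmod a + cmod b)\<^sup>2" by (intro power_mono norm_triangle_ineq) simp
  also have "\<dots> \<le> 2 * ((cmod a)\<^sup>2 + (cmod b)\<^sup>2)"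
    using sum_squares_bound[of "cmod a" "cmod b"] by (simp add: power2_sum)
  finally show ?thesis .
qed

lemma L2_add:
  assumes f: "f \<in> L2" and h: "h \<in> L2"
  shows "(\<lambda>x. f x + h x) \<in> L2"
  unfolding L2_def
proof (intro CollectI conjI)
  show "(\<lambda>x. f x + h x) \<in> borel_measurable lebesgue" using f h by measurable
  show "integrable lebesgue (\<lambda>x. (cmod (f x + h x))\<^sup>2)"
  proof (rule Bochner_Integration.integrable_bound)
    show "integrable lebesgue (\<lambda>x. 2 * ((cmod (f x))\<^sup>2 + (cmod (h x))\<^sup>2))"
      using L2_integrable[OF f] L2_integrable[OF h] by simp
    show "(\<lambda>x. (cmod (f x + h x))\<^sup>2) \<in> borel_measurable lebesgue" using f h by measurable
    show "AE x in lebesgue. norm ((cmod (f x + h x))\<^sup>2) \<le> norm (2 * ((cmod (f x))\<^sup>2 + (cmod (h x))\<^sup>2))"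
      using cmod_add_power2_le by (intro AE_I2) simp
  qed
qed

lemma L2_diff: "f \<in> L2 \<Longrightarrow> h \<in> L2 \<Longrightarrow> (\<lambda>x. f x - h x) \<in> L2"
  using L2_add[of f "\<lambda>x. - 1 * h x"] L2_cmult[of h "- 1"] by simp

lemma L2_zero: "(\<lambda>x. 0) \<in> L2"
  by (simp add: L2_def)

lemma L2_sum: "(\<And>i. i \<in> I \<Longrightarrow> f i \<in> L2) \<Longrightarrow> (\<lambda>x. \<Sum>i\<in>I. f i x) \<in> L2"
  by (induction I rule: infinite_finite_induct) (auto intro: L2_add L2_zero)

lemma L2_translate:
  assumes f: "f \<in> L2"
  shows "(\<lambda>x. f (x - a)) \<in> L2"
proof -
  have [measurable]: "f \<in> borel_measurable lebesgue" using f by (rule L2_measurable)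
  have "integrable lebesgue (\<lambda>x. (cmod (f (x - a)))\<^sup>2)"
    using integrable_lebesgue_translate[of "\<lambda>x. (cmod (f x))\<^sup>2" a] L2_integrable[OF f] by simp
  then show ?thesis by (simp add: L2_def)
qed

lemma L2_reflect:
  assumes f: "f \<in> L2"
  shows "(\<lambda>x. f (a - x)) \<in> L2"
proof -
  have [measurable]: "f \<in> borel_measurable lebesgue" using f by (rule L2_measurable)
  have "integrable lebesgue (\<lambda>x. (cmod (f (a - x)))\<^sup>2)"
    using integrable_lebesgue_reflect[of "\<lambda>x. (cmod (f x))\<^sup>2" a] L2_integrable[OF f] by simp
  then show ?thesis by (simp add: L2_def)
qed

lemma L2_mult_wave: "f \<in> L2 \<Longrightarrow> (\<lambda>x. f x * wave (\<xi> \<bullet> x)) \<in> L2"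
  by (rule L2_bounded_by[where c = 1]) (auto simp: norm_mult)

text \<open>
  Polarization: the autocorrelation at \<open>u\<close> is close to its value at \<open>0\<close> because translation by \<open>u\<close> moves \<open>f\<close> little.
\<close>

lemma autocorrelation_Re:
  assumes f: "f \<in> L2"
  shows "Re (LINT x|lebesgue. f x * cnj (f (x - u)))
     = (LINT x|lebesgue. (cmod (f x))\<^sup>2) - (LINT x|lebesgue. (cmod (f (x - u) - f x))\<^sup>2) / 2"
proof -
  have [measurable]: "f \<in> borel_measurable lebesgue" using f by (rule L2_measurable)
  note fu = L2_translate[OF f, of u]
  have i: "integrable lebesgue (\<lambda>x. f x * cnj (f (x - u)))"
    by (rule L2_mult_integrable[OF f L2_cnj[OF fu]])
  define r where "r = (\<lambda>x. Re (f x * cnj (f (x - u))))"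
  have ir: "integrable lebesgue r" unfolding r_def using i by (rule integrable_Re)
  have "(LINT x|lebesgue. (cmod (f (x - u)))\<^sup>2) = (LINT x|lebesgue. (cmod (f x))\<^sup>2)"
    by (rule integral_lebesgue_translate[of "\<lambda>x. (cmod (f x))\<^sup>2"]) measurable
  then have "2 * (LINT x|lebesgue. (cmod (f x))\<^sup>2) - 2 * integral\<^sup>L lebesgue r
     = (LINT x|lebesgue. ((cmod (f (x - u)))\<^sup>2 + (cmod (f x))\<^sup>2) - 2 * r x)"
    using ir L2_integrable[OF f] L2_integrable[OF fu] by simp
  also have "\<dots> = (LINT x|lebesgue. (cmod (f (x - u) - f x))\<^sup>2)"
    by (intro Bochner_Integration.integral_cong refl) (simp add: r_def cmod_power2, simp add: power2_eq_square algebra_simps)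
  finally have "integral\<^sup>L lebesgue r
      = (LINT x|lebesgue. (cmod (f x))\<^sup>2) - (LINT x|lebesgue. (cmod (f (x - u) - f x))\<^sup>2) / 2" by simp
  then show ?thesis unfolding r_def integral_Re[OF i] .
qed

lemma autocorrelation_norm_le:
  assumes f: "f \<in> L2"
  shows "(LINT x|lebesgue. cmod (f x * cnj (f (x - u)))) \<le> (LINT x|lebesgue. (cmod (f x))\<^sup>2)"
proof -
  have [measurable]: "f \<in> borel_measurable lebesgue" using f by (rule L2_measurable)
  note fu = L2_translate[OF f, of u]
  have i: "integrable lebesgue (\<lambda>x. f x * cnj (f (x - u)))"
    by (rule L2_mult_integrable[OF f L2_cnj[OF fu]])
  have "(LINT x|lebesgue. cmod (f x * cnj (f (x - u)))) \<le> (LINT x|lebesgue. ((cmod (f x))\<^sup>2 + (cmod (f (x - u)))\<^sup>2) / 2)"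
  proof (rule integral_mono)
    fix x show "cmod (f x * cnj (f (x - u))) \<le> ((cmod (f x))\<^sup>2 + (cmod (f (x - u)))\<^sup>2) / 2"
      using norm_mult_le_power2[of "f x" "cnj (f (x - u))"] by simp
  qed (use i L2_integrable[OF f] L2_integrable[OF fu] in auto)
  also have "\<dots> = ((LINT x|lebesgue. (cmod (f x))\<^sup>2) + (LINT x|lebesgue. (cmod (f (x - u)))\<^sup>2)) / 2"
    using L2_integrable[OF f] L2_integrable[OF fu] by simp
  also have "(LINT x|lebesgue. (cmod (f (x - u)))\<^sup>2) = (LINT x|lebesgue. (cmod (f x))\<^sup>2)"
    by (rule integral_lebesgue_translate[of "\<lambda>x. (cmod (f x))\<^sup>2"]) measurable
  finally show ?thesis by simp
qed

section \<open>Plancherel's theorem for integrable functions\<close>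

text \<open>
  Two applications of the multiplication formula replace both factors of \<open>|F f|\<^sup>2\<close> by \<open>f\<close>: the first moves
  the transform of \<open>f\<close> onto the weighted conjugate \<open>k * cnj (F f)\<close>, the second evaluates the transform of
  that product as a convolution of \<open>f\<close> with the transformed Gaussian.
\<close>

lemma gauss_weighted_Plancherel:
  fixes f :: "real ^ 'd \<Rightarrow> complex"
  assumes fb: "f \<in> borel_measurable borel" and f1: "integrable lebesgue f" and f2: "f \<in> L2" and \<delta>: "\<delta> > 0"
  shows "(LINT \<xi>|lebesgue. gauss (\<delta> *\<^sub>R \<xi>) * (cmod (fourier_integral f \<xi>))\<^sup>2)
    = (LINT v|lebesgue. gauss v * Re (LINT x|lebesgue. f x * cnj (f (x - \<delta> *\<^sub>R v))))"
proof -
  note [measurable] = fb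
  let ?k = "\<lambda>\<xi>::real^'d. complex_of_real (gauss (\<delta> *\<^sub>R \<xi>))"
  let ?F = "fourier_integral f"
  have fl [measurable]: "f \<in> borel_measurable lebesgue" by (rule measurable_completion) simp
  have mF [measurable]: "?F \<in> borel_measurable lebesgue"
    using borel_measurable_fourier_integral[OF f1] by (intro measurable_completion) simp
  have mg: "(\<lambda>x. complex_of_real (gauss x)) \<in> borel_measurable (lebesgue :: (real ^ 'd) measure)" by measurable
  have k: "integrable lebesgue ?k"
    using integrable_lebesgue_affine[of \<delta> _ 0, OF _ mg] \<delta> integrable_gauss[where 'a = "real ^ 'd"] by simp
  have [measurable]: "?k \<in> borel_measurable lebesgue" using k by auto
  obtain C where C: "\<And>\<xi>. cmod (?F \<xi>) \<le> C" using norm_fourier_integral_le[of f] by blast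
  have kF: "integrable lebesgue (\<lambda>\<xi>. ?k \<xi> * cnj (?F \<xi>))"
  proof (rule Bochner_Integration.integrable_bound)
    show "integrable lebesgue (\<lambda>\<xi>. C * ?k \<xi>)" using k by simp
    show "AE x in lebesgue. norm (?k x * cnj (?F x)) \<le> norm (C * ?k x)"
    proof (intro AE_I2)
      fix x
      have "cmod (?F x) \<le> \<bar>C\<bar>" using C[of x] by linarith
      then show "norm (?k x * cnj (?F x)) \<le> norm (C * ?k x)"
        by (simp add: norm_mult mult.commute[of "\<bar>gauss _\<bar>"] mult_right_mono)
    qed
  qed measurable
  have inner: "fourier_integral (\<lambda>\<xi>. ?k \<xi> * cnj (?F \<xi>)) x
     = cnj (LINT v|lebesgue. of_real (gauss v) * f (x - \<delta> *\<^sub>R v))" for x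
  proof -
    have kw: "integrable lebesgue (\<lambda>\<xi>. ?k \<xi> * wave ((- x) \<bullet> \<xi>))" using k by (rule integrable_mult_wave)
    have "fourier_integral (\<lambda>\<xi>. ?k \<xi> * cnj (?F \<xi>)) x = (LINT \<xi>|lebesgue. cnj ((?k \<xi> * wave ((- x) \<bullet> \<xi>)) * ?F \<xi>))"
      unfolding fourier_integral_wave[of "\<lambda>\<xi>. ?k \<xi> * cnj (?F \<xi>)"]
      by (intro Bochner_Integration.integral_cong refl) (simp add: wave_minus mult_ac)
    also have "\<dots> = cnj (LINT \<xi>|lebesgue. (?k \<xi> * wave ((- x) \<bullet> \<xi>)) * ?F \<xi>)"
      by (rule Bochner_Integration.integral_cnj)
    also have "(LINT \<xi>|lebesgue. (?k \<xi> * wave ((- x) \<bullet> \<xi>)) * ?F \<xi>)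
       = (LINT y|lebesgue. fourier_integral (\<lambda>\<xi>. ?k \<xi> * wave ((- x) \<bullet> \<xi>)) y * f y)"
      by (rule fourier_integral_multiplication[OF f1 kw])
    also have "(\<lambda>y. fourier_integral (\<lambda>\<xi>. ?k \<xi> * wave ((- x) \<bullet> \<xi>)) y) = (\<lambda>y. of_real (gauss ((y - x) /\<^sub>R \<delta>) / \<delta> ^ CARD('d)))"
    proof
      fix y
      have "fourier_integral (\<lambda>\<xi>. ?k \<xi> * wave ((- x) \<bullet> \<xi>)) y = fourier_integral ?k (y - x)"
        unfolding fourier_integral_wave
        by (intro Bochner_Integration.integral_cong refl) (simp add: mult.assoc wave_add[symmetric] inner_diff_left)
      then show "fourier_integral (\<lambda>\<xi>. ?k \<xi> * wave ((- x) \<bullet> \<xi>)) y = of_real (gauss ((y - x) /\<^sub>R \<delta>) / \<delta> ^ CARD('d))"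
        using fourier_integral_gauss_scaled[OF \<delta>] by simp
    qed
    also have "(LINT y|lebesgue. of_real (gauss ((y - x) /\<^sub>R \<delta>) / \<delta> ^ CARD('d)) * f y)
      = \<bar>- \<delta>\<bar> ^ DIM(real ^ 'd) *\<^sub>R (LINT v|lebesgue. of_real (gauss (((x + (- \<delta>) *\<^sub>R v) - x) /\<^sub>R \<delta>) / \<delta> ^ CARD('d)) * f (x + (- \<delta>) *\<^sub>R v))"
    proof (rule integral_lebesgue_affine)
      have "(\<lambda>y. gauss ((y - x) /\<^sub>R \<delta>)) \<in> borel_measurable lebesgue"
        by (rule measurable_completion) measurable
      then show "(\<lambda>y. of_real (gauss ((y - x) /\<^sub>R \<delta>) / \<delta> ^ CARD('d)) * f y) \<in> borel_measurable lebesgue"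
        by measurable
    qed (use \<delta> in simp)
    also have "\<dots> = (LINT v|lebesgue. of_real (\<delta> ^ CARD('d)) * (of_real (gauss (((x + (- \<delta>) *\<^sub>R v) - x) /\<^sub>R \<delta>) / \<delta> ^ CARD('d)) * f (x + (- \<delta>) *\<^sub>R v)))"
      using \<delta> by (simp add: scaleR_conv_of_real[where 'a = complex] del: of_real_power)
    also have "\<dots> = (LINT v|lebesgue. of_real (gauss v) * f (x - \<delta> *\<^sub>R v))"
      using \<delta> by (intro Bochner_Integration.integral_cong refl) (simp add: gauss_def)
    finally show ?thesis .
  qed
  let ?H = "\<lambda>v x. complex_of_real (gauss v) * (f x * cnj (f (x - \<delta> *\<^sub>R v)))"
  have iA: "integrable lborel (\<lambda>x. f x * cnj (f (x - u)))" for u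
    using L2_mult_integrable[OF f2 L2_cnj[OF L2_translate[OF f2, of u]]] by (simp add: integrable_completion)
  have nA: "(LINT x|lborel. cmod (f x * cnj (f (x - u)))) \<le> (LINT x|lebesgue. (cmod (f x))\<^sup>2)" for u
    using autocorrelation_norm_le[OF f2, of u] by (simp add: integral_completion)
  have gi: "integrable (lborel :: (real ^ 'd) measure) gauss"
    using integrable_gauss[where 'a = "real ^ 'd"] by (simp add: integrable_completion)
  have "integrable (lborel \<Otimes>\<^sub>M lborel) (\<lambda>(v, x). ?H v x)"
  proof (rule lborel_pair.Fubini_integrable)
    show "(\<lambda>(v, x). ?H v x) \<in> borel_measurable (lborel \<Otimes>\<^sub>M lborel)" by measurable
    show "integrable lborel (\<lambda>v. \<integral>x. norm (case (v, x) of (v, x) \<Rightarrow> ?H v x) \<partial>lborel)"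
    proof (rule Bochner_Integration.integrable_bound)
      show "integrable lborel (\<lambda>v::real^'d. gauss v * (LINT x|lebesgue. (cmod (f x))\<^sup>2))" using gi by simp
      show "AE v in lborel. norm (\<integral>x. norm (case (v, x) of (v, x) \<Rightarrow> ?H v x) \<partial>lborel) \<le> norm (gauss v * (LINT x|lebesgue. (cmod (f x))\<^sup>2))"
      proof (intro AE_I2)
        fix v :: "real ^ 'd"
        have "(\<integral>x. norm (case (v, x) of (v, x) \<Rightarrow> ?H v x) \<partial>lborel) = gauss v * (LINT x|lborel. cmod (f x * cnj (f (x - \<delta> *\<^sub>R v))))"
          by (simp add: norm_mult gauss_def)
        also have "\<dots> \<le> gauss v * (LINT x|lebesgue. (cmod (f x))\<^sup>2)"
          by (intro mult_left_mono nA) (simp add: gauss_def)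
        finally show "norm (\<integral>x. norm (case (v, x) of (v, x) \<Rightarrow> ?H v x) \<partial>lborel) \<le> norm (gauss v * (LINT x|lebesgue. (cmod (f x))\<^sup>2))"
          by (simp add: integral_nonneg_AE gauss_def abs_mult)
      qed
    qed measurable
    show "AE v in lborel. integrable lborel (\<lambda>x. case (v, x) of (v, x) \<Rightarrow> ?H v x)"
      using iA by simp
  qed
  note sw = lborel_pair.Fubini_integral[OF this]
  have "complex_of_real (LINT \<xi>|lebesgue. gauss (\<delta> *\<^sub>R \<xi>) * (cmod (?F \<xi>))\<^sup>2)
     = (LINT \<xi>|lebesgue. (?k \<xi> * cnj (?F \<xi>)) * ?F \<xi>)"
    unfolding integral_complex_of_real[symmetric]
    by (intro Bochner_Integration.integral_cong refl)
       (simp add: complex_norm_square mult_ac del: of_real_power)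
  also have "\<dots> = (LINT x|lebesgue. fourier_integral (\<lambda>\<xi>. ?k \<xi> * cnj (?F \<xi>)) x * f x)"
    by (rule fourier_integral_multiplication[OF f1 kF])
  also have "\<dots> = (LINT x|lebesgue. cnj (LINT v|lborel. of_real (gauss v) * f (x - \<delta> *\<^sub>R v)) * f x)"
    unfolding inner by (simp add: integral_completion)
  also have "\<dots> = (LINT x|lborel. cnj (LINT v|lborel. of_real (gauss v) * f (x - \<delta> *\<^sub>R v)) * f x)"
    by (rule integral_completion) measurable
  also have "\<dots> = (LINT x|lborel. LINT v|lborel. ?H v x)"
  proof (intro Bochner_Integration.integral_cong refl)
    fix x
    have "cnj (LINT v|lborel. of_real (gauss v) * f (x - \<delta> *\<^sub>R v))
        = (LINT v|lborel. of_real (gauss v) * cnj (f (x - \<delta> *\<^sub>R v)))"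
      using Bochner_Integration.integral_cnj[of lborel "\<lambda>v. of_real (gauss v) * f (x - \<delta> *\<^sub>R v)"] by simp
    then have "cnj (LINT v|lborel. of_real (gauss v) * f (x - \<delta> *\<^sub>R v)) * f x
        = (LINT v|lborel. of_real (gauss v) * cnj (f (x - \<delta> *\<^sub>R v)) * f x)"
      by (simp only: integral_mult_left_zero)
    then show "cnj (LINT v|lborel. of_real (gauss v) * f (x - \<delta> *\<^sub>R v)) * f x = (LINT v|lborel. ?H v x)"
      by (simp only: mult_ac)
  qed
  also have "\<dots> = (LINT v|lborel. LINT x|lborel. ?H v x)"
    using sw by simp
  also have "\<dots> = (LINT v|lborel. of_real (gauss v) * (LINT x|lborel. f x * cnj (f (x - \<delta> *\<^sub>R v))))"
    by simp
  finally have *: "complex_of_real (LINT \<xi>|lebesgue. gauss (\<delta> *\<^sub>R \<xi>) * (cmod (?F \<xi>))\<^sup>2)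
      = (LINT v|lborel. of_real (gauss v) * (LINT x|lborel. f x * cnj (f (x - \<delta> *\<^sub>R v))))" .
  have i2: "integrable lborel (\<lambda>v. complex_of_real (gauss v) * (LINT x|lborel. f x * cnj (f (x - \<delta> *\<^sub>R v))))"
    using lborel_pair.integrable_fst'[OF \<open>integrable (lborel \<Otimes>\<^sub>M lborel) (\<lambda>(v, x). ?H v x)\<close>] by simp
  have "(LINT \<xi>|lebesgue. gauss (\<delta> *\<^sub>R \<xi>) * (cmod (?F \<xi>))\<^sup>2)
      = Re (LINT v|lborel. of_real (gauss v) * (LINT x|lborel. f x * cnj (f (x - \<delta> *\<^sub>R v))))"
    unfolding *[symmetric] by simp
  also have "\<dots> = (LINT v|lborel. gauss v * Re (LINT x|lborel. f x * cnj (f (x - \<delta> *\<^sub>R v))))"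
    unfolding integral_Re[OF i2, symmetric] by simp
  also have "\<dots> = (LINT v|lebesgue. gauss v * Re (LINT x|lborel. f x * cnj (f (x - \<delta> *\<^sub>R v))))"
    by (rule integral_completion[symmetric]) measurable
  also have "\<dots> = (LINT v|lebesgue. gauss v * Re (LINT x|lebesgue. f x * cnj (f (x - \<delta> *\<^sub>R v))))"
    by (simp add: integral_completion)
  finally show ?thesis .
qed

text \<open>
  As \<open>\<delta>\<close> tends to zero the weight \<open>gauss (\<delta> \<xi>)\<close> increases to \<open>1\<close>, while the autocorrelation at \<open>\<delta> v\<close> tends
  to its value at \<open>0\<close>, which is the squared norm.
\<close>

theorem Plancherel:
  fixes f :: "real ^ 'd \<Rightarrow> complex"
  assumes f1: "integrable lebesgue f" and f2: "f \<in> L2"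
  shows "fourier_integral f \<in> L2"
    and "(LINT \<xi>|lebesgue. (cmod (fourier_integral f \<xi>))\<^sup>2) = (LINT x|lebesgue. (cmod (f x))\<^sup>2)"
proof -
  let ?F = "fourier_integral f"
  obtain f' where f': "f' \<in> borel_measurable borel" "integrable lborel f'" "AE x in lebesgue. f x = f' x"
    using integrable_borel_representative[OF f1] .
  note [measurable] = f'(1)
  have [measurable]: "f' \<in> borel_measurable lebesgue" "f \<in> borel_measurable lebesgue"
    using f1 by (auto intro: measurable_completion)
  have F: "?F = fourier_integral f'" by (rule fourier_integral_cong_AE[OF f'(3)]) measurable
  have f'1: "integrable lebesgue f'" using f'(2) by (simp add: integrable_completion)
  have "integrable lebesgue (\<lambda>x. (cmod (f' x))\<^sup>2)"
    using L2_integrable[OF f2] by (rule integrable_cong_AE_imp) (use f'(3) in auto)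
  then have f'2: "f' \<in> L2" by (simp add: L2_def)
  let ?N = "LINT x|lebesgue. (cmod (f' x))\<^sup>2"
  have N: "?N = (LINT x|lebesgue. (cmod (f x))\<^sup>2)"
    by (rule integral_cong_AE) (use f'(3) in auto)
  have mF [measurable]: "?F \<in> borel_measurable lebesgue"
    using borel_measurable_fourier_integral[OF f1] by (intro measurable_completion) simp
  let ?\<delta> = "\<lambda>n. 1 / real (Suc n)"
  have d0: "?\<delta> \<longlonglongrightarrow> 0" using LIMSEQ_inverse_real_of_nat by (simp add: inverse_eq_divide)
  let ?A = "\<lambda>u. Re (LINT x|lebesgue. f' x * cnj (f' (x - u)))"
  have A: "?A u = ?N - (LINT x|lebesgue. (cmod (f' (x - u) - f' x))\<^sup>2) / 2" for u
    by (rule autocorrelation_Re[OF f'2])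
  have A_le: "\<bar>?A u\<bar> \<le> ?N" for u
    using autocorrelation_norm_le[OF f'2, of u]
      integral_norm_bound[of lebesgue "\<lambda>x. f' x * cnj (f' (x - u))"]
      abs_Re_le_cmod[of "LINT x|lebesgue. f' x * cnj (f' (x - u))"] by linarith
  have lim: "(\<lambda>n. LINT v|lebesgue. gauss v * ?A (?\<delta> n *\<^sub>R v)) \<longlonglongrightarrow> (LINT v|(lebesgue::(real^'d) measure). gauss v * ?N)"
  proof (rule integral_dominated_convergence)
    show "integrable lebesgue (\<lambda>v::real^'d. gauss v * ?N)" using integrable_gauss[where 'a="real^'d"] by simp
    show "AE v::real^'d in lebesgue. norm (gauss v * ?A (?\<delta> n *\<^sub>R v)) \<le> gauss v * ?N" for n
      using A_le by (intro AE_I2) (simp add: abs_mult gauss_def mult_left_mono)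
    show "AE v in lebesgue. (\<lambda>n. gauss v * ?A (?\<delta> n *\<^sub>R v)) \<longlonglongrightarrow> gauss v * ?N"
    proof (intro AE_I2 tendsto_mult tendsto_const)
      fix v :: "real ^ 'd"
      have "(\<lambda>n. ?\<delta> n *\<^sub>R v) \<longlonglongrightarrow> 0" using tendsto_scaleR[OF d0 tendsto_const[of v]] by simp
      from L2_translate_tendsto[OF f'2 this]
      have "(\<lambda>n. ?N - (LINT x|lebesgue. (cmod (f' (x - ?\<delta> n *\<^sub>R v) - f' x))\<^sup>2) / 2) \<longlonglongrightarrow> ?N - 0 / 2"
        by (intro tendsto_intros) auto
      then show "(\<lambda>n. ?A (?\<delta> n *\<^sub>R v)) \<longlonglongrightarrow> ?N" unfolding A by simp
    qed
    have "(\<lambda>v. Re (LINT x|lborel. f' x * cnj (f' (x - c *\<^sub>R v)))) \<in> borel_measurable lebesgue" for c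
      by (rule measurable_completion) measurable
    then show "(\<lambda>v. gauss v * ?A (?\<delta> n *\<^sub>R v)) \<in> borel_measurable lebesgue" for n
      by (simp add: integral_completion)
  qed measurable
  have gF: "integrable lebesgue (\<lambda>\<xi>. gauss (?\<delta> n *\<^sub>R \<xi>) * (cmod (?F \<xi>))\<^sup>2)" for n
  proof (rule Bochner_Integration.integrable_bound)
    let ?C = "LINT x|lebesgue. cmod (f x)"
    have "integrable lebesgue (\<lambda>\<xi>::real^'d. gauss (0 + ?\<delta> n *\<^sub>R \<xi>))"
      using integrable_lebesgue_affine[of "?\<delta> n" gauss "0::real^'d"] integrable_gauss[where 'a="real^'d"] by simp
    then show "integrable lebesgue (\<lambda>\<xi>::real^'d. gauss (?\<delta> n *\<^sub>R \<xi>) * ?C\<^sup>2)" by simp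
    show "AE \<xi> in lebesgue. norm (gauss (?\<delta> n *\<^sub>R \<xi>) * (cmod (?F \<xi>))\<^sup>2) \<le> norm (gauss (?\<delta> n *\<^sub>R \<xi>) * ?C\<^sup>2)"
      using norm_fourier_integral_le[of f] by (intro AE_I2) (simp add: abs_mult gauss_def mult_left_mono power_mono)
    have "(\<lambda>\<xi>::real^'d. gauss (?\<delta> n *\<^sub>R \<xi>)) \<in> borel_measurable lebesgue" by (rule measurable_completion) measurable
    then show "(\<lambda>\<xi>. gauss (?\<delta> n *\<^sub>R \<xi>) * (cmod (?F \<xi>))\<^sup>2) \<in> borel_measurable lebesgue" by measurable
  qed
  have "(\<lambda>n. \<integral>\<^sup>+\<xi>. ennreal (gauss (?\<delta> n *\<^sub>R \<xi>) * (cmod (?F \<xi>))\<^sup>2) \<partial>lebesgue) \<longlonglongrightarrow> (\<integral>\<^sup>+\<xi>. ennreal ((cmod (?F \<xi>))\<^sup>2) \<partial>lebesgue)"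
  proof (rule nn_integral_LIMSEQ)
    have "gauss (?\<delta> n *\<^sub>R \<xi>) \<le> gauss (?\<delta> (Suc n) *\<^sub>R \<xi>)" for n and \<xi> :: "real ^ 'd"
      by (simp add: gauss_def divide_simps mult_mono del: of_nat_Suc)
    then show "incseq (\<lambda>n \<xi>. ennreal (gauss (?\<delta> n *\<^sub>R \<xi>) * (cmod (?F \<xi>))\<^sup>2))"
      by (intro incseq_SucI le_funI ennreal_leI mult_right_mono) auto
    show "(\<lambda>\<xi>. ennreal (gauss (?\<delta> n *\<^sub>R \<xi>) * (cmod (?F \<xi>))\<^sup>2)) \<in> borel_measurable lebesgue" for n
      using gF[of n] by measurable
    fix \<xi> :: "real ^ 'd"
    have "(\<lambda>n. exp (- (pi * ((?\<delta> n *\<^sub>R \<xi>) \<bullet> (?\<delta> n *\<^sub>R \<xi>)))) * (cmod (?F \<xi>))\<^sup>2) \<longlonglongrightarrow> exp (- (pi * ((0 *\<^sub>R \<xi>) \<bullet> (0 *\<^sub>R \<xi>)))) * (cmod (?F \<xi>))\<^sup>2"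
      by (intro tendsto_intros d0)
    then show "(\<lambda>n. ennreal (gauss (?\<delta> n *\<^sub>R \<xi>) * (cmod (?F \<xi>))\<^sup>2)) \<longlonglongrightarrow> ennreal ((cmod (?F \<xi>))\<^sup>2)"
      by (intro tendsto_ennrealI) (simp add: gauss_def)
  qed
  moreover have "(\<integral>\<^sup>+\<xi>. ennreal (gauss (?\<delta> n *\<^sub>R \<xi>) * (cmod (?F \<xi>))\<^sup>2) \<partial>lebesgue) = ennreal (LINT v|lebesgue. gauss v * ?A (?\<delta> n *\<^sub>R v))" for n
  proof -
    have "(\<integral>\<^sup>+\<xi>. ennreal (gauss (?\<delta> n *\<^sub>R \<xi>) * (cmod (?F \<xi>))\<^sup>2) \<partial>lebesgue) = ennreal (LINT \<xi>|lebesgue. gauss (?\<delta> n *\<^sub>R \<xi>) * (cmod (?F \<xi>))\<^sup>2)"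
      by (rule nn_integral_eq_integral[OF gF]) (simp add: gauss_def)
    also have "(LINT \<xi>|lebesgue. gauss (?\<delta> n *\<^sub>R \<xi>) * (cmod (?F \<xi>))\<^sup>2) = (LINT v|lebesgue. gauss v * ?A (?\<delta> n *\<^sub>R v))"
      unfolding F by (rule gauss_weighted_Plancherel[OF f'(1) f'1 f'2]) simp
    finally show ?thesis .
  qed
  moreover have "(\<lambda>n. ennreal (LINT v|lebesgue. gauss v * ?A (?\<delta> n *\<^sub>R v))) \<longlonglongrightarrow> ennreal ?N"
    using lim integral_gauss[where 'a="real^'d"] by (intro tendsto_ennrealI) simp
  ultimately have nn: "(\<integral>\<^sup>+\<xi>. ennreal ((cmod (?F \<xi>))\<^sup>2) \<partial>lebesgue) = ennreal ?N"
    by (simp add: LIMSEQ_unique)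
  then have i: "integrable lebesgue (\<lambda>\<xi>. (cmod (?F \<xi>))\<^sup>2)"
    by (intro integrableI_nonneg) auto
  then show "?F \<in> L2" by (simp add: L2_def)
  show "(LINT \<xi>|lebesgue. (cmod (?F \<xi>))\<^sup>2) = (LINT x|lebesgue. (cmod (f x))\<^sup>2)"
    using nn nn_integral_eq_integral[OF i] N by (simp add: integral_nonneg_AE)
qed

section \<open>The Fourier transform of a square integrable function\<close>

lemma L2_diff_power2_le:
  assumes f: "f \<in> L2" and g: "g \<in> L2" and h: "h \<in> L2"
  shows "(LINT x|lebesgue. (cmod (f x - h x))\<^sup>2)
    \<le> 2 * ((LINT x|lebesgue. (cmod (f x - g x))\<^sup>2) + (LINT x|lebesgue. (cmod (g x - h x))\<^sup>2))"
proof -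
  have i: "integrable lebesgue (\<lambda>x. (cmod (f x - h x))\<^sup>2)" "integrable lebesgue (\<lambda>x. (cmod (f x - g x))\<^sup>2)"
     "integrable lebesgue (\<lambda>x. (cmod (g x - h x))\<^sup>2)"
    using assms by (auto intro!: L2_integrable L2_diff)
  have "(LINT x|lebesgue. (cmod (f x - h x))\<^sup>2) \<le> (LINT x|lebesgue. 2 * ((cmod (f x - g x))\<^sup>2 + (cmod (g x - h x))\<^sup>2))"
  proof (rule integral_mono)
    fix x show "(cmod (f x - h x))\<^sup>2 \<le> 2 * ((cmod (f x - g x))\<^sup>2 + (cmod (g x - h x))\<^sup>2)"
      using cmod_add_power2_le[of "f x - g x" "g x - h x"] by simp
  qed (use i in auto)
  then show ?thesis using i by simp
qed

text \<open>
  Weighting the squared increments by \<open>2 ^ n\<close> keeps their integrals summable and makes the sequence converge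
  absolutely at almost every point; Fatou's lemma then controls the distance to the pointwise limit.
\<close>

lemma L2_tendsto_if_rapidly_Cauchy:
  fixes h :: "nat \<Rightarrow> real ^ 'd \<Rightarrow> complex"
  assumes h: "\<And>n. h n \<in> L2"
    and bd: "\<And>m n. n \<le> m \<Longrightarrow> (LINT x|lebesgue. (cmod (h m x - h n x))\<^sup>2) \<le> C / 4 ^ n"
  shows "\<exists>k. L2_tendsto h k"
proof -
  have [measurable]: "h n \<in> borel_measurable lebesgue" for n using h by (rule L2_measurable)
  have i: "integrable lebesgue (\<lambda>x. (cmod (h m x - h n x))\<^sup>2)" for m n
    using h by (intro L2_integrable L2_diff)
  have nn: "(\<integral>\<^sup>+x. ennreal ((cmod (h m x - h n x))\<^sup>2) \<partial>lebesgue) \<le> ennreal (C / 4 ^ n)" if "n \<le> m" for m n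
    using bd[OF that] nn_integral_eq_integral[OF i, of m n] by (simp add: ennreal_leI)
  have C: "C \<ge> 0" using bd[of 0 0] by simp
  let ?w = "\<lambda>n x. 2 ^ n * (cmod (h (Suc n) x - h n x))\<^sup>2"
  have w: "(\<integral>\<^sup>+x. ennreal (?w n x) \<partial>lebesgue) \<le> ennreal (C * (1 / 2) ^ n)" for n
  proof -
    have "(\<integral>\<^sup>+x. ennreal (?w n x) \<partial>lebesgue) = 2 ^ n * (\<integral>\<^sup>+x. ennreal ((cmod (h (Suc n) x - h n x))\<^sup>2) \<partial>lebesgue)"
      by (subst nn_integral_cmult[symmetric]) (auto simp: ennreal_mult ennreal_power[symmetric])
    also have "\<dots> \<le> 2 ^ n * ennreal (C / 4 ^ n)" by (intro mult_left_mono nn) auto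
    also have "(2::ennreal) ^ n = ennreal (2 ^ n)" by (simp add: ennreal_power[symmetric])
    also have "ennreal (2 ^ n) * ennreal (C / 4 ^ n) = ennreal (2 ^ n * (C / 4 ^ n))"
      using C by (intro ennreal_mult[symmetric]) auto
    also have "2 ^ n * (C / 4 ^ n) = C * (1 / 2) ^ n"
      using power_mult_distrib[of "2::real" 2 n] by (simp add: field_simps)
    finally show ?thesis .
  qed
  have "(\<integral>\<^sup>+x. (\<Sum>n. ennreal (?w n x)) \<partial>lebesgue) = (\<Sum>n. \<integral>\<^sup>+x. ennreal (?w n x) \<partial>lebesgue)"
    by (intro nn_integral_suminf) measurable
  also have "\<dots> \<le> (\<Sum>n. ennreal (C * (1 / 2) ^ n))" by (intro suminf_le w) auto
  also have "\<dots> < \<infinity>"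
  proof -
    have "summable (\<lambda>n. C * (1 / 2) ^ n)" by (intro summable_mult summable_geometric) simp
    then show ?thesis using C by (simp add: ennreal_suminf_neq_top less_top[symmetric])
  qed
  finally have "AE x in lebesgue. (\<Sum>n. ennreal (?w n x)) \<noteq> \<infinity>"
    by (intro nn_integral_PInf_AE) auto
  then have conv: "AE x in lebesgue. convergent (\<lambda>n. h n x)"
  proof eventually_elim
    case (elim x)
    then have sw: "summable (\<lambda>n. ?w n x)" by (intro summable_suminf_not_top) auto
    (* By 2 a \<le> 2^n a^2 + 2^(-n), square summability with the weights 2^n gives absolute summability. *)
    have le: "norm (h (Suc n) x - h n x) \<le> ?w n x + (1 / 2) ^ n" for n
    proof -
      let ?a = "cmod (h (Suc n) x - h n x)"
      have "0 \<le> (2 ^ n * ?a - 1)\<^sup>2" by simp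
      then have "2 ^ n * (2 * ?a) \<le> 2 ^ n * (?w n x) + 1" by (simp add: power2_eq_square algebra_simps)
      moreover have "2 ^ n * (?w n x + (1 / 2) ^ n) = 2 ^ n * (?w n x) + 1"
        by (simp add: algebra_simps power_mult_distrib[symmetric])
      ultimately have "2 ^ n * (2 * ?a) \<le> 2 ^ n * (?w n x + (1 / 2) ^ n)" by simp
      then have "2 * ?a \<le> ?w n x + (1 / 2) ^ n" by (subst (asm) mult_le_cancel_left_pos) auto
      then show ?thesis using norm_ge_zero[of "h (Suc n) x - h n x"] by linarith
    qed
    have "summable (\<lambda>n. ?w n x + (1 / 2) ^ n)"
      by (intro summable_add sw summable_geometric) simp
    then have "summable (\<lambda>n. h (Suc n) x - h n x)"
      by (rule summable_comparison_test'[where N = 0]) (rule le)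
    then have "convergent (\<lambda>n. \<Sum>k<n. h (Suc k) x - h k x)"
      by (simp add: summable_iff_convergent)
    then have "convergent (\<lambda>n. (\<Sum>k<n. h (Suc k) x - h k x) + h 0 x)"
      by (intro convergent_add convergent_const)
    then show ?case unfolding sum_lessThan_telescope[of "\<lambda>k. h k x"] by simp
  qed
  define k where "k = (\<lambda>x. lim (\<lambda>n. h n x))"
  have [measurable]: "k \<in> borel_measurable lebesgue" unfolding k_def by measurable
  have lim: "AE x in lebesgue. (\<lambda>n. h n x) \<longlonglongrightarrow> k x"
    using conv by eventually_elim (simp add: k_def convergent_LIMSEQ_iff)
  have F: "(\<integral>\<^sup>+x. ennreal ((cmod (h n x - k x))\<^sup>2) \<partial>lebesgue) \<le> ennreal (C / 4 ^ n)" for n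
  proof -
    have "(\<integral>\<^sup>+x. ennreal ((cmod (h n x - k x))\<^sup>2) \<partial>lebesgue)
      = (\<integral>\<^sup>+x. liminf (\<lambda>m. ennreal ((cmod (h m x - h n x))\<^sup>2)) \<partial>lebesgue)"
    proof (rule nn_integral_cong_AE, use lim in eventually_elim)
      case (elim x)
      have "(\<lambda>m. ennreal ((cmod (h m x - h n x))\<^sup>2)) \<longlonglongrightarrow> ennreal ((cmod (k x - h n x))\<^sup>2)"
        by (intro tendsto_intros elim)
      then have "liminf (\<lambda>m. ennreal ((cmod (h m x - h n x))\<^sup>2)) = ennreal ((cmod (k x - h n x))\<^sup>2)"
        by (rule lim_imp_Liminf[OF sequentially_bot])
      then show ?case by (simp add: norm_minus_commute)
    qed
    also have "\<dots> \<le> liminf (\<lambda>m. \<integral>\<^sup>+x. ennreal ((cmod (h m x - h n x))\<^sup>2) \<partial>lebesgue)"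
      by (rule nn_integral_liminf) measurable
    also have "\<dots> \<le> liminf (\<lambda>m. ennreal (C / 4 ^ n))"
      by (rule Liminf_mono) (use nn in \<open>auto simp: eventually_sequentially\<close>)
    also have "\<dots> = ennreal (C / 4 ^ n)" by (simp add: Liminf_const)
    finally show ?thesis .
  qed
  have d: "(\<lambda>x. h n x - k x) \<in> L2" for n
  proof -
    have "integrable lebesgue (\<lambda>x. (cmod (h n x - k x))\<^sup>2)"
      by (rule integrableI_nonneg) (use F[of n] in \<open>auto simp: le_less_trans\<close>)
    then show ?thesis by (simp add: L2_def)
  qed
  have "k \<in> L2" using L2_diff[OF h d, of 0 0] by simp
  moreover have "(\<lambda>n. L2_norm (\<lambda>x. h n x - k x)) \<longlonglongrightarrow> 0"
  proof (rule Lim_null_comparison[OF always_eventually])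
    show "\<forall>n. norm (L2_norm (\<lambda>x. h n x - k x)) \<le> sqrt (C / 4 ^ n)"
    proof
      fix n
      have "ennreal (LINT x|lebesgue. (cmod (h n x - k x))\<^sup>2) \<le> ennreal (C / 4 ^ n)"
        using F[of n] nn_integral_eq_integral[OF L2_integrable[OF d[of n]]] by simp
      then have "(LINT x|lebesgue. (cmod (h n x - k x))\<^sup>2) \<le> C / 4 ^ n"
        using C by (subst (asm) ennreal_le_iff) auto
      then show "norm (L2_norm (\<lambda>x. h n x - k x)) \<le> sqrt (C / 4 ^ n)"
        by (simp add: L2_norm_def integral_nonneg_AE)
    qed
    have "(\<lambda>n. sqrt (C * (1 / 4) ^ n)) \<longlonglongrightarrow> sqrt (C * 0)"
      by (intro tendsto_intros LIMSEQ_power_zero) simp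
    then show "(\<lambda>n. sqrt (C / 4 ^ n)) \<longlonglongrightarrow> 0" by (simp add: power_divide)
  qed
  ultimately show ?thesis using h unfolding L2_tendsto_def by blast
qed

lemma fourier_integral_diff:
  assumes "integrable lebesgue f" "integrable lebesgue h"
  shows "fourier_integral (\<lambda>x. f x - h x) \<xi> = fourier_integral f \<xi> - fourier_integral h \<xi>"
  unfolding fourier_integral_wave left_diff_distrib
  using assms by (intro Bochner_Integration.integral_diff integrable_mult_wave)

lemma L2_mult_indicator:
  fixes f :: "real ^ 'd \<Rightarrow> complex"
  assumes f: "f \<in> L2" and E: "E \<in> lmeasurable"
  shows "integrable lebesgue (\<lambda>x. indicator E x *\<^sub>R f x)" "(\<lambda>x. indicator E x *\<^sub>R f x) \<in> L2"
proof -
  have [measurable]: "f \<in> borel_measurable lebesgue" "E \<in> sets lebesgue"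
    using f E by (auto intro: L2_measurable)
  have iE: "integrable lebesgue (indicat_real E)" using E by (simp add: fmeasurable_def)
  show "(\<lambda>x. indicator E x *\<^sub>R f x) \<in> L2"
    by (rule L2_bounded_by[OF f, where c = 1]) (auto split: split_indicator)
  show "integrable lebesgue (\<lambda>x. indicator E x *\<^sub>R f x)"
  proof (rule Bochner_Integration.integrable_bound)
    show "integrable lebesgue (\<lambda>x. indicat_real E x + (cmod (f x))\<^sup>2)" using iE L2_integrable[OF f] by simp
    show "AE x in lebesgue. norm (indicator E x *\<^sub>R f x) \<le> norm (indicat_real E x + (cmod (f x))\<^sup>2)"
    proof (intro AE_I2)
      fix x
      have "0 \<le> (cmod (f x) - 1)\<^sup>2" by simp
      then have "2 * cmod (f x) \<le> 1 + (cmod (f x))\<^sup>2" by (simp add: power2_eq_square algebra_simps)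
      then have "cmod (f x) \<le> 1 + (cmod (f x))\<^sup>2"
        using norm_ge_zero[of "f x"] by linarith
      then show "norm (indicator E x *\<^sub>R f x) \<le> norm (indicat_real E x + (cmod (f x))\<^sup>2)"
        by (auto split: split_indicator)
    qed
  qed measurable
qed

text \<open>
  Truncations of \<open>g\<close> to large balls, chosen to converge geometrically fast, have transforms that are
  rapidly Cauchy by Plancherel's theorem.
\<close>

lemma is_fourier_L2_exists:
  fixes g :: "real ^ 'd \<Rightarrow> complex"
  assumes g: "g \<in> L2"
  shows "\<exists>h. is_fourier_L2 g h"
proof -
  have [measurable]: "g \<in> borel_measurable lebesgue" using g by (rule L2_measurable)
  let ?t = "\<lambda>n x. indicator (cball 0 (real n)) x *\<^sub>R g x"
  have t: "integrable lebesgue (?t n)" "?t n \<in> L2" for n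
    using L2_mult_indicator[OF g] by auto
  have [measurable]: "?t n \<in> borel_measurable lebesgue" for n using t(2) by (rule L2_measurable)
  have "(\<lambda>n. LINT x|lebesgue. (cmod (?t n x - g x))\<^sup>2) \<longlonglongrightarrow> (LINT x|(lebesgue::(real^'d) measure). 0)"
  proof (rule integral_dominated_convergence[OF _ _ L2_integrable[OF g]])
    show "AE x in lebesgue. (\<lambda>n. (cmod (?t n x - g x))\<^sup>2) \<longlonglongrightarrow> 0"
    proof (intro AE_I2 tendsto_eventually)
      fix x :: "real ^ 'd"
      obtain N where "norm x \<le> real N" using real_arch_simple by blast
      then have "\<forall>n\<ge>N. (cmod (?t n x - g x))\<^sup>2 = 0" by (auto simp: indicator_def dest: order_trans)
      then show "\<forall>\<^sub>F n in sequentially. (cmod (?t n x - g x))\<^sup>2 = 0" by (auto simp: eventually_sequentially)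
    qed
    show "AE x in lebesgue. norm ((cmod (?t n x - g x))\<^sup>2) \<le> (cmod (g x))\<^sup>2" for n
      by (intro AE_I2) (auto split: split_indicator)
  qed measurable
  then have t0: "(\<lambda>n. LINT x|lebesgue. (cmod (?t n x - g x))\<^sup>2) \<longlonglongrightarrow> 0" by simp
  have "\<exists>N. (LINT x|lebesgue. (cmod (?t N x - g x))\<^sup>2) \<le> 1 / 4 ^ n" for n
  proof -
    have "0 < (1::real) / 4 ^ n" by simp
    then have "\<forall>\<^sub>F N in sequentially. (LINT x|lebesgue. (cmod (?t N x - g x))\<^sup>2) < 1 / 4 ^ n"
      by (rule order_tendstoD(2)[OF t0])
    then show ?thesis by (meson eventually_sequentially less_imp_le order_refl)
  qed
  then have "\<forall>n. \<exists>N. (LINT x|lebesgue. (cmod (?t N x - g x))\<^sup>2) \<le> 1 / 4 ^ n" by (rule allI)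
  from choice[OF this] obtain N where "\<forall>n. (LINT x|lebesgue. (cmod (?t (N n) x - g x))\<^sup>2) \<le> 1 / 4 ^ n" ..
  then have N: "(LINT x|lebesgue. (cmod (?t (N n) x - g x))\<^sup>2) \<le> 1 / 4 ^ n" for n by (rule spec)
  define f where "f = (\<lambda>n. ?t (N n))"
  have f: "integrable lebesgue (f n)" "f n \<in> L2" and fg: "(LINT x|lebesgue. (cmod (f n x - g x))\<^sup>2) \<le> 1 / 4 ^ n" for n
    unfolding f_def by (rule t(1), rule t(2), rule N)
  have fL: "L2_tendsto f g"
    unfolding L2_tendsto_def
  proof (intro conjI allI f g)
    show "(\<lambda>n. L2_norm (\<lambda>x. f n x - g x)) \<longlonglongrightarrow> 0"
    proof (rule Lim_null_comparison[OF always_eventually])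
      show "\<forall>n. norm (L2_norm (\<lambda>x. f n x - g x)) \<le> (1 / 2) ^ n"
      proof
        fix n
        have "((1 / 2) ^ n)\<^sup>2 = (1 :: real) / 4 ^ n"
          by (simp add: power2_eq_square power_mult_distrib[symmetric] power_divide)
        then have "(L2_norm (\<lambda>x. f n x - g x))\<^sup>2 \<le> ((1 / 2) ^ n)\<^sup>2"
          using fg[of n] by (simp add: L2_norm_power2)
        then show "norm (L2_norm (\<lambda>x. f n x - g x)) \<le> (1 / 2) ^ n"
          by (subst real_norm_def, subst abs_of_nonneg) (auto intro: power2_le_imp_le)
      qed
    qed (intro LIMSEQ_power_zero, simp)
  qed
  let ?F = "\<lambda>n. fourier_integral (f n)"
  have "\<exists>k. L2_tendsto ?F k"
  proof (rule L2_tendsto_if_rapidly_Cauchy[where C = 4])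
    fix n show "?F n \<in> L2" by (rule Plancherel(1)[OF f])
  next
    fix m n :: nat assume mn: "n \<le> m"
    have "(LINT \<xi>|lebesgue. (cmod (?F m \<xi> - ?F n \<xi>))\<^sup>2) = (LINT \<xi>|lebesgue. (cmod (fourier_integral (\<lambda>x. f m x - f n x) \<xi>))\<^sup>2)"
      by (simp add: fourier_integral_diff[OF f(1) f(1)])
    also have "\<dots> = (LINT x|lebesgue. (cmod (f m x - f n x))\<^sup>2)"
      using f by (intro Plancherel(2) L2_diff) auto
    also have "\<dots> \<le> 2 * ((LINT x|lebesgue. (cmod (f m x - g x))\<^sup>2) + (LINT x|lebesgue. (cmod (g x - f n x))\<^sup>2))"
      by (rule L2_diff_power2_le[OF f(2) g f(2)])
    also have "(LINT x|lebesgue. (cmod (g x - f n x))\<^sup>2) = (LINT x|lebesgue. (cmod (f n x - g x))\<^sup>2)"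
      by (simp add: norm_minus_commute)
    also have "2 * ((LINT x|lebesgue. (cmod (f m x - g x))\<^sup>2) + (LINT x|lebesgue. (cmod (f n x - g x))\<^sup>2)) \<le> 2 * (1 / 4 ^ m + 1 / 4 ^ n)"
      using fg[of m] fg[of n] by simp
    also have "\<dots> \<le> 4 / 4 ^ n"
      using mn by (simp add: field_simps power_increasing)
    finally show "(LINT \<xi>|lebesgue. (cmod (?F m \<xi> - ?F n \<xi>))\<^sup>2) \<le> 4 / 4 ^ n" .
  qed
  then show ?thesis using f(1) fL unfolding is_fourier_L2_def by blast
qed

lemma is_fourier_L2_fourier_L2: "g \<in> L2 \<Longrightarrow> is_fourier_L2 g (fourier_L2 g)"
  unfolding fourier_L2_def using is_fourier_L2_exists by (rule someI_ex)

lemma L2_Cauchy_Schwarz: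
  assumes f: "f \<in> L2" and h: "h \<in> L2"
  shows "cmod (LINT x|lebesgue. f x * h x) \<le> L2_norm f * L2_norm h"
proof -
  have [measurable]: "f \<in> borel_measurable lebesgue" "h \<in> borel_measurable lebesgue"
    using f h by (auto intro: L2_measurable)
  have nn: "(\<integral>\<^sup>+x. ennreal (cmod (k x)) ^ 2 \<partial>lebesgue) = ennreal ((L2_norm k)\<^sup>2)" if "k \<in> L2" for k :: "real ^ 'a \<Rightarrow> complex"
    using nn_integral_eq_integral[OF L2_integrable[OF that]] by (simp add: L2_norm_power2 ennreal_power)
  have i: "integrable lebesgue (\<lambda>x. f x * h x)" by (rule L2_mult_integrable[OF f h])
  have "ennreal ((LINT x|lebesgue. cmod (f x * h x))\<^sup>2) = (\<integral>\<^sup>+x. ennreal (cmod (f x)) * ennreal (cmod (h x)) \<partial>lebesgue)\<^sup>2"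
    using nn_integral_eq_integral[OF integrable_norm[OF i]]
    by (simp add: norm_mult ennreal_mult ennreal_power[symmetric] integral_nonneg_AE)
  also have "\<dots> \<le> ennreal ((L2_norm f)\<^sup>2) * ennreal ((L2_norm h)\<^sup>2)"
    unfolding nn[OF f, symmetric] nn[OF h, symmetric] by (rule Cauchy_Schwarz_nn_integral) measurable
  also have "\<dots> = ennreal ((L2_norm f * L2_norm h)\<^sup>2)"
    by (simp add: ennreal_mult power_mult_distrib)
  finally have "(LINT x|lebesgue. cmod (f x * h x))\<^sup>2 \<le> (L2_norm f * L2_norm h)\<^sup>2"
    by (simp add: ennreal_le_iff)
  then have "(LINT x|lebesgue. cmod (f x * h x)) \<le> L2_norm f * L2_norm h"
    by (rule power2_le_imp_le) simp
  then show ?thesis using integral_norm_bound[of lebesgue "\<lambda>x. f x * h x"] by linarith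
qed

lemma L2_tendsto_integral_mult:
  assumes u: "L2_tendsto u v" and w: "w \<in> L2"
  shows "(\<lambda>n. LINT x|lebesgue. w x * cnj (u n x)) \<longlonglongrightarrow> (LINT x|lebesgue. w x * cnj (v x))"
proof (rule LIM_zero_cancel, rule Lim_null_comparison[OF always_eventually])
  have L: "u n \<in> L2" "v \<in> L2" for n using u by (auto simp: L2_tendsto_def)
  show "\<forall>n. norm ((LINT x|lebesgue. w x * cnj (u n x)) - (LINT x|lebesgue. w x * cnj (v x))) \<le> L2_norm w * L2_norm (\<lambda>x. u n x - v x)"
  proof
    fix n
    have d: "(\<lambda>x. cnj (u n x - v x)) \<in> L2" by (intro L2_cnj L2_diff L)
    have "(LINT x|lebesgue. w x * cnj (u n x)) - (LINT x|lebesgue. w x * cnj (v x)) = (LINT x|lebesgue. w x * cnj (u n x) - w x * cnj (v x))"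
      by (intro Bochner_Integration.integral_diff[symmetric] L2_mult_integrable w L2_cnj L)
    also have "\<dots> = (LINT x|lebesgue. w x * cnj (u n x - v x))"
      by (simp add: algebra_simps)
    finally show "norm ((LINT x|lebesgue. w x * cnj (u n x)) - (LINT x|lebesgue. w x * cnj (v x))) \<le> L2_norm w * L2_norm (\<lambda>x. u n x - v x)"
      using L2_Cauchy_Schwarz[OF w d] by (simp add: L2_norm_def complex_cnj_diff[symmetric] del: complex_cnj_diff)
  qed
  show "(\<lambda>n. L2_norm w * L2_norm (\<lambda>x. u n x - v x)) \<longlonglongrightarrow> 0"
    using u by (intro tendsto_mult_right_zero) (simp add: L2_tendsto_def)
qed

text \<open>
  The multiplication formula in sesquilinear form, extended from integrable functions by continuity of the
  inner product; it holds for every admissible representative \<open>h\<close>.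
\<close>

lemma is_fourier_L2_pairing:
  assumes gh: "is_fourier_L2 g h" and c1: "integrable lebesgue \<phi>" and c2: "\<phi> \<in> L2"
  shows "(LINT x|lebesgue. fourier_integral \<phi> x * cnj (g x)) = (LINT \<xi>|lebesgue. \<phi> (- \<xi>) * cnj (h \<xi>))"
proof -
  obtain f where f: "\<And>n. integrable lebesgue (f n)" and fg: "L2_tendsto f g"
    and Fh: "L2_tendsto (\<lambda>n. fourier_integral (f n)) h"
    using gh unfolding is_fourier_L2_def by blast
  have c2': "(\<lambda>\<xi>. \<phi> (- \<xi>)) \<in> L2" using L2_reflect[OF c2, of 0] by simp
  have [measurable]: "\<phi> \<in> borel_measurable lebesgue" using c1 by auto
  have "(LINT x|lebesgue. fourier_integral \<phi> x * cnj (f n x)) = (LINT \<xi>|lebesgue. \<phi> (- \<xi>) * cnj (fourier_integral (f n) \<xi>))" for n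
  proof -
    have i: "integrable lebesgue (\<lambda>x. cnj (f n x))" using f by simp
    have "(LINT x|lebesgue. fourier_integral \<phi> x * cnj (f n x)) = (LINT \<xi>|lebesgue. \<phi> \<xi> * fourier_integral (\<lambda>x. cnj (f n x)) \<xi>)"
      by (rule fourier_integral_multiplication[OF i c1, symmetric])
    also have "\<dots> = (LINT \<xi>|lebesgue. \<phi> (0 - \<xi>) * fourier_integral (\<lambda>x. cnj (f n x)) (0 - \<xi>))"
    proof (rule integral_lebesgue_reflect[symmetric])
      have "fourier_integral (\<lambda>x. cnj (f n x)) \<in> borel_measurable lebesgue"
        using borel_measurable_fourier_integral[OF i] by (intro measurable_completion) simp
      then show "(\<lambda>\<xi>. \<phi> \<xi> * fourier_integral (\<lambda>x. cnj (f n x)) \<xi>) \<in> borel_measurable lebesgue" by measurable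
    qed
    also have "(\<lambda>\<xi>. fourier_integral (\<lambda>x. cnj (f n x)) (0 - \<xi>)) = (\<lambda>\<xi>. cnj (fourier_integral (f n) \<xi>))"
      unfolding fourier_integral_wave
      by (simp add: wave_minus Bochner_Integration.integral_cnj[symmetric] del: Bochner_Integration.integral_cnj)
    finally show ?thesis by simp
  qed
  moreover have "(\<lambda>n. LINT x|lebesgue. fourier_integral \<phi> x * cnj (f n x)) \<longlonglongrightarrow> (LINT x|lebesgue. fourier_integral \<phi> x * cnj (g x))"
    by (rule L2_tendsto_integral_mult[OF fg Plancherel(1)[OF c1 c2]])
  moreover have "(\<lambda>n. LINT \<xi>|lebesgue. \<phi> (- \<xi>) * cnj (fourier_integral (f n) \<xi>)) \<longlonglongrightarrow> (LINT \<xi>|lebesgue. \<phi> (- \<xi>) * cnj (h \<xi>))"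
    by (rule L2_tendsto_integral_mult[OF Fh c2'])
  ultimately show ?thesis using LIMSEQ_unique by force
qed

section \<open>Parseval's identity\<close>

lemma L2_inner_self: "L2_inner f f = of_real (LINT x|lebesgue. (cmod (f x))\<^sup>2)"
  unfolding L2_inner_def integral_complex_of_real[symmetric] by (simp only: complex_norm_square)

lemma L2_inner_commute: "L2_inner h f = cnj (L2_inner f h)"
  unfolding L2_inner_def Bochner_Integration.integral_cnj[symmetric] by (simp add: mult.commute)

lemma L2_inner_diff_left:
  assumes "f \<in> L2" "g \<in> L2" "h \<in> L2"
  shows "L2_inner (\<lambda>x. f x - g x) h = L2_inner f h - L2_inner g h"
  unfolding L2_inner_def left_diff_distrib
  by (intro Bochner_Integration.integral_diff L2_mult_integrable L2_cnj assms)

lemma L2_inner_sum_left: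
  assumes "\<And>i. i \<in> F \<Longrightarrow> e i \<in> L2" "h \<in> L2"
  shows "L2_inner (\<lambda>x. \<Sum>i\<in>F. c i * e i x) h = (\<Sum>i\<in>F. c i * L2_inner (e i) h)"
proof -
  have "L2_inner (\<lambda>x. \<Sum>i\<in>F. c i * e i x) h = (LINT x|lebesgue. (\<Sum>i\<in>F. c i * (e i x * cnj (h x))))"
    unfolding L2_inner_def by (simp add: sum_distrib_right mult.assoc)
  also have "\<dots> = (\<Sum>i\<in>F. LINT x|lebesgue. c i * (e i x * cnj (h x)))"
    by (intro Bochner_Integration.integral_sum integrable_mult_right L2_mult_integrable L2_cnj assms)
  finally show ?thesis by (simp add: L2_inner_def)
qed

text \<open>
  The two extreme choices of the coefficients give Bessel's inequality (\<open>c\<close> the Fourier coefficients) and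
  the reverse bound in Parseval's identity (\<open>c\<close> from the density of the span).
\<close>

lemma L2_best_approximation:
  assumes fin: "finite F" and e: "\<And>i. i \<in> F \<Longrightarrow> e i \<in> L2"
    and on: "\<And>i j. i \<in> F \<Longrightarrow> j \<in> F \<Longrightarrow> L2_inner (e i) (e j) = (if i = j then 1 else 0)"
    and f: "f \<in> L2"
  shows "(L2_norm (\<lambda>x. f x - (\<Sum>i\<in>F. c i * e i x)))\<^sup>2
    = (L2_norm f)\<^sup>2 - (\<Sum>i\<in>F. (cmod (L2_inner f (e i)))\<^sup>2) + (\<Sum>i\<in>F. (cmod (c i - L2_inner f (e i)))\<^sup>2)"
proof -
  let ?p = "\<lambda>x. \<Sum>i\<in>F. c i * e i x"
  let ?a = "\<lambda>i. L2_inner f (e i)"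
  have p: "?p \<in> L2" using e by (intro L2_sum L2_cmult)
  have pf: "L2_inner ?p f = (\<Sum>i\<in>F. c i * cnj (?a i))"
    using e f by (simp add: L2_inner_sum_left L2_inner_commute[of f])
  have pe: "L2_inner ?p (e j) = c j" if "j \<in> F" for j
  proof -
    have "L2_inner ?p (e j) = (\<Sum>i\<in>F. c i * L2_inner (e i) (e j))" using e that by (intro L2_inner_sum_left) auto
    also have "\<dots> = (\<Sum>i\<in>F. if i = j then c i else 0)" using on that by (intro sum.cong) auto
    also have "\<dots> = c j" using fin that by simp
    finally show ?thesis .
  qed
  have pp: "L2_inner ?p ?p = (\<Sum>i\<in>F. c i * cnj (c i))"
  proof -
    have "L2_inner ?p ?p = (\<Sum>i\<in>F. c i * L2_inner (e i) ?p)" using e p by (intro L2_inner_sum_left) auto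
    also have "\<dots> = (\<Sum>i\<in>F. c i * cnj (c i))"
      by (intro sum.cong refl) (simp add: L2_inner_commute[of _ ?p] pe)
    finally show ?thesis .
  qed
  have "complex_of_real ((L2_norm (\<lambda>x. f x - ?p x))\<^sup>2) = L2_inner (\<lambda>x. f x - ?p x) (\<lambda>x. f x - ?p x)"
    by (simp add: L2_inner_self L2_norm_power2)
  also have "\<dots> = L2_inner f (\<lambda>x. f x - ?p x) - L2_inner ?p (\<lambda>x. f x - ?p x)"
    by (intro L2_inner_diff_left L2_diff f p)
  also have "\<dots> = cnj (L2_inner f f - L2_inner ?p f) - cnj (L2_inner f ?p - L2_inner ?p ?p)"
    using f p by (simp add: L2_inner_commute[of _ "\<lambda>x. f x - ?p x"] L2_inner_diff_left L2_diff del: complex_cnj_diff)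
  also have "\<dots> = L2_inner f f - cnj (L2_inner ?p f) - L2_inner ?p f + cnj (L2_inner ?p ?p)"
    by (simp add: L2_inner_commute[of ?p f] L2_inner_self)
  also have "\<dots> = of_real ((L2_norm f)\<^sup>2) + (\<Sum>i\<in>F. c i * cnj (c i) - cnj (c i) * ?a i - c i * cnj (?a i))"
    unfolding pp pf by (simp add: L2_inner_self L2_norm_power2 sum_subtractf mult.commute)
  also have "(\<Sum>i\<in>F. c i * cnj (c i) - cnj (c i) * ?a i - c i * cnj (?a i))
    = (\<Sum>i\<in>F. of_real ((cmod (c i - ?a i))\<^sup>2) - of_real ((cmod (?a i))\<^sup>2))"
    by (intro sum.cong refl) (simp only: complex_norm_square, simp add: algebra_simps)
  finally have "complex_of_real ((L2_norm (\<lambda>x. f x - ?p x))\<^sup>2)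
     = of_real ((L2_norm f)\<^sup>2 + (\<Sum>i\<in>F. (cmod (c i - ?a i))\<^sup>2 - (cmod (?a i))\<^sup>2))"
    by simp
  then show ?thesis unfolding of_real_eq_iff by (simp add: sum_subtractf)
qed

lemma L2_Bessel:
  assumes onb: "L2_orthonormal_basis I e" and f: "f \<in> L2" and F: "finite F" "F \<subseteq> I"
  shows "(\<Sum>i\<in>F. (cmod (L2_inner f (e i)))\<^sup>2) \<le> (L2_norm f)\<^sup>2"
proof -
  have "0 \<le> (L2_norm (\<lambda>x. f x - (\<Sum>i\<in>F. L2_inner f (e i) * e i x)))\<^sup>2" by simp
  also have "\<dots> = (L2_norm f)\<^sup>2 - (\<Sum>i\<in>F. (cmod (L2_inner f (e i)))\<^sup>2) + (\<Sum>i\<in>F. (cmod (L2_inner f (e i) - L2_inner f (e i)))\<^sup>2)"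
    by (rule L2_best_approximation) (use assms in \<open>auto simp: L2_orthonormal_basis_def subset_iff\<close>)
  finally show ?thesis by simp
qed

lemma L2_Parseval:
  assumes onb: "L2_orthonormal_basis I e" and f: "f \<in> L2"
  shows "((\<lambda>i. (cmod (L2_inner f (e i)))\<^sup>2) has_sum (L2_norm f)\<^sup>2) I"
proof -
  let ?s = "\<lambda>i. (cmod (L2_inner f (e i)))\<^sup>2"
  have bdd: "bdd_above (sum ?s ` {F. F \<subseteq> I \<and> finite F})"
    using L2_Bessel[OF onb f] by (auto simp: bdd_above_def)
  then have hs: "(?s has_sum (SUP F\<in>{F. finite F \<and> F \<subseteq> I}. sum ?s F)) I"
    by (intro nonneg_bdd_above_has_sum) auto
  moreover have "(SUP F\<in>{F. finite F \<and> F \<subseteq> I}. sum ?s F) = (L2_norm f)\<^sup>2"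
  proof (rule antisym)
    show "(SUP F\<in>{F. finite F \<and> F \<subseteq> I}. sum ?s F) \<le> (L2_norm f)\<^sup>2"
      using L2_Bessel[OF onb f] by (intro cSUP_least) auto
    show "(L2_norm f)\<^sup>2 \<le> (SUP F\<in>{F. finite F \<and> F \<subseteq> I}. sum ?s F)"
    proof (rule field_le_epsilon)
      fix \<epsilon> :: real assume "\<epsilon> > 0"
      then have "sqrt \<epsilon> > 0" by simp
      then obtain F c where F: "finite F" "F \<subseteq> I" and lt: "L2_norm (\<lambda>x. f x - (\<Sum>i\<in>F. c i * e i x)) < sqrt \<epsilon>"
        using onb f unfolding L2_orthonormal_basis_def by blast
      have "(L2_norm f)\<^sup>2 - sum ?s F \<le> (L2_norm f)\<^sup>2 - sum ?s F + (\<Sum>i\<in>F. (cmod (c i - L2_inner f (e i)))\<^sup>2)"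
        by (simp add: sum_nonneg)
      also have "\<dots> = (L2_norm (\<lambda>x. f x - (\<Sum>i\<in>F. c i * e i x)))\<^sup>2"
        by (rule L2_best_approximation[symmetric]) (use onb F f in \<open>auto simp: L2_orthonormal_basis_def subset_iff\<close>)
      also have "\<dots> \<le> (sqrt \<epsilon>)\<^sup>2" using lt by (intro power_mono) auto
      finally have "(L2_norm f)\<^sup>2 \<le> sum ?s F + \<epsilon>" using \<open>\<epsilon> > 0\<close> by simp
      also have "sum ?s F \<le> (SUP F\<in>{F. finite F \<and> F \<subseteq> I}. sum ?s F)"
        using F bdd by (intro cSUP_upper) (auto simp: conj_commute)
      finally show "(L2_norm f)\<^sup>2 \<le> (SUP F\<in>{F. finite F \<and> F \<subseteq> I}. sum ?s F) + \<epsilon>" by simp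
    qed
  qed
  ultimately show ?thesis by simp
qed

section \<open>Tilings by translates of a nonnegative function\<close>

lemma translate_cube_eq: "(+) x ` cbox 0 (vec r) = cbox x (x + vec r :: real ^ 'd)"
  using cbox_translation[of x 0 "vec r"] by simp

lemma emeasure_cube:
  assumes "0 \<le> r"
  shows "emeasure lebesgue (cbox x (x + vec r :: real ^ 'd)) = ennreal (r ^ CARD('d))"
proof -
  have b: "vec r \<bullet> b = r" if "b \<in> Basis" for b :: "real ^ 'd"
    using that by (auto simp: Basis_vec_def inner_axis)
  have "emeasure lborel (cbox x (x + vec r)) = (\<Prod>b\<in>Basis. ((x + vec r) - x) \<bullet> b)"
    by (rule emeasure_lborel_cbox) (simp add: b inner_add_left assms)
  then show ?thesis by (simp add: b)
qed

text \<open>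
  The tiling identity integrated over a cube: the point \<open>u + l\<close> lies in the cube at \<open>x\<close> exactly if
  \<open>l\<close> lies in the cube at \<open>x - u\<close>.
\<close>

lemma tiling_cube_count:
  fixes H :: "real ^ 'd \<Rightarrow> ennreal"
  assumes L: "countable \<Lambda>" and H [measurable]: "H \<in> borel_measurable lebesgue"
    and tile: "AE \<eta> in lebesgue. (\<integral>\<^sup>+l. H (\<eta> - l) \<partial>count_space \<Lambda>) = ennreal c"
    and r: "0 \<le> r"
  shows "(\<integral>\<^sup>+u. H u * emeasure (count_space \<Lambda>) (\<Lambda> \<inter> cbox (x - u) (x - u + vec r)) \<partial>lebesgue) = ennreal c * ennreal (r ^ CARD('d))"
proof -
  let ?Q = "cbox x (x + vec r)"
  have [measurable]: "?Q \<in> sets lebesgue" by simp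
  have mt: "(\<lambda>\<eta>. H (\<eta> - l) * indicator ?Q \<eta>) \<in> borel_measurable lebesgue" for l by measurable
  have iQ: "(\<lambda>\<eta>. indicator ?Q (\<eta> + l) :: ennreal) \<in> borel_measurable lebesgue" for l
    by (rule measurable_completion) measurable
  have "ennreal c * ennreal (r ^ CARD('d)) = (\<integral>\<^sup>+\<eta>. ennreal c * indicator ?Q \<eta> \<partial>lebesgue)"
    using emeasure_cube[OF r, of x] by (simp add: nn_integral_cmult)
  also have "\<dots> = (\<integral>\<^sup>+\<eta>. (\<integral>\<^sup>+l. H (\<eta> - l) * indicator ?Q \<eta> \<partial>count_space \<Lambda>) \<partial>lebesgue)"
    by (rule nn_integral_cong_AE, use tile in eventually_elim) (simp add: nn_integral_multc)
  also have "\<dots> = (\<integral>\<^sup>+l. (\<integral>\<^sup>+\<eta>. H (\<eta> - l) * indicator ?Q \<eta> \<partial>lebesgue) \<partial>count_space \<Lambda>)"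
    by (intro nn_integral_count_space_nn_integral L mt)
  also have "\<dots> = (\<integral>\<^sup>+l. (\<integral>\<^sup>+u. H u * indicator ?Q (u + l) \<partial>lebesgue) \<partial>count_space \<Lambda>)"
  proof (rule nn_integral_cong)
    fix l
    show "(\<integral>\<^sup>+\<eta>. H (\<eta> - l) * indicator ?Q \<eta> \<partial>lebesgue) = (\<integral>\<^sup>+u. H u * indicator ?Q (u + l) \<partial>lebesgue)"
      using nn_integral_lebesgue_translate[of "\<lambda>u. H u * indicator ?Q (u + l)" l] iQ by simp
  qed
  also have "\<dots> = (\<integral>\<^sup>+u. (\<integral>\<^sup>+l. H u * indicator ?Q (u + l) \<partial>count_space \<Lambda>) \<partial>lebesgue)"
    using iQ by (intro nn_integral_count_space_nn_integral[symmetric] L) measurable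
  also have "\<dots> = (\<integral>\<^sup>+u. H u * emeasure (count_space \<Lambda>) (\<Lambda> \<inter> cbox (x - u) (x - u + vec r)) \<partial>lebesgue)"
  proof (rule nn_integral_cong)
    fix u
    have "(\<integral>\<^sup>+l. H u * indicator ?Q (u + l) \<partial>count_space \<Lambda>) = H u * (\<integral>\<^sup>+l. indicator ?Q (u + l) \<partial>count_space \<Lambda>)"
      by (rule nn_integral_cmult) simp
    also have "(\<integral>\<^sup>+l. indicator ?Q (u + l) \<partial>count_space \<Lambda>) = (\<integral>\<^sup>+l. indicator (\<Lambda> \<inter> cbox (x - u) (x - u + vec r)) l \<partial>count_space \<Lambda>)"
      by (intro nn_integral_cong) (auto simp: indicator_def mem_box algebra_simps)
    finally show "(\<integral>\<^sup>+l. H u * indicator ?Q (u + l) \<partial>count_space \<Lambda>) = H u * emeasure (count_space \<Lambda>) (\<Lambda> \<inter> cbox (x - u) (x - u + vec r))"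
      by simp
  qed
  finally show ?thesis ..
qed

lemma tendsto_power_quotient_at_top: "((\<lambda>r::real. (r + a) ^ d / r ^ d) \<longlongrightarrow> 1) at_top"
proof -
  have "((\<lambda>r::real. (1 + a / r) ^ d) \<longlongrightarrow> (1 + 0) ^ d) at_top"
    by (intro tendsto_intros tendsto_divide_0[OF tendsto_const] filterlim_at_top_imp_at_infinity filterlim_ident)
  moreover have "\<forall>\<^sub>F r::real in at_top. (1 + a / r) ^ d = (r + a) ^ d / r ^ d"
    using eventually_gt_at_top[of 0]
  proof eventually_elim
    case (elim r)
    then have "1 + a / r = (r + a) / r" by (simp add: field_simps)
    then show ?case by (simp only: power_divide)
  qed
  ultimately show ?thesis by (simp add: tendsto_cong)
qed

text \<open>
  Let \<open>N x r\<close> count the points of \<open>\<Lambda>\<close> in the cube of side \<open>r\<close> at \<open>x\<close>. The integrated tiling identity says that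
  the average of \<open>N (x - u) r\<close> with weight \<open>H u\<close> is \<open>c r\<^sup>d\<close>. For \<open>u\<close> in the box \<open>B n\<close> the cubes at
  \<open>x\<close> and \<open>x - u\<close> are nested after enlarging one of them by \<open>2 n\<close>, which changes \<open>r\<^sup>d\<close> by a factor
  tending to \<open>1\<close>. Dropping the part of \<open>H\<close> outside \<open>B n\<close> gives the upper bound; this bound for one \<open>n\<close>
  also controls the contribution of that part, which gives the lower bound.
  If \<open>H\<close> is not integrable, the upper bound alone forces density \<open>0\<close>; the quotient by \<open>\<infinity>\<close> is \<open>0\<close> too.
\<close>

theorem tiling_uniform_density:
  fixes H :: "real ^ 'd \<Rightarrow> ennreal"
  assumes L: "countable \<Lambda>" and H [measurable]: "H \<in> borel_measurable lebesgue"
    and tile: "AE \<eta> in lebesgue. (\<integral>\<^sup>+l. H (\<eta> - l) \<partial>count_space \<Lambda>) = ennreal c"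
    and c: "c > 0"
  shows "0 < integral\<^sup>N lebesgue H"
    and "has_uniform_density \<Lambda> (enn2real (ennreal c / integral\<^sup>N lebesgue H))"
proof -
  let ?d = "CARD('d)"
  define Q where "Q = (\<lambda>(x :: real ^ 'd) r. cbox x (x + vec r))"
  define N where "N = (\<lambda>x r. emeasure (count_space \<Lambda>) (\<Lambda> \<inter> Q x r))"
  define M where "M = integral\<^sup>N lebesgue H"
  define B where "B = (\<lambda>n::nat. cbox (- vec (real n)) (vec (real n) :: real ^ 'd))"
  define m where "m = (\<lambda>n. \<integral>\<^sup>+u. H u * indicator (B n) u \<partial>lebesgue)"
  have [measurable]: "B n \<in> sets lebesgue" for n by (simp add: B_def)
  have star: "(\<integral>\<^sup>+u. H u * N (x - u) r \<partial>lebesgue) = ennreal (c * r ^ ?d)" if "0 \<le> r" for x r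
    using tiling_cube_count[OF L H tile that, of x] c that by (simp add: N_def Q_def ennreal_mult)
  have Nmono: "N x r \<le> N y s" if "Q x r \<subseteq> Q y s" for x y r s
    unfolding N_def using that by (intro emeasure_mono) auto
  have Qsub: "Q x r \<subseteq> Q y s" if "\<And>i. y $ i \<le> x $ i" "\<And>i. x $ i + r \<le> y $ i + s" for x y r s
  proof
    fix z assume z: "z \<in> Q x r"
    have "y $ i \<le> z $ i \<and> z $ i \<le> y $ i + s" for i
    proof -
      have "x $ i \<le> z $ i" "z $ i \<le> x $ i + r" using z by (auto simp: Q_def mem_box_cart)
      then show ?thesis using that[of i] by linarith
    qed
    then show "z \<in> Q y s" by (simp add: Q_def mem_box_cart)
  qed
  (* For every u in B n the cube of side r + 2 n at x - n - u contains the cube of side r at x. *)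
  have upper: "N x r * m n \<le> ennreal (c * (r + 2 * real n) ^ ?d)" if r: "0 \<le> r" for x r n
  proof -
    have "N x r * m n = (\<integral>\<^sup>+u. N x r * (H u * indicator (B n) u) \<partial>lebesgue)"
      unfolding m_def by (rule nn_integral_cmult[symmetric]) measurable
    also have "\<dots> \<le> (\<integral>\<^sup>+u. H u * N (x - vec (real n) - u) (r + 2 * real n) \<partial>lebesgue)"
    proof (rule nn_integral_mono)
      fix u
      have "N x r \<le> N (x - vec (real n) - u) (r + 2 * real n)" if "u \<in> B n"
      proof (rule Nmono)
        have b: "- real n \<le> u $ i \<and> u $ i \<le> real n" for i
          using that by (auto simp: B_def mem_box_cart)
        show "Q x r \<subseteq> Q (x - vec (real n) - u) (r + 2 * real n)"
        proof (rule Qsub)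
          fix i
          show "(x - vec (real n) - u) $ i \<le> x $ i" using b[of i] by simp
          show "x $ i + r \<le> (x - vec (real n) - u) $ i + (r + 2 * real n)" using b[of i] by simp
        qed
      qed
      then show "N x r * (H u * indicator (B n) u) \<le> H u * N (x - vec (real n) - u) (r + 2 * real n)"
        by (auto split: split_indicator simp: mult.commute intro: mult_left_mono)
    qed
    also have "\<dots> = ennreal (c * (r + 2 * real n) ^ ?d)" using r by (intro star) simp
    finally show ?thesis .
  qed
  have m_le: "m n \<le> M" for n unfolding m_def M_def by (intro nn_integral_mono) (auto split: split_indicator)
  have m_lim: "m \<longlonglongrightarrow> M"
    unfolding m_def M_def
  proof (rule nn_integral_LIMSEQ)
    have "B n \<subseteq> B (Suc n)" for n
    proof
      fix z assume "z \<in> B n"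
      then have "- real n \<le> z $ i" "z $ i \<le> real n" for i by (auto simp: B_def mem_box_cart)
      then have "- real (Suc n) \<le> z $ i \<and> z $ i \<le> real (Suc n)" for i
        by (metis (no_types) le_imp_neg_le lessI less_imp_le of_nat_le_iff order_trans)
      then show "z \<in> B (Suc n)" by (simp add: B_def mem_box_cart)
    qed
    then show "incseq (\<lambda>n u. H u * indicator (B n) u)"
      by (intro incseq_SucI le_funI mult_left_mono) (auto split: split_indicator)
    fix u :: "real ^ 'd"
    obtain n0 where n0: "norm u \<le> real n0" using real_arch_simple by blast
    have "u \<in> B n" if "n \<ge> n0" for n
    proof -
      have "\<bar>u $ i\<bar> \<le> real n" for i using component_le_norm_cart[of u i] n0 that by linarith
      then show ?thesis by (auto simp: B_def mem_box_cart abs_le_iff) (smt (verit))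
    qed
    then have "\<forall>\<^sub>F n in sequentially. H u * indicator (B n) u = H u"
      unfolding eventually_sequentially by (intro exI[of _ n0]) auto
    then show "(\<lambda>n. H u * indicator (B n) u) \<longlonglongrightarrow> H u" by (rule tendsto_eventually)
  qed measurable
  have M0: "M > 0"
  proof (rule ccontr)
    assume "\<not> M > 0"
    then have "AE u in lebesgue. H u = 0" unfolding M_def by (simp add: nn_integral_0_iff_AE)
    then have "AE u in lebesgue. H u * N (0 - u) 1 = 0" by eventually_elim simp
    then have "(\<integral>\<^sup>+u. H u * N (0 - u) 1 \<partial>lebesgue) = (\<integral>\<^sup>+u. 0 \<partial>(lebesgue :: (real^'d) measure))" by (rule nn_integral_cong_AE)
    then show False using star[of 1 0] c by simp
  qed
  have m_fin: "m n < \<infinity>" for n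
  proof (rule ccontr)
    assume "\<not> m n < \<infinity>"
    then have top: "m n = \<infinity>" by (simp add: less_top[symmetric])
    have "N x 1 = 0" for x
    proof (rule ccontr)
      assume "N x 1 \<noteq> 0"
      then show False using upper[of 1 x n] top by (simp add: ennreal_mult_top top_unique)
    qed
    then show False using star[of 1 0] c by simp
  qed
  define \<mu> where "\<mu> = (\<lambda>n. enn2real (m n))"
  have m_\<mu>: "m n = ennreal (\<mu> n)" for n using m_fin[of n] by (simp add: \<mu>_def less_top)
  have \<mu>0: "\<mu> n \<ge> 0" for n by (simp add: \<mu>_def)
  obtain n0 where n0: "\<mu> n0 > 0"
  proof -
    have "\<forall>\<^sub>F n in sequentially. m n > 0" by (rule order_tendstoD(1)[OF m_lim M0])
    then obtain n where "m n > 0" by (auto simp: eventually_sequentially)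
    then show thesis using that[of n] by (simp add: m_\<mu>)
  qed
  have Nfin: "N x r < \<infinity>" if "0 \<le> r" for x r
  proof (rule ccontr)
    assume "\<not> N x r < \<infinity>"
    then have "N x r = \<infinity>" by (simp add: less_top[symmetric])
    then show False using upper[OF that, of x n0] n0 by (simp add: m_\<mu> ennreal_top_mult top_unique)
  qed
  define \<nu> where "\<nu> = (\<lambda>x r. real (card (\<Lambda> \<inter> Q x r)))"
  have fin: "finite (\<Lambda> \<inter> Q x r)" for x r
  proof (cases "0 \<le> r")
    case True
    then show ?thesis using Nfin[OF True, of x] by (auto simp: N_def emeasure_count_space split: if_splits)
  next
    case False
    then have "Q x r = {}" by (simp add: Q_def interval_eq_empty_cart)
    then show ?thesis by simp
  qed
  have N\<nu>: "N x r = ennreal (\<nu> x r)" for x r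
    using fin[of x r] by (simp add: N_def \<nu>_def emeasure_count_space ennreal_of_nat_eq_real_of_nat)
  have up: "\<nu> x r * \<mu> n \<le> c * (r + 2 * real n) ^ ?d" if "0 \<le> r" for x r n
    using upper[OF that, of x n] c that \<mu>0[of n]
    by (simp add: N\<nu> m_\<mu> ennreal_mult[symmetric] \<nu>_def)
  define D where "D = enn2real (ennreal c / M)"
  have ev_upper: "\<forall>\<^sub>F r in at_top. \<forall>x. \<nu> x r / r ^ ?d < D + e" if e: "e > 0" for e
  proof -
    have D0: "D \<ge> 0" by (simp add: D_def)
    have "ennreal (c / (D + e)) < M"
    proof (cases "M = \<infinity>")
      case False
      define \<mu>' where "\<mu>' = enn2real M"
      have M\<mu>: "M = ennreal \<mu>'" using False by (simp add: \<mu>'_def less_top)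
      have \<mu>'0: "\<mu>' > 0" using M0 by (simp add: M\<mu>)
      have D: "D * \<mu>' = c" using c \<mu>'0 by (simp add: D_def M\<mu> divide_ennreal)
      have "c < \<mu>' * (D + e)" using D e \<mu>'0 by (simp add: algebra_simps)
      then have "c / (D + e) < \<mu>'" using D0 e by (simp add: pos_divide_less_eq)
      then show ?thesis using c D0 e \<mu>'0 by (simp add: M\<mu> ennreal_less_iff)
    qed (simp add: less_top[symmetric])
    then have "\<forall>\<^sub>F n in sequentially. ennreal (c / (D + e)) < m n"
      by (rule order_tendstoD(1)[OF m_lim])
    then obtain n where n: "ennreal (c / (D + e)) < m n"
      by (auto simp: eventually_sequentially)
    have *: "c / (D + e) < \<mu> n" "0 < c / (D + e)"
      using n c D0 e by (auto simp: m_\<mu> ennreal_less_iff)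
    then have mn: "\<mu> n > 0" by linarith
    have cn: "c / \<mu> n < D + e"
      using * mn D0 e by (simp add: field_simps)
    have "((\<lambda>r. c / \<mu> n * ((r + 2 * real n) ^ ?d / r ^ ?d)) \<longlongrightarrow> c / \<mu> n * 1) at_top"
      by (intro tendsto_intros tendsto_power_quotient_at_top)
    then have "\<forall>\<^sub>F r in at_top. c / \<mu> n * ((r + 2 * real n) ^ ?d / r ^ ?d) < D + e"
      using cn by (intro order_tendstoD(2)) auto
    then show ?thesis using eventually_gt_at_top[of 0]
    proof eventually_elim
      case (elim r)
      show ?case
      proof
        fix x
        have "\<nu> x r \<le> c / \<mu> n * (r + 2 * real n) ^ ?d"
          using up[of r x n] elim(2) mn by (simp add: field_simps)
        then have "\<nu> x r / r ^ ?d \<le> c / \<mu> n * (r + 2 * real n) ^ ?d / r ^ ?d"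
          using elim(2) by (intro divide_right_mono) auto
        then show "\<nu> x r / r ^ ?d < D + e" using elim(1) by simp
      qed
    qed
  qed
  have ev_lower: "\<forall>\<^sub>F r in at_top. \<forall>x. D - e < \<nu> x r / r ^ ?d" if e: "e > 0" for e
  proof (cases "M = \<infinity>")
    case True
    then have "D = 0" by (simp add: D_def)
    have "D - e < \<nu> x r / r ^ ?d" if "r > 0" for x r
    proof -
      have "0 \<le> \<nu> x r / r ^ ?d" using that by (simp add: \<nu>_def)
      then show ?thesis using e \<open>D = 0\<close> by linarith
    qed
    then show ?thesis by (intro eventually_mono[OF eventually_gt_at_top[of 0]]) auto
  next
    case False
    define \<mu>' where "\<mu>' = enn2real M"
    have M\<mu>: "M = ennreal \<mu>'" using False by (simp add: \<mu>'_def less_top)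
    have \<mu>'0: "\<mu>' > 0" using M0 by (simp add: M\<mu>)
    have D: "D = c / \<mu>'" using c \<mu>'0 by (simp add: D_def M\<mu> divide_ennreal)
    have \<mu>_lim: "\<mu> \<longlonglongrightarrow> \<mu>'"
    proof -
      have "m = (\<lambda>n. ennreal (\<mu> n))" using m_\<mu> by (simp add: fun_eq_iff)
      then have "(\<lambda>n. ennreal (\<mu> n)) \<longlonglongrightarrow> ennreal \<mu>'" using m_lim M\<mu> by simp
      then show ?thesis using \<mu>0 \<mu>'0 by (simp add: tendsto_ennreal_iff)
    qed
    define C where "C = c / \<mu> n0"
    have C: "\<nu> x r \<le> C * (r + 2 * real n0) ^ ?d" if "0 \<le> r" for x r
      using up[OF that, of x n0] n0 by (simp add: C_def field_simps)
    (* Inside B n the count is compared with a single larger cube; outside it is at most the a priori bound C. *)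
    have low: "c * r ^ ?d \<le> \<nu> (x - vec (real n)) (r + 2 * real n) * \<mu>' + (\<mu>' - \<mu> n) * (C * (r + 2 * real n0) ^ ?d)"
      if r: "0 \<le> r" for x r n
    proof -
      let ?K = "C * (r + 2 * real n0) ^ ?d" and ?n = "\<nu> (x - vec (real n)) (r + 2 * real n)"
      have K0: "?K \<ge> 0" using n0 c r by (simp add: C_def)
      have n_0: "?n \<ge> 0" by (simp add: \<nu>_def)
      have rest: "(\<integral>\<^sup>+u. H u * indicator (- B n) u \<partial>lebesgue) = ennreal (\<mu>' - \<mu> n)"
      proof -
        have "M = (\<integral>\<^sup>+u. H u * indicator (B n) u + H u * indicator (- B n) u \<partial>lebesgue)"
          unfolding M_def by (intro nn_integral_cong) (auto split: split_indicator)
        also have "\<dots> = m n + (\<integral>\<^sup>+u. H u * indicator (- B n) u \<partial>lebesgue)"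
          unfolding m_def by (intro nn_integral_add) measurable
        finally have "(\<integral>\<^sup>+u. H u * indicator (- B n) u \<partial>lebesgue) = M - m n"
          using m_fin[of n] by (simp add: ennreal_add_diff_cancel_left less_top[symmetric])
        then show ?thesis using \<mu>0 by (simp add: M\<mu> m_\<mu> ennreal_minus)
      qed
      have "ennreal (c * r ^ ?d) = (\<integral>\<^sup>+u. H u * N (x - u) r \<partial>lebesgue)" using star[OF r] by simp
      also have "\<dots> \<le> (\<integral>\<^sup>+u. H u * ennreal ?n + H u * indicator (- B n) u * ennreal ?K \<partial>lebesgue)"
      proof (rule nn_integral_mono)
        fix u
        show "H u * N (x - u) r \<le> H u * ennreal ?n + H u * indicator (- B n) u * ennreal ?K"
        proof (cases "u \<in> B n")
          case True
          have b: "- real n \<le> u $ i \<and> u $ i \<le> real n" for i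
            using True by (auto simp: B_def mem_box_cart)
          have "Q (x - u) r \<subseteq> Q (x - vec (real n)) (r + 2 * real n)"
          proof (rule Qsub)
            fix i
            show "(x - vec (real n)) $ i \<le> (x - u) $ i" using b[of i] by simp
            show "(x - u) $ i + r \<le> (x - vec (real n)) $ i + (r + 2 * real n)" using b[of i] by simp
          qed
          then have "N (x - u) r \<le> ennreal ?n" unfolding N\<nu>[symmetric] by (rule Nmono)
          then show ?thesis using True by (simp add: mult_left_mono)
        next
          case False
          have "N (x - u) r \<le> ennreal ?K" unfolding N\<nu> using C[OF r] by (rule ennreal_leI)
          then have "H u * N (x - u) r \<le> H u * ennreal ?K" by (rule mult_left_mono) simp
          then show ?thesis using False by (simp add: add_increasing)
        qed
      qed
      also have "\<dots> = M * ennreal ?n + ennreal (\<mu>' - \<mu> n) * ennreal ?K"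
        unfolding rest[symmetric] M_def by (subst nn_integral_add) (auto simp: nn_integral_multc)
      also have "\<dots> = ennreal (\<mu>' * ?n + (\<mu>' - \<mu> n) * ?K)"
      proof -
        have "\<mu>' - \<mu> n \<ge> 0" using m_le[of n] \<mu>'0 by (simp add: M\<mu> m_\<mu>)
        then show ?thesis using \<mu>'0 n_0 K0 by (simp add: M\<mu> ennreal_mult ennreal_plus)
      qed
      finally have "c * r ^ ?d \<le> \<mu>' * ?n + (\<mu>' - \<mu> n) * ?K"
        by (rule ennreal_le_iff[THEN iffD1, rotated])
          (use m_le[of n] \<mu>'0 n_0 K0 in \<open>simp add: M\<mu> m_\<mu>\<close>)
      then show ?thesis by (simp add: mult.commute)
    qed
    have "(\<lambda>n. (\<mu>' - \<mu> n) * C / \<mu>') \<longlonglongrightarrow> (\<mu>' - \<mu>') * C / \<mu>'"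
      by (intro tendsto_intros \<mu>_lim) (use \<mu>'0 in simp)
    then have "\<forall>\<^sub>F n in sequentially. (\<mu>' - \<mu> n) * C / \<mu>' < e"
      using e by (intro order_tendstoD(2)) auto
    then obtain n where n: "(\<mu>' - \<mu> n) * C / \<mu>' < e" by (auto simp: eventually_sequentially)
    let ?g = "\<lambda>r. (c * ((r + - (2 * real n)) ^ ?d / r ^ ?d) - (\<mu>' - \<mu> n) * C * ((r + (2 * real n0 - 2 * real n)) ^ ?d / r ^ ?d)) / \<mu>'"
    have "(?g \<longlongrightarrow> (c * 1 - (\<mu>' - \<mu> n) * C * 1) / \<mu>') at_top"
      by (intro tendsto_intros tendsto_power_quotient_at_top) (use \<mu>'0 in simp)
    then have "\<forall>\<^sub>F r in at_top. D - e < ?g r"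
      using n by (intro order_tendstoD(1)) (auto simp: D diff_divide_distrib)
    then show ?thesis using eventually_gt_at_top[of "2 * real n"] eventually_gt_at_top[of 0]
    proof eventually_elim
      case (elim r)
      show ?case
      proof
        fix x
        let ?X = "c * (r - 2 * real n) ^ ?d - (\<mu>' - \<mu> n) * (C * (r - 2 * real n + 2 * real n0) ^ ?d)"
        have "?X \<le> \<nu> x r * \<mu>'"
          using low[of "r - 2 * real n" "x + vec (real n)" n] elim(2) by simp
        then have "?X / \<mu>' \<le> \<nu> x r" using \<mu>'0 by (simp add: pos_divide_le_eq)
        then have "?X / \<mu>' / r ^ ?d \<le> \<nu> x r / r ^ ?d" using elim(3) by (intro divide_right_mono) auto
        moreover have "?X / \<mu>' / r ^ ?d = ?g r"
        proof -
          have "(c * p - a * (C * q)) / b / R = (c * (p / R) - a * C * (q / R)) / b" for p q a b R :: real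
            by (simp add: diff_divide_distrib mult_ac)
          moreover have "r + - (2 * real n) = r - 2 * real n"
            "r + (2 * real n0 - 2 * real n) = r - 2 * real n + 2 * real n0" by simp_all
          ultimately show ?thesis by (simp only:)
        qed
        ultimately show "D - e < \<nu> x r / r ^ ?d" using elim(1) by linarith
      qed
    qed
  qed
  show "0 < integral\<^sup>N lebesgue H" using M0 by (simp add: M_def)
  show "has_uniform_density \<Lambda> (enn2real (ennreal c / integral\<^sup>N lebesgue H))"
    unfolding has_uniform_density_def translate_cube_eq M_def[symmetric] D_def[symmetric]
  proof (intro conjI allI)
    fix x r show "finite (\<Lambda> \<inter> cbox x (x + vec r))" using fin[of x r] by (simp add: Q_def)
  next
    show "uniform_limit UNIV (\<lambda>r x. real (card (\<Lambda> \<inter> cbox x (x + vec r))) / r ^ ?d) (\<lambda>x. D) at_top"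
    proof (rule uniform_limitI)
      fix e :: real assume e: "e > 0"
      show "\<forall>\<^sub>F r in at_top. \<forall>x\<in>UNIV. dist (real (card (\<Lambda> \<inter> cbox x (x + vec r))) / r ^ ?d) D < e"
        using ev_upper[OF e] ev_lower[OF e]
      proof eventually_elim
        case (elim r)
        show ?case
        proof
          fix x
          show "dist (real (card (\<Lambda> \<inter> cbox x (x + vec r))) / r ^ ?d) D < e"
            using elim(1)[rule_format, of x] elim(2)[rule_format, of x]
            by (simp add: dist_real_def \<nu>_def Q_def abs_less_iff)
        qed
      qed
    qed
  qed
qed

section \<open>Periodizations and windowed transforms\<close>

text \<open>
  Sums are handled as integrals over counting measures, where Tonelli's theorem needs no summability.
\<close>

lemma has_sum_iff_nn_integral_count_space:
  fixes f :: "'a \<Rightarrow> real"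
  assumes f: "\<And>x. x \<in> A \<Longrightarrow> 0 \<le> f x" and s: "0 \<le> s"
  shows "(f has_sum s) A \<longleftrightarrow> (\<integral>\<^sup>+x. ennreal (f x) \<partial>count_space A) = ennreal s"
proof
  assume hs: "(f has_sum s) A"
  then have "(\<lambda>x. norm (f x)) summable_on A"
    using f by (subst summable_on_cong[where g = f]) (auto simp: has_sum_imp_summable)
  then have i: "integrable (count_space A) f"
    using abs_summable_equivalent[of f A] unfolding Infinite_Set_Sum.abs_summable_on_def by simp
  have "integral\<^sup>L (count_space A) f = s"
    using infsetsum_infsum[of f A] i infsumI[OF hs]
    unfolding Infinite_Set_Sum.abs_summable_on_def infsetsum_def by simp
  then show "(\<integral>\<^sup>+x. ennreal (f x) \<partial>count_space A) = ennreal s"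
    using nn_integral_eq_integral[OF i] f by (simp add: AE_count_space)
next
  assume e: "(\<integral>\<^sup>+x. ennreal (f x) \<partial>count_space A) = ennreal s"
  have i: "integrable (count_space A) f"
    using f e by (intro integrableI_nonneg) (auto simp: AE_count_space)
  then have as: "Infinite_Set_Sum.abs_summable_on f A"
    unfolding Infinite_Set_Sum.abs_summable_on_def .
  have "integral\<^sup>L (count_space A) f = s"
    using nn_integral_eq_integral[OF i] f e s by (auto simp: AE_count_space integral_nonneg_AE)
  then have "infsum f A = s"
    using infsetsum_infsum[OF as] unfolding infsetsum_def by simp
  moreover have "f summable_on A"
    using abs_summable_equivalent[of f A] as f
    by (subst (asm) summable_on_cong[where g = f]) auto
  ultimately show "(f has_sum s) A" by (simp add: has_sum_iff)
qed

lemma borel_measurable_nn_integral_count_space: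
  assumes A: "countable A" and f: "\<And>a. a \<in> A \<Longrightarrow> f a \<in> borel_measurable M"
  shows "(\<lambda>x. \<integral>\<^sup>+a. f a x \<partial>count_space A) \<in> borel_measurable M"
proof -
  interpret sigma_finite_measure "count_space A" by (rule sigma_finite_measure_count_space_countable[OF A])
  have "(\<lambda>p. f (snd p) (fst p)) \<in> borel_measurable (M \<Otimes>\<^sub>M count_space A)"
    by (rule measurable_compose_countable'[where f = "\<lambda>a p. f a (fst p)" and g = snd and I = A])
      (use A f in \<open>auto intro: measurable_compose[OF measurable_fst]\<close>)
  then show ?thesis
    using borel_measurable_nn_integral[of "\<lambda>x a. f a x" M] by (simp add: case_prod_unfold)
qed

lemma
  fixes f :: "'a \<times> 'b \<Rightarrow> ennreal"
  shows nn_integral_count_space_Times_fst: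
      "(\<integral>\<^sup>+a. \<integral>\<^sup>+b. f (a, b) \<partial>count_space B \<partial>count_space A) = integral\<^sup>N (count_space (A \<times> B)) f"
    and nn_integral_count_space_Times_snd:
      "(\<integral>\<^sup>+b. \<integral>\<^sup>+a. f (a, b) \<partial>count_space A \<partial>count_space B) = integral\<^sup>N (count_space (A \<times> B)) f"
proof -
  let ?f = "\<lambda>p. f p * indicator (A \<times> B) p"
  have 0: "integral\<^sup>N (count_space UNIV) ?f = integral\<^sup>N (count_space (A \<times> B)) f"
    by (simp add: nn_integral_count_space_indicator)
  have outer: "(\<integral>\<^sup>+x. u x \<partial>count_space X) = (\<integral>\<^sup>+x. u x * indicator X x \<partial>count_space UNIV)" for u :: "'c \<Rightarrow> ennreal" and X
    by (simp add: nn_integral_count_space_indicator)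
  have "(\<integral>\<^sup>+b. f (a, b) \<partial>count_space B) * indicator A a = (\<integral>\<^sup>+b. ?f (a, b) \<partial>count_space UNIV)" for a
    by (cases "a \<in> A") (simp_all add: outer[of B] indicator_times)
  then show "(\<integral>\<^sup>+a. \<integral>\<^sup>+b. f (a, b) \<partial>count_space B \<partial>count_space A) = integral\<^sup>N (count_space (A \<times> B)) f"
    unfolding outer[of A] using nn_integral_fst_count_space[of ?f] 0 by simp
  have "(\<integral>\<^sup>+a. f (a, b) \<partial>count_space A) * indicator B b = (\<integral>\<^sup>+a. ?f (a, b) \<partial>count_space UNIV)" for b
    by (cases "b \<in> B") (simp_all add: outer[of A] indicator_times)
  then show "(\<integral>\<^sup>+b. \<integral>\<^sup>+a. f (a, b) \<partial>count_space A \<partial>count_space B) = integral\<^sup>N (count_space (A \<times> B)) f"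
    unfolding outer[of B] using nn_integral_snd_count_space[of ?f] 0 by simp
qed

text \<open>
  The bounded parts of the sets where \<open>G > k\<close> and where \<open>G < k\<close> serve as \<open>E\<close>; a set of positive
  measure of either kind would contradict the value of the integral.
\<close>

lemma AE_eq_const_from_integrals:
  fixes G :: "'a::euclidean_space \<Rightarrow> ennreal"
  assumes G [measurable]: "G \<in> borel_measurable lebesgue"
    and eq: "\<And>E. E \<in> lmeasurable \<Longrightarrow> measure lebesgue E > 0 \<Longrightarrow>
        (\<integral>\<^sup>+x. G x * indicator E x \<partial>lebesgue) = ennreal (k * measure lebesgue E)"
    and k: "0 \<le> k"
  shows "AE x in lebesgue. G x = ennreal k"
proof -
  define P where "P = (\<lambda>n::nat. {x \<in> cball 0 (real n). G x > ennreal k})"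
  define Q where "Q = (\<lambda>n::nat. {x \<in> cball 0 (real n). G x < ennreal k})"
  have S: "P n \<in> sets lebesgue" "Q n \<in> sets lebesgue" for n
  proof -
    have "P n = cball 0 (real n) \<inter> {x \<in> space lebesgue. G x > ennreal k}"
      "Q n = cball 0 (real n) \<inter> {x \<in> space lebesgue. G x < ennreal k}" by (auto simp: P_def Q_def)
    moreover have "cball 0 (real n) \<inter> {x \<in> space lebesgue. G x > ennreal k} \<in> sets lebesgue"
      "cball 0 (real n) \<inter> {x \<in> space lebesgue. G x < ennreal k} \<in> sets lebesgue"
      by (intro sets.Int borel_measurable_less borel_measurable_const G; simp)+
    ultimately show "P n \<in> sets lebesgue" "Q n \<in> sets lebesgue" by simp_all
  qed
  have b: "bounded (P n)" "bounded (Q n)" for n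
    by (auto simp: P_def Q_def intro: bounded_subset[OF bounded_cball[of 0 "real n"]])
  have lm: "P n \<in> lmeasurable" "Q n \<in> lmeasurable" for n
    using b S by (auto intro: bounded_set_imp_lmeasurable)
  have null: "A \<in> null_sets lebesgue"
    if A: "A \<in> lmeasurable" and u: "u \<in> borel_measurable lebesgue" and u0: "\<And>x. x \<in> A \<Longrightarrow> u x \<noteq> 0"
      and ueq: "measure lebesgue A > 0 \<Longrightarrow> (\<integral>\<^sup>+x. u x * indicator A x \<partial>lebesgue) = 0" for A and u :: "'a \<Rightarrow> ennreal"
  proof (cases "measure lebesgue A > 0")
    case True
    have [measurable]: "A \<in> sets lebesgue" "u \<in> borel_measurable lebesgue" using A u by auto
    have "AE x in lebesgue. u x * indicator A x = 0"
      using ueq[OF True] by (subst (asm) nn_integral_0_iff_AE) auto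
    then have "AE x in lebesgue. x \<notin> A" by eventually_elim (use u0 in \<open>auto simp: indicator_def\<close>)
    then show ?thesis by (subst AE_iff_null_sets) auto
  next
    case False
    then have "measure lebesgue A = 0" using measure_nonneg[of lebesgue A] by linarith
    then show ?thesis using A by (simp add: emeasure_eq_measure2 null_sets_def)
  qed
  have "P n \<in> null_sets lebesgue" for n
  proof (rule null[OF lm(1)])
    show "(\<lambda>x. G x - ennreal k) \<in> borel_measurable lebesgue" by measurable
    show "G x - ennreal k \<noteq> 0" if "x \<in> P n" for x using that by (auto simp: P_def diff_eq_0_iff_ennreal)
    assume p: "measure lebesgue (P n) > 0"
    have [measurable]: "P n \<in> sets lebesgue" using S by simp
    have "ennreal (k * measure lebesgue (P n)) = (\<integral>\<^sup>+x. G x * indicator (P n) x \<partial>lebesgue)"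
      by (rule eq[OF lm(1) p, symmetric])
    also have "\<dots> = (\<integral>\<^sup>+x. ennreal k * indicator (P n) x + (G x - ennreal k) * indicator (P n) x \<partial>lebesgue)"
      by (intro nn_integral_cong) (auto simp: P_def add_diff_inverse_ennreal split: split_indicator)
    also have "\<dots> = ennreal k * emeasure lebesgue (P n) + (\<integral>\<^sup>+x. (G x - ennreal k) * indicator (P n) x \<partial>lebesgue)"
      by (subst nn_integral_add) (auto simp: nn_integral_cmult)
    also have "ennreal k * emeasure lebesgue (P n) = ennreal (k * measure lebesgue (P n))"
      using lm(1)[of n] k by (simp add: emeasure_eq_measure2 ennreal_mult)
    finally have "ennreal (k * measure lebesgue (P n)) + 0 = ennreal (k * measure lebesgue (P n)) + (\<integral>\<^sup>+x. (G x - ennreal k) * indicator (P n) x \<partial>lebesgue)"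
      by simp
    then show "(\<integral>\<^sup>+x. (G x - ennreal k) * indicator (P n) x \<partial>lebesgue) = 0"
      by (subst (asm) ennreal_add_left_cancel) auto
  qed
  moreover have "Q n \<in> null_sets lebesgue" for n
  proof (rule null[OF lm(2)])
    show "(\<lambda>x. ennreal k - G x) \<in> borel_measurable lebesgue" by measurable
    show "ennreal k - G x \<noteq> 0" if "x \<in> Q n" for x using that by (auto simp: Q_def diff_eq_0_iff_ennreal)
    assume p: "measure lebesgue (Q n) > 0"
    have [measurable]: "Q n \<in> sets lebesgue" using S by simp
    have "ennreal (k * measure lebesgue (Q n)) = ennreal k * emeasure lebesgue (Q n)"
      using lm(2)[of n] k by (simp add: emeasure_eq_measure2 ennreal_mult)
    also have "\<dots> = (\<integral>\<^sup>+x. ennreal k * indicator (Q n) x \<partial>lebesgue)" by (simp add: nn_integral_cmult)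
    also have "\<dots> = (\<integral>\<^sup>+x. G x * indicator (Q n) x + (ennreal k - G x) * indicator (Q n) x \<partial>lebesgue)"
      by (intro nn_integral_cong) (auto simp: Q_def add_diff_inverse_ennreal split: split_indicator)
    also have "\<dots> = (\<integral>\<^sup>+x. G x * indicator (Q n) x \<partial>lebesgue) + (\<integral>\<^sup>+x. (ennreal k - G x) * indicator (Q n) x \<partial>lebesgue)"
      by (subst nn_integral_add) auto
    also have "(\<integral>\<^sup>+x. G x * indicator (Q n) x \<partial>lebesgue) = ennreal (k * measure lebesgue (Q n))" by (rule eq[OF lm(2) p])
    finally have "ennreal (k * measure lebesgue (Q n)) + 0 = ennreal (k * measure lebesgue (Q n)) + (\<integral>\<^sup>+x. (ennreal k - G x) * indicator (Q n) x \<partial>lebesgue)"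
      by simp
    then show "(\<integral>\<^sup>+x. (ennreal k - G x) * indicator (Q n) x \<partial>lebesgue) = 0"
      by (subst (asm) ennreal_add_left_cancel) auto
  qed
  ultimately have "AE x in lebesgue. \<forall>n. x \<notin> P n \<and> x \<notin> Q n"
    unfolding AE_all_countable by (auto intro!: AE_conjI AE_not_in)
  then show ?thesis
  proof eventually_elim
    case (elim x)
    obtain n where "norm x \<le> real n" using real_arch_simple by blast
    then show ?case using elim[rule_format, of n] by (auto simp: P_def Q_def)
  qed
qed

text \<open>
  The sum \<open>H\<close> over \<open>a\<close> of the squared windowed transforms tiles along \<open>B\<close> by hypothesis, and Plancherel's
  theorem evaluates its integral. Time and frequency sides of a Gabor basis are both instances.
\<close>

lemma windowed_Parseval_uniform_density:
  fixes g :: "real ^ 'd \<Rightarrow> complex"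
  assumes g: "g \<in> L2" and A: "countable A" and B: "countable B"
    and E: "E \<in> lmeasurable" "measure lebesgue E > 0"
    and par: "\<And>\<eta>. (\<integral>\<^sup>+b. \<integral>\<^sup>+a. ennreal ((cmod (fourier_integral (\<lambda>x. indicator E x *\<^sub>R g (x - a)) (\<eta> - b)))\<^sup>2)
         \<partial>count_space A \<partial>count_space B) = ennreal (measure lebesgue E)"
  defines "G \<equiv> \<lambda>x. \<integral>\<^sup>+a. ennreal ((cmod (g (x - a)))\<^sup>2) \<partial>count_space A"
  shows "0 < (\<integral>\<^sup>+x. G x * indicator E x \<partial>lebesgue)"
    and "has_uniform_density B (enn2real (ennreal (measure lebesgue E) / (\<integral>\<^sup>+x. G x * indicator E x \<partial>lebesgue)))"
proof -
  have [measurable]: "g \<in> borel_measurable lebesgue" "E \<in> sets lebesgue" using g E by (auto intro: L2_measurable)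
  let ?h = "\<lambda>a x. indicator E x *\<^sub>R g (x - a)"
  have h: "integrable lebesgue (?h a)" "?h a \<in> L2" for a
    using L2_mult_indicator[OF L2_translate[OF g] E(1)] by auto
  define H where "H = (\<lambda>u. \<integral>\<^sup>+a. ennreal ((cmod (fourier_integral (?h a) u))\<^sup>2) \<partial>count_space A)"
  have m: "(\<lambda>u. ennreal ((cmod (fourier_integral (?h a) u))\<^sup>2)) \<in> borel_measurable lebesgue" for a
    using L2_measurable[OF Plancherel(1)[OF h]] by measurable
  have Hm: "H \<in> borel_measurable lebesgue"
    unfolding H_def by (intro borel_measurable_nn_integral_count_space A m)
  have "integral\<^sup>N lebesgue H = (\<integral>\<^sup>+a. (\<integral>\<^sup>+u. ennreal ((cmod (fourier_integral (?h a) u))\<^sup>2) \<partial>lebesgue) \<partial>count_space A)"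
    unfolding H_def by (intro nn_integral_count_space_nn_integral A m)
  also have "\<dots> = (\<integral>\<^sup>+a. (\<integral>\<^sup>+x. ennreal ((cmod (g (x - a)))\<^sup>2) * indicator E x \<partial>lebesgue) \<partial>count_space A)"
  proof (rule nn_integral_cong)
    fix a
    have "(\<integral>\<^sup>+u. ennreal ((cmod (fourier_integral (?h a) u))\<^sup>2) \<partial>lebesgue) = ennreal (LINT x|lebesgue. (cmod (?h a x))\<^sup>2)"
      using nn_integral_eq_integral[OF L2_integrable[OF Plancherel(1)[OF h]], of a] Plancherel(2)[OF h, of a] by simp
    also have "\<dots> = (\<integral>\<^sup>+x. ennreal ((cmod (?h a x))\<^sup>2) \<partial>lebesgue)"
      using nn_integral_eq_integral[OF L2_integrable[OF h(2)], of a] by simp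
    also have "\<dots> = (\<integral>\<^sup>+x. ennreal ((cmod (g (x - a)))\<^sup>2) * indicator E x \<partial>lebesgue)"
      by (intro nn_integral_cong) (auto split: split_indicator)
    finally show "(\<integral>\<^sup>+u. ennreal ((cmod (fourier_integral (?h a) u))\<^sup>2) \<partial>lebesgue)
        = (\<integral>\<^sup>+x. ennreal ((cmod (g (x - a)))\<^sup>2) * indicator E x \<partial>lebesgue)" .
  qed
  also have "\<dots> = (\<integral>\<^sup>+x. (\<integral>\<^sup>+a. ennreal ((cmod (g (x - a)))\<^sup>2) * indicator E x \<partial>count_space A) \<partial>lebesgue)"
    by (intro nn_integral_count_space_nn_integral[symmetric] A) measurable
  also have "\<dots> = (\<integral>\<^sup>+x. G x * indicator E x \<partial>lebesgue)"
    unfolding G_def by (intro nn_integral_cong nn_integral_multc) auto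
  finally have int: "integral\<^sup>N lebesgue H = (\<integral>\<^sup>+x. G x * indicator E x \<partial>lebesgue)" .
  have tile: "AE \<eta> in lebesgue. (\<integral>\<^sup>+b. H (\<eta> - b) \<partial>count_space B) = ennreal (measure lebesgue E)"
    using par unfolding H_def by simp
  show "0 < (\<integral>\<^sup>+x. G x * indicator E x \<partial>lebesgue)"
    "has_uniform_density B (enn2real (ennreal (measure lebesgue E) / (\<integral>\<^sup>+x. G x * indicator E x \<partial>lebesgue)))"
    using tiling_uniform_density[OF B Hm tile E(2)] unfolding int by simp_all
qed

text \<open>
  The density of \<open>B\<close> is the same for every window \<open>E\<close>, so the integrals of the periodization over all \<open>E\<close> are
  proportional to \<open>|E|\<close>. Positivity of the density excludes that they are infinite.
\<close>

lemma windowed_Parseval_AE_const: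
  fixes g :: "real ^ 'd \<Rightarrow> complex"
  assumes g: "g \<in> L2" and A: "countable A" and B: "countable B"
    and par: "\<And>E \<eta>. E \<in> lmeasurable \<Longrightarrow>
        (\<integral>\<^sup>+b. \<integral>\<^sup>+a. ennreal ((cmod (fourier_integral (\<lambda>x. indicator E x *\<^sub>R g (x - a)) (\<eta> - b)))\<^sup>2)
         \<partial>count_space A \<partial>count_space B) = ennreal (measure lebesgue E)"
    and pos: "0 < uniform_density B"
  shows "AE x in lebesgue. (\<integral>\<^sup>+a. ennreal ((cmod (g (x - a)))\<^sup>2) \<partial>count_space A) = ennreal (1 / uniform_density B)"
proof (rule AE_eq_const_from_integrals)
  let ?G = "\<lambda>x. \<integral>\<^sup>+a. ennreal ((cmod (g (x - a)))\<^sup>2) \<partial>count_space A"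
  have [measurable]: "g \<in> borel_measurable lebesgue" using g by (rule L2_measurable)
  show "?G \<in> borel_measurable lebesgue"
    by (intro borel_measurable_nn_integral_count_space A) measurable
  show "0 \<le> 1 / uniform_density B" using pos by simp
  fix E :: "(real ^ 'd) set" assume E: "E \<in> lmeasurable" "measure lebesgue E > 0"
  let ?I = "\<integral>\<^sup>+x. ?G x * indicator E x \<partial>lebesgue"
  note X = windowed_Parseval_uniform_density[OF g A B E par[OF E(1)]]
  have D: "uniform_density B = enn2real (ennreal (measure lebesgue E) / ?I)"
    by (rule uniform_density_eq[OF X(2)])
  have "?I \<noteq> \<infinity>" using D pos by auto
  then obtain i where i: "?I = ennreal i" "i \<ge> 0" by (cases ?I) auto
  have "i > 0" using X(1) i by simp
  then have "uniform_density B = measure lebesgue E / i"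
    unfolding D i(1) using E(2) by (simp add: divide_ennreal)
  then have "i = 1 / uniform_density B * measure lebesgue E"
    using \<open>i > 0\<close> E(2) pos by (simp add: field_simps)
  then show "?I = ennreal (1 / uniform_density B * measure lebesgue E)" using i(1) by simp
qed

lemma L2_indicator:
  fixes E :: "(real ^ 'd) set"
  assumes E: "E \<in> lmeasurable"
  shows "(\<lambda>x. indicator E x :: complex) \<in> L2" "integrable lebesgue (\<lambda>x. indicator E x :: complex)"
    "(LINT x|lebesgue. (cmod (indicator E x))\<^sup>2) = measure lebesgue E"
proof -
  have [measurable]: "E \<in> sets lebesgue" using E by auto
  have i: "integrable lebesgue (indicat_real E)" using E by (simp add: fmeasurable_def)
  have eq: "(cmod (indicator E x))\<^sup>2 = indicat_real E x" for x by (auto split: split_indicator)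
  show "(\<lambda>x. indicator E x :: complex) \<in> L2" using i by (simp add: L2_def eq)
  have "integrable lebesgue (\<lambda>x. complex_of_real (indicat_real E x))" using i by simp
  moreover have "(\<lambda>x. complex_of_real (indicat_real E x)) = (\<lambda>x. indicator E x)" by (auto simp: indicator_def)
  ultimately show "integrable lebesgue (\<lambda>x. indicator E x :: complex)" by simp
  show "(LINT x|lebesgue. (cmod (indicator E x))\<^sup>2) = measure lebesgue E"
    unfolding eq using E by simp
qed

lemma Parseval_nn_integral:
  assumes "L2_orthonormal_basis I e" "f \<in> L2"
  shows "(\<integral>\<^sup>+i. ennreal ((cmod (L2_inner f (e i)))\<^sup>2) \<partial>count_space I) = ennreal (LINT x|lebesgue. (cmod (f x))\<^sup>2)"
  using L2_Parseval[OF assms] unfolding L2_norm_power2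
  by (subst (asm) has_sum_iff_nn_integral_count_space) (auto simp: integral_nonneg_AE)

section \<open>Gabor orthonormal bases\<close>

text \<open>
  Parseval's identity for \<open>1\<^sub>E\<close> modulated by \<open>\<eta>\<close>.
\<close>

lemma gabor_time_Parseval:
  fixes g :: "real ^ 'd \<Rightarrow> complex"
  assumes onb: "L2_orthonormal_basis (T \<times> S) (gabor g)" and E: "E \<in> lmeasurable"
  shows "(\<integral>\<^sup>+s. \<integral>\<^sup>+t. ennreal ((cmod (fourier_integral (\<lambda>x. indicator E x *\<^sub>R g (x - t)) (\<eta> - s)))\<^sup>2)
         \<partial>count_space T \<partial>count_space S) = ennreal (measure lebesgue E)"
proof -
  let ?f = "\<lambda>x. indicator E x * wave ((- \<eta>) \<bullet> x)"
  have f: "?f \<in> L2" by (rule L2_mult_wave[OF L2_indicator(1)[OF E]])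
  have nf: "(LINT x|lebesgue. (cmod (?f x))\<^sup>2) = measure lebesgue E"
    using L2_indicator(3)[OF E] by (simp add: norm_mult)
  have "cmod (L2_inner ?f (gabor g (t, s))) = cmod (fourier_integral (\<lambda>x. indicator E x *\<^sub>R g (x - t)) (\<eta> - s))" for t s
  proof -
    have "L2_inner ?f (gabor g (t, s)) = (LINT x|lebesgue. cnj ((indicator E x *\<^sub>R g (x - t)) * wave ((\<eta> - s) \<bullet> x)))"
      unfolding L2_inner_def
    proof (intro Bochner_Integration.integral_cong refl)
      fix x
      have "wave ((- \<eta>) \<bullet> x) * wave (s \<bullet> x) = cnj (wave ((\<eta> - s) \<bullet> x))"
        unfolding wave_minus[symmetric] wave_add[symmetric] by (simp add: inner_diff_left)
      then show "?f x * cnj (gabor g (t, s) x) = cnj ((indicator E x *\<^sub>R g (x - t)) * wave ((\<eta> - s) \<bullet> x))"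
        by (auto simp: gabor_wave wave_minus[of "s \<bullet> x"] indicator_def mult_ac)
    qed
    also have "\<dots> = cnj (fourier_integral (\<lambda>x. indicator E x *\<^sub>R g (x - t)) (\<eta> - s))"
      unfolding fourier_integral_wave by (rule Bochner_Integration.integral_cnj)
    finally show ?thesis by simp
  qed
  then show ?thesis
    using Parseval_nn_integral[OF onb f] unfolding nf
    by (simp add: nn_integral_count_space_Times_snd[symmetric])
qed

text \<open>
  Parseval's identity for \<open>x \<mapsto> F 1\<^sub>E (\<eta> - x)\<close>, whose norm is that of \<open>1\<^sub>E\<close>. The conjugate on \<open>h\<close> only
  serves to keep the transform in its standard sign.
\<close>

lemma gabor_frequency_Parseval:
  fixes g h :: "real ^ 'd \<Rightarrow> complex"
  assumes onb: "L2_orthonormal_basis (T \<times> S) (gabor g)" and g: "g \<in> L2" and gh: "is_fourier_L2 g h"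
    and E: "E \<in> lmeasurable"
  shows "(\<integral>\<^sup>+t. \<integral>\<^sup>+s. ennreal ((cmod (fourier_integral (\<lambda>x. indicator E x *\<^sub>R cnj (h (x - s))) (\<eta> - t)))\<^sup>2)
         \<partial>count_space S \<partial>count_space T) = ennreal (measure lebesgue E)"
proof -
  have h: "h \<in> L2" using gh by (auto simp: is_fourier_L2_def L2_tendsto_def)
  have [measurable]: "g \<in> borel_measurable lebesgue" "h \<in> borel_measurable lebesgue" "E \<in> sets lebesgue"
    using g h E by (auto intro: L2_measurable)
  let ?o = "\<lambda>x. indicator E x :: complex"
  note L1 = L2_indicator[OF E]
  let ?\<phi> = "\<lambda>x. fourier_integral ?o (\<eta> - x)"
  have F1: "fourier_integral ?o \<in> L2" by (rule Plancherel(1)[OF L1(2,1)])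
  have [measurable]: "fourier_integral ?o \<in> borel_measurable lebesgue" using F1 by (rule L2_measurable)
  have p: "?\<phi> \<in> L2" by (rule L2_reflect[OF F1])
  have np: "(LINT x|lebesgue. (cmod (?\<phi> x))\<^sup>2) = measure lebesgue E"
    using integral_lebesgue_reflect[of "\<lambda>x. (cmod (fourier_integral ?o x))\<^sup>2" \<eta>] Plancherel(2)[OF L1(2,1)] L1(3) by simp
  have "cmod (L2_inner ?\<phi> (gabor g (t, s))) = cmod (fourier_integral (\<lambda>x. indicator E x *\<^sub>R cnj (h (x - s))) (\<eta> - t))" for t s
  proof -
    (* The test function u is the reflected and modulated indicator; its transform is a modulated translate of F 1_E. *)
    let ?c = "\<lambda>v. ?o v * wave ((\<eta> - t) \<bullet> v)"
    let ?u = "\<lambda>\<xi>. ?c (s - \<xi>)"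
    have c: "integrable lebesgue ?c" "?c \<in> L2"
      by (rule integrable_mult_wave[OF L1(2)], rule L2_mult_wave[OF L1(1)])
    have [measurable]: "?c \<in> borel_measurable lebesgue" using c(1) by auto
    have u: "integrable lebesgue ?u" "?u \<in> L2"
      using c(1) integrable_lebesgue_reflect[of ?c s] L2_reflect[OF c(2), of s] by simp_all
    have Fu: "fourier_integral ?u x = wave (x \<bullet> s) * fourier_integral ?o (\<eta> - t - x)" for x
    proof -
      have "fourier_integral ?u x = (LINT \<xi>|lebesgue. (\<lambda>v. ?c v * wave (x \<bullet> (s - v))) (s - \<xi>))"
        unfolding fourier_integral_wave by simp
      also have "\<dots> = (LINT v|lebesgue. ?c v * wave (x \<bullet> (s - v)))"
      proof (rule integral_lebesgue_reflect)
        have "(\<lambda>v. wave (x \<bullet> (s - v))) \<in> borel_measurable lebesgue" by (rule measurable_completion) measurable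
        then show "(\<lambda>v. ?c v * wave (x \<bullet> (s - v))) \<in> borel_measurable lebesgue" by measurable
      qed
      also have "\<dots> = (LINT v|lebesgue. wave (x \<bullet> s) * (?o v * wave ((\<eta> - t - x) \<bullet> v)))"
      proof (intro Bochner_Integration.integral_cong refl)
        fix v
        have "wave ((\<eta> - t) \<bullet> v) * wave (x \<bullet> (s - v)) = wave (x \<bullet> s) * wave ((\<eta> - t - x) \<bullet> v)"
          unfolding wave_add[symmetric] by (simp add: inner_diff_left inner_diff_right algebra_simps)
        then show "?c v * wave (x \<bullet> (s - v)) = wave (x \<bullet> s) * (?o v * wave ((\<eta> - t - x) \<bullet> v))"
          by (simp add: mult.assoc)
      qed
      finally show ?thesis by (simp add: fourier_integral_wave)
    qed
    have "fourier_integral (\<lambda>x. indicator E x *\<^sub>R cnj (h (x - s))) (\<eta> - t) = (LINT \<xi>|lebesgue. (\<lambda>\<xi>. ?u (- \<xi>) * cnj (h \<xi>)) (\<xi> - s))"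
      unfolding fourier_integral_wave by (intro Bochner_Integration.integral_cong refl) (auto simp: indicator_def)
    also have "\<dots> = (LINT \<xi>|lebesgue. ?u (- \<xi>) * cnj (h \<xi>))"
    proof (rule integral_lebesgue_translate)
      have "(\<lambda>\<xi>. ?u (0 - \<xi>)) \<in> L2" by (rule L2_reflect[OF u(2)])
      then have "(\<lambda>\<xi>. ?u (- \<xi>)) \<in> borel_measurable lebesgue" by (auto dest: L2_measurable)
      then show "(\<lambda>\<xi>. ?u (- \<xi>) * cnj (h \<xi>)) \<in> borel_measurable lebesgue" by measurable
    qed
    also have "\<dots> = (LINT x|lebesgue. fourier_integral ?u x * cnj (g x))"
      by (rule is_fourier_L2_pairing[OF gh u, symmetric])
    also have "\<dots> = (LINT x|lebesgue. fourier_integral ?u (x - t) * cnj (g (x - t)))"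
    proof (rule integral_lebesgue_translate[symmetric])
      have "fourier_integral ?u \<in> borel_measurable lebesgue" by (rule L2_measurable[OF Plancherel(1)[OF u]])
      then show "(\<lambda>x. fourier_integral ?u x * cnj (g x)) \<in> borel_measurable lebesgue" by measurable
    qed
    also have "\<dots> = (LINT x|lebesgue. wave (- (s \<bullet> t)) * (?\<phi> x * cnj (gabor g (t, s) x)))"
    proof (intro Bochner_Integration.integral_cong refl)
      fix x
      have "wave ((x - t) \<bullet> s) = wave (- (s \<bullet> t)) * wave (s \<bullet> x)"
        unfolding wave_add[symmetric] using inner_commute[of x s] inner_commute[of t s] by (simp add: inner_diff_left)
      then show "fourier_integral ?u (x - t) * cnj (g (x - t)) = wave (- (s \<bullet> t)) * (?\<phi> x * cnj (gabor g (t, s) x))"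
        unfolding Fu gabor_wave by (simp add: wave_minus[of "s \<bullet> x"] mult_ac)
    qed
    also have "\<dots> = wave (- (s \<bullet> t)) * L2_inner ?\<phi> (gabor g (t, s))"
      by (simp add: L2_inner_def)
    finally show ?thesis by (simp add: norm_mult)
  qed
  then show ?thesis
    using Parseval_nn_integral[OF onb p] unfolding np
    by (simp add: nn_integral_count_space_Times_fst[symmetric])
qed

text \<open>
  Translates of \<open>g\<close> by nearby vectors have inner product of real part at least \<open>1 / 2\<close>, so each point \<open>t\<close> near \<open>y\<close>
  uses up \<open>1 / 4\<close> in Bessel's inequality for the unit vector \<open>gabor g (y, s)\<close>.
\<close>

lemma gabor_translates_locally_bounded:
  fixes g :: "real ^ 'd \<Rightarrow> complex"
  assumes onb: "L2_orthonormal_basis (T \<times> S) (gabor g)" and g: "g \<in> L2" and s: "s \<in> S"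
    and g1: "(LINT x|lebesgue. (cmod (g x))\<^sup>2) = 1"
  obtains \<delta> where "\<delta> > 0" "\<And>y. finite (T \<inter> ball y \<delta>)" "\<And>y. card (T \<inter> ball y \<delta>) \<le> 4"
proof -
  have [measurable]: "g \<in> borel_measurable lebesgue" using g by (rule L2_measurable)
  have "((\<lambda>u. LINT x|lebesgue. (cmod (g (x - u) - g x))\<^sup>2) \<longlongrightarrow> 0) (at 0)"
    unfolding LIMSEQ_SEQ_conv[symmetric] using L2_translate_tendsto[OF g] by blast
  then have "\<forall>\<^sub>F u in at 0. (LINT x|lebesgue. (cmod (g (x - u) - g x))\<^sup>2) < 1"
    by (rule order_tendstoD(2)) simp
  then obtain \<delta> where d: "\<delta> > 0" and du: "\<And>u. u \<noteq> 0 \<Longrightarrow> norm u < \<delta> \<Longrightarrow> (LINT x|lebesgue. (cmod (g (x - u) - g x))\<^sup>2) < 1"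
    unfolding eventually_at by (auto simp: dist_norm)
  have du': "(LINT x|lebesgue. (cmod (g (x - u) - g x))\<^sup>2) \<le> 1" if "norm u < \<delta>" for u
    using du[of u] that by (cases "u = 0") auto
  have card: "card F \<le> 4" if F: "F \<subseteq> T \<inter> ball y \<delta>" "finite F" for F y
  proof -
    let ?f = "gabor g (y, s)"
    have "?f = (\<lambda>x. g (x - y) * wave ((- s) \<bullet> x))" by (simp add: gabor_wave fun_eq_iff)
    then have f: "?f \<in> L2" using L2_mult_wave[OF L2_translate[OF g, of y], of "- s"] by simp
    have f1: "(L2_norm ?f)\<^sup>2 = 1"
      using g1 integral_lebesgue_translate[of "\<lambda>x. (cmod (g x))\<^sup>2" y] by (simp add: L2_norm_power2 gabor_wave norm_mult)
    have ge: "1 / 4 \<le> (cmod (L2_inner ?f (gabor g (t, s))))\<^sup>2" if "t \<in> F" for t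
    proof -
      have "norm (t - y) < \<delta>" using that F by (auto simp: dist_norm norm_minus_commute)
      then have "1 / 2 \<le> Re (LINT x|lebesgue. g x * cnj (g (x - (t - y))))"
        unfolding autocorrelation_Re[OF g] g1 using du'[of "t - y"] by simp
      also have "(LINT x|lebesgue. g x * cnj (g (x - (t - y)))) = (LINT x|lebesgue. g (x - y) * cnj (g (x - y - (t - y))))"
        by (rule integral_lebesgue_translate[symmetric, of "\<lambda>x. g x * cnj (g (x - (t - y)))"]) measurable
      also have "\<dots> = L2_inner ?f (gabor g (t, s))"
        unfolding L2_inner_def gabor_wave
        by (intro Bochner_Integration.integral_cong refl) (simp add: mult.assoc mult.left_commute[of "wave _"])
      also have "Re \<dots> \<le> cmod \<dots>" by (rule complex_Re_le_cmod)
      finally have "(1 / 2)\<^sup>2 \<le> (cmod (L2_inner ?f (gabor g (t, s))))\<^sup>2" by (intro power_mono) auto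
      then show ?thesis by (simp add: power2_eq_square)
    qed
    have "real (card F) * (1 / 4) \<le> (\<Sum>t\<in>F. (cmod (L2_inner ?f (gabor g (t, s))))\<^sup>2)"
      using sum_mono[of F "\<lambda>_. 1 / 4", OF ge] by simp
    also have "\<dots> = (\<Sum>i\<in>F \<times> {s}. (cmod (L2_inner ?f (gabor g i)))\<^sup>2)"
      by (rule sum.reindex_bij_witness[of _ fst "\<lambda>t. (t, s)"]) auto
    also have "\<dots> \<le> 1"
      unfolding f1[symmetric] by (rule L2_Bessel[OF onb f]) (use F s in auto)
    finally show ?thesis by simp
  qed
  show thesis
  proof (rule that[OF d])
    fix y
    have "finite (T \<inter> ball y \<delta>) \<and> card (T \<inter> ball y \<delta>) \<le> 4"
      by (rule finite_if_finite_subsets_card_bdd) (use card in auto)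
    then show "finite (T \<inter> ball y \<delta>)" "card (T \<inter> ball y \<delta>) \<le> 4" by auto
  qed
qed

text \<open>
  After Tonelli's theorem and a translation, each value \<open>|g u|\<^sup>2\<close> is counted once for every point of \<open>T\<close> in the
  ball at \<open>- u\<close>.
\<close>

lemma nn_integral_translates_over_ball_le:
  fixes g :: "real ^ 'd \<Rightarrow> complex"
  assumes g: "g \<in> L2" and T: "countable T"
    and fin: "\<And>y. finite (T \<inter> ball y \<delta>)" and card: "\<And>y. card (T \<inter> ball y \<delta>) \<le> N"
  shows "(\<integral>\<^sup>+x. (\<integral>\<^sup>+t. ennreal ((cmod (g (x - t)))\<^sup>2) \<partial>count_space T) * indicator (ball 0 \<delta>) x \<partial>lebesgue)
     \<le> ennreal (real N * (LINT x|lebesgue. (cmod (g x))\<^sup>2))"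
proof -
  have [measurable]: "g \<in> borel_measurable lebesgue" "ball 0 \<delta> \<in> sets lebesgue" using g by (auto intro: L2_measurable)
  let ?B = "ball 0 \<delta> :: (real ^ 'd) set" and ?g = "\<lambda>x. ennreal ((cmod (g x))\<^sup>2)"
  have [measurable]: "(\<lambda>u. indicator ?B (u + t) :: ennreal) \<in> borel_measurable lebesgue" for t
    by (rule measurable_compose[OF measurable_lebesgue_add borel_measurable_indicator]) simp
  have "(\<integral>\<^sup>+x. (\<integral>\<^sup>+t. ?g (x - t) \<partial>count_space T) * indicator ?B x \<partial>lebesgue)
     = (\<integral>\<^sup>+x. (\<integral>\<^sup>+t. ?g (x - t) * indicator ?B x \<partial>count_space T) \<partial>lebesgue)"
    by (intro nn_integral_cong nn_integral_multc[symmetric]) auto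
  also have "\<dots> = (\<integral>\<^sup>+t. (\<integral>\<^sup>+x. ?g (x - t) * indicator ?B x \<partial>lebesgue) \<partial>count_space T)"
    by (intro nn_integral_count_space_nn_integral T) measurable
  also have "\<dots> = (\<integral>\<^sup>+t. (\<integral>\<^sup>+u. ?g u * indicator ?B (u + t) \<partial>lebesgue) \<partial>count_space T)"
  proof (rule nn_integral_cong)
    fix t show "(\<integral>\<^sup>+x. ?g (x - t) * indicator ?B x \<partial>lebesgue) = (\<integral>\<^sup>+u. ?g u * indicator ?B (u + t) \<partial>lebesgue)"
      using nn_integral_lebesgue_translate[of "\<lambda>u. ?g u * indicator ?B (u + t)" t] by simp
  qed
  also have "\<dots> = (\<integral>\<^sup>+u. (\<integral>\<^sup>+t. ?g u * indicator ?B (u + t) \<partial>count_space T) \<partial>lebesgue)"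
    by (intro nn_integral_count_space_nn_integral[symmetric] T) measurable
  also have "\<dots> \<le> (\<integral>\<^sup>+u. ?g u * ennreal (real N) \<partial>lebesgue)"
  proof (rule nn_integral_mono)
    fix u
    have "(\<integral>\<^sup>+t. ?g u * indicator ?B (u + t) \<partial>count_space T) = ?g u * (\<integral>\<^sup>+t. indicator ?B (u + t) \<partial>count_space T)"
      by (rule nn_integral_cmult) simp
    also have "(\<integral>\<^sup>+t. indicator ?B (u + t) \<partial>count_space T) = (\<integral>\<^sup>+t. indicator (T \<inter> ball (- u) \<delta>) t \<partial>count_space T)"
      by (intro nn_integral_cong) (auto simp: indicator_def dist_norm norm_minus_commute add.commute)
    also have "\<dots> = ennreal (real (card (T \<inter> ball (- u) \<delta>)))"
      using fin[of "- u"] by (simp add: emeasure_count_space ennreal_of_nat_eq_real_of_nat)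
    also have "?g u * ennreal (real (card (T \<inter> ball (- u) \<delta>))) \<le> ?g u * ennreal (real N)"
      using card[of "- u"] by (intro mult_left_mono ennreal_leI) auto
    finally show "(\<integral>\<^sup>+t. ?g u * indicator ?B (u + t) \<partial>count_space T) \<le> ?g u * ennreal (real N)" .
  qed
  also have "\<dots> = ennreal (LINT x|lebesgue. (cmod (g x))\<^sup>2) * ennreal (real N)"
    using nn_integral_eq_integral[OF L2_integrable[OF g]] by (subst nn_integral_multc) auto
  also have "\<dots> = ennreal (real N * (LINT x|lebesgue. (cmod (g x))\<^sup>2))"
    by (subst ennreal_mult[symmetric]) (auto simp: mult.commute integral_nonneg_AE)
  finally show ?thesis .
qed

theorem theorem1p2:
  fixes g :: "real ^ 'd \<Rightarrow> complex" and T S :: "(real ^ 'd) set"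
  assumes "g \<in> L2"
    and "countable T" and "countable S"
    and "L2_orthonormal_basis (T \<times> S) (gabor g)"
  shows "(AE x in lebesgue.
            ((\<lambda>t. (cmod (g (x - t)))\<^sup>2) has_sum uniform_density T) T) \<and>
         (AE \<xi> in lebesgue.
            ((\<lambda>s. (cmod (fourier_L2 g (\<xi> - s)))\<^sup>2) has_sum uniform_density S) S)"
proof -
  note g = assms(1) and T = assms(2) and S = assms(3) and onb = assms(4)
  have [measurable]: "g \<in> borel_measurable lebesgue" using g by (rule L2_measurable)
  have ball: "(ball 0 r :: (real ^ 'd) set) \<in> lmeasurable" "measure lebesgue (ball 0 r :: (real ^ 'd) set) > 0" if "r > 0" for r
    using that by (auto simp: content_ball_pos)
  (* An empty family would make every square integrable function null. *)
  have "T \<times> S \<noteq> {}"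
  proof
    assume "T \<times> S = {}"
    then have "ennreal (measure lebesgue (ball 0 1 :: (real ^ 'd) set)) = 0"
      using Parseval_nn_integral[OF onb L2_indicator(1)[OF ball(1)[of 1]]] L2_indicator(3)[OF ball(1)[of 1]]
      by (simp add: nn_integral_empty)
    then show False using ball(2)[of 1] by simp
  qed
  then obtain t0 s0 where ts: "t0 \<in> T" "s0 \<in> S" by auto
  have g1: "(LINT x|lebesgue. (cmod (g x))\<^sup>2) = 1"
  proof -
    have "L2_inner (gabor g (t0, s0)) (gabor g (t0, s0)) = 1"
      using onb ts by (auto simp: L2_orthonormal_basis_def)
    then have "(LINT x|lebesgue. (cmod (gabor g (t0, s0) x))\<^sup>2) = 1" by (simp add: L2_inner_self)
    then show ?thesis
      using integral_lebesgue_translate[of "\<lambda>x. (cmod (g x))\<^sup>2" t0] by (simp add: gabor_wave norm_mult)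
  qed
  obtain \<delta> where d: "\<delta> > 0" "\<And>y. finite (T \<inter> ball y \<delta>)" "\<And>y. card (T \<inter> ball y \<delta>) \<le> 4"
    using gabor_translates_locally_bounded[OF onb g ts(2) g1] by blast
  let ?G = "\<lambda>x. \<integral>\<^sup>+t. ennreal ((cmod (g (x - t)))\<^sup>2) \<partial>count_space T"
  let ?E = "ball 0 \<delta> :: (real ^ 'd) set"
  let ?I = "\<integral>\<^sup>+x. ?G x * indicator ?E x \<partial>lebesgue"
  have I4: "?I \<le> ennreal 4"
    using nn_integral_translates_over_ball_le[OF g T d(2,3)] g1 by simp
  note X = windowed_Parseval_uniform_density[OF g T S ball[OF d(1)] gabor_time_Parseval[OF onb ball(1)[OF d(1)]]]
  have "?I < \<infinity>" using I4 by (simp add: le_less_trans)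
  then obtain i where i: "?I = ennreal i" "i \<ge> 0" by (cases ?I) auto
  have i0: "i > 0" using X(1) i by simp
  have "uniform_density S = measure lebesgue ?E / i"
    using uniform_density_eq[OF X(2)] i(1) i0 ball(2)[OF d(1)] by (simp add: divide_ennreal)
  then have DS: "uniform_density S > 0" using ball(2)[OF d(1)] i0 by simp
  have G: "AE x in lebesgue. ?G x = ennreal (1 / uniform_density S)"
    by (rule windowed_Parseval_AE_const[OF g T S gabor_time_Parseval[OF onb] DS])
  have "has_uniform_density T (enn2real (ennreal (1 / uniform_density S) / (\<integral>\<^sup>+x. ennreal ((cmod (g x))\<^sup>2) \<partial>lebesgue)))"
    by (rule tiling_uniform_density(2)[OF T _ G]) (use DS in \<open>measurable, simp\<close>)
  moreover have "(\<integral>\<^sup>+x. ennreal ((cmod (g x))\<^sup>2) \<partial>lebesgue) = ennreal 1"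
    unfolding g1[symmetric] by (rule nn_integral_eq_integral[OF L2_integrable[OF g]]) simp
  ultimately have DT: "uniform_density T = 1 / uniform_density S"
    using DS by (simp add: uniform_density_eq divide_ennreal del: ennreal_1)
  have DT0: "uniform_density T > 0" unfolding DT using DS by simp
  have 1: "AE x in lebesgue. ((\<lambda>t. (cmod (g (x - t)))\<^sup>2) has_sum uniform_density T) T"
    using G by eventually_elim (use DS DT in \<open>simp add: has_sum_iff_nn_integral_count_space\<close>)
  let ?h = "fourier_L2 g"
  have gh: "is_fourier_L2 g ?h" by (rule is_fourier_L2_fourier_L2[OF g])
  have h: "(\<lambda>\<xi>. cnj (?h \<xi>)) \<in> L2" using gh by (intro L2_cnj) (auto simp: is_fourier_L2_def L2_tendsto_def)
  have "AE \<xi> in lebesgue. (\<integral>\<^sup>+s. ennreal ((cmod (cnj (?h (\<xi> - s))))\<^sup>2) \<partial>count_space S) = ennreal (1 / uniform_density T)"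
    by (rule windowed_Parseval_AE_const[OF h S T gabor_frequency_Parseval[OF onb g gh] DT0])
  then have 2: "AE \<xi> in lebesgue. ((\<lambda>s. (cmod (?h (\<xi> - s)))\<^sup>2) has_sum uniform_density S) S"
    by eventually_elim (use DS DT in \<open>simp add: has_sum_iff_nn_integral_count_space\<close>)
  from 1 2 show ?thesis by simp
qed

end
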